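(* Let $M$ be a time-like surface in the Robertson-Walker space-time $L^4_1(f,c)$. Then $M$ has positive relative nullity if and only if its second fundamental form $h$ satisfies $$h(e_1,e_1)=h(e_1,e_2)=0,\qquad h(e_2,e_2)=\xi,$$ where $e_1,e_2$ form a (local) orthonormal base for the tangent bundle of $M$ such that $e_1$ is proportional to the tangential part $T=\left(\frac{\partial}{\partial t}\right)^T$ of $\frac{\partial}{\partial t}$, and $\xi$ is a normal vector field.
   Context: For $c\in\{-1,0,1\}$ let $R^3(c)$ be $\mathbb H^3,\mathbb E^3,\mathbb S^3$ respectively with metric $g_c$. Let $I$ be an open interval and $f:I\to\mathbb R$ a smooth nowhere vanishing function. The Robertson-Walker space-time $L^4_1(f,c)$ is $I\times R^3(c)$ with metric $\langle\cdot,\cdot\rangle=-dt^2+f(t)^2g_c$. A surface $M$ in $L^4_1(f,c)$ is time-like if its induced metric is Lorentzian; $h$ is its second fundamental form. Write $\frac{\partial}{\partial t}|_M=T+\eta$ with $T$ tangent and $\eta$ normal to $M$. The relative null space at $p\in M$ is $\mathcal N_p=\{X\in T_pM: h_p(X,Y)=0\ \text{for all } Y\in T_pM\}$; $M$ has positive relative nullity if $\dim\mathcal N_p>0$ for all $p\in M$. Standing assumptions: (i) $\frac{f''(t)}{f(t)}-\frac{f'(t)^2+c}{f(t)^2}\neq0$ for all $t\in I$; (ii) $T$ does not vanish on $M$; (iii) when $M$ has positive relative nullity, the spaces $\mathcal N_p$ form a smooth 1-dimensional distribution; (iv) $M$ is connected and no open part of $M$ lies in a 3-dimensional totally geodesic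 hypersurface of $L^4_1(f,c)$. *)

theory Defs
  imports "HOL-Analysis.Analysis"
begin

section \<open>Smooth maps and smooth manifolds\<close>

text \<open>\<open>Ck_on k f D\<close> is only meant for open \<open>D\<close>.\<close>

primrec Ck_on :: "nat \<Rightarrow> ('a::euclidean_space \<Rightarrow> 'b::euclidean_space) \<Rightarrow> 'a set \<Rightarrow> bool" where
  "Ck_on 0 f D \<longleftrightarrow> continuous_on D f"
| "Ck_on (Suc k) f D \<longleftrightarrow> (\<forall>x\<in>D. f differentiable (at x)) \<and>
     (\<forall>v. Ck_on k (\<lambda>x. frechet_derivative f (at x) v) D)"

definition smooth_on :: "'a::euclidean_space set \<Rightarrow> ('a \<Rightarrow> 'b::euclidean_space) \<Rightarrow> bool" where
  "smooth_on D f \<longleftrightarrow> (\<forall>k. Ck_on k f D)"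

text \<open>A manifold modelled on \<open>'e\<close> with carrier \<open>pts\<close> (carrying the subspace topology) and an atlas
  of charts \<open>(C, \<kappa>)\<close> with domain \<open>C\<close>, together with a map \<open>imm\<close> into a Euclidean space \<open>'v\<close>.\<close>

record ('m, 'e, 'v) submanifold =
  pts :: "'m set"
  charts :: "('m set \<times> ('m \<Rightarrow> 'e)) set"
  imm :: "'m \<Rightarrow> 'v"

definition smooth_atlas ::
    "'m::{t2_space, second_countable_topology} set \<Rightarrow> ('m set \<times> ('m \<Rightarrow> 'e::euclidean_space)) set \<Rightarrow> bool" where
  "smooth_atlas M A \<longleftrightarrow>
     \<Union> (fst ` A) = M \<and>
     (\<forall>(C, \<kappa>)\<in>A. openin (top_of_set M) C \<and> open (\<kappa> ` C) \<and>
        homeomorphism C (\<kappa> ` C) \<kappa> (inv_into C \<kappa>)) \<and>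
     (\<forall>(C, \<kappa>)\<in>A. \<forall>(C', \<kappa>')\<in>A. smooth_on (\<kappa> ` (C \<inter> C')) (\<kappa>' \<circ> inv_into C \<kappa>))"

definition smooth_map ::
    "('m, 'e::euclidean_space, 'v::euclidean_space) submanifold \<Rightarrow> 'm set \<Rightarrow> ('m \<Rightarrow> 'v) \<Rightarrow> bool" where
  "smooth_map S U W \<longleftrightarrow> (\<forall>(C, \<kappa>)\<in>charts S. smooth_on (\<kappa> ` (U \<inter> C)) (W \<circ> inv_into C \<kappa>))"

text \<open>Derivatives at a point are computed in an arbitrary chart around it; \<open>deriv_in_chart S p W\<close> is the
  derivative at \<open>p\<close> of a map \<open>W\<close> defined near \<open>p\<close> in \<open>pts S\<close>. Tangent vectors of the
  manifold are identified with their images under the differential of \<open>imm S\<close>; neither the tangent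
  space nor \<open>dir_deriv\<close> depends on the chart.\<close>

definition chart_at :: "('m, 'e, 'v) submanifold \<Rightarrow> 'm \<Rightarrow> 'm set \<times> ('m \<Rightarrow> 'e)" where
  "chart_at S p = (SOME ch. ch \<in> charts S \<and> p \<in> fst ch)"

definition deriv_in_chart ::
    "('m, 'e::euclidean_space, 'v::euclidean_space) submanifold \<Rightarrow> 'm \<Rightarrow> ('m \<Rightarrow> 'v) \<Rightarrow> 'e \<Rightarrow> 'v" where
  "deriv_in_chart S p W =
     (case chart_at S p of (C, \<kappa>) \<Rightarrow> frechet_derivative (W \<circ> inv_into C \<kappa>) (at (\<kappa> p)))"

definition tangent_space ::
    "('m, 'e::euclidean_space, 'v::euclidean_space) submanifold \<Rightarrow> 'm \<Rightarrow> 'v set" where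
  "tangent_space S p = range (deriv_in_chart S p (imm S))"

text \<open>Derivative of \<open>W\<close> in the direction of the tangent vector \<open>X \<in> tangent_space S p\<close>.\<close>

definition dir_deriv ::
    "('m, 'e::euclidean_space, 'v::euclidean_space) submanifold \<Rightarrow> 'm \<Rightarrow> 'v \<Rightarrow> ('m \<Rightarrow> 'v) \<Rightarrow> 'v" where
  "dir_deriv S p X W = deriv_in_chart S p W (inv (deriv_in_chart S p (imm S)) X)"

definition tangent_field ::
    "('m::topological_space, 'e::euclidean_space, 'v::euclidean_space) submanifold \<Rightarrow> 'm set \<Rightarrow> ('m \<Rightarrow> 'v) \<Rightarrow> bool" where
  "tangent_field S U W \<longleftrightarrow> smooth_map S U W \<and> (\<forall>q\<in>U. W q \<in> tangent_space S q)"

definition open_part :: "('m::topological_space, 'e, 'v) submanifold \<Rightarrow> 'm set \<Rightarrow> bool" where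
  "open_part S U \<longleftrightarrow> openin (top_of_set (pts S)) U"

definition smooth_line_distribution ::
    "('m::topological_space, 'e::euclidean_space, 'v::euclidean_space) submanifold \<Rightarrow> ('m \<Rightarrow> 'v set) \<Rightarrow> bool" where
  "smooth_line_distribution S \<D> \<longleftrightarrow>
     (\<forall>p\<in>pts S. \<exists>U X. open_part S U \<and> p \<in> U \<and> tangent_field S U X \<and>
        (\<forall>q\<in>U. X q \<noteq> 0 \<and> \<D> q = span {X q}))"

section \<open>The spaces \<open>R\<^sup>3(c)\<close>\<close>

text \<open>The three models inside \<open>\<real>\<^sup>3 \<times> \<real>\<close>: the unit sphere for \<open>c = 1\<close>, the affine hyperplane
  \<open>s = 1\<close> for \<open>c = 0\<close>, and for \<open>c = -1\<close> the upper sheet of the hyperboloid in Minkowski space. In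
  each case the metric \<open>g\<^sub>c\<close> is the restriction of the bilinear form \<open>sf_metric c\<close>. The point set and
  the tangent spaces are cut out uniformly by \<open>c * (x \<bullet> x) + s\<^sup>2 = 1\<close> and its linearisation.\<close>

type_synonym vec4 = "(real ^ 3) \<times> real"

definition space_form :: "real \<Rightarrow> vec4 set" where
  "space_form c =
     (if c = 1 then {(x, s). x \<bullet> x + s\<^sup>2 = 1}
      else if c = 0 then {(x, s). s = 1}
      else {(x, s). x \<bullet> x - s\<^sup>2 = -1 \<and> s > 0})"

definition sf_metric :: "real \<Rightarrow> vec4 \<Rightarrow> vec4 \<Rightarrow> real" where
  "sf_metric c u v = fst u \<bullet> fst v + c * (snd u * snd v)"

definition sf_tangent :: "real \<Rightarrow> vec4 \<Rightarrow> vec4 set" where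
  "sf_tangent c x = {u. c * (fst x \<bullet> fst u) + snd x * snd u = 0}"

section \<open>Robertson-Walker space-times\<close>

type_synonym vec5 = "real \<times> vec4"

definition rw_space :: "real set \<Rightarrow> real \<Rightarrow> vec5 set" where
  "rw_space I c = I \<times> space_form c"

definition rw_tangent :: "real \<Rightarrow> vec5 \<Rightarrow> vec5 set" where
  "rw_tangent c q = UNIV \<times> sf_tangent c (snd q)"

definition rw_metric :: "(real \<Rightarrow> real) \<Rightarrow> real \<Rightarrow> vec5 \<Rightarrow> vec5 \<Rightarrow> vec5 \<Rightarrow> real" where
  "rw_metric f c q X Y = - (fst X * fst Y) + (f (fst q))\<^sup>2 * sf_metric c (snd X) (snd Y)"

definition d_dt :: vec5 where
  "d_dt = (1, 0)"

text \<open>The Levi-Civita connection of \<open>rw_space I c\<close>: the value at \<open>q\<close> of the covariant derivative of a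
  tangent field with value \<open>Y\<close> at \<open>q\<close> in the direction \<open>X\<close>, where \<open>D\<close> is the ordinary directional
  derivative of that field as a map into \<open>vec5\<close>. It is the Gauss formula for \<open>R\<^sup>3(c)\<close> in \<open>\<real>\<^sup>4\<close>
  combined with the warped product formulas. The lemmas \<open>rw_conn_tangent\<close>, \<open>rw_conn_metric\<close> and
  \<open>rw_conn_torsion_free\<close> below give the characterising properties.\<close>

definition rw_conn :: "(real \<Rightarrow> real) \<Rightarrow> real \<Rightarrow> vec5 \<Rightarrow> vec5 \<Rightarrow> vec5 \<Rightarrow> vec5 \<Rightarrow> vec5" where
  "rw_conn f c q X Y D =
     (let t = fst q; x = snd q; a = fst X; u = snd X; b = fst Y; v = snd Y in
      (fst D + f t * deriv f t * sf_metric c u v,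
       snd D + (c * sf_metric c u v) *\<^sub>R x + (deriv f t / f t) *\<^sub>R (a *\<^sub>R v + b *\<^sub>R u)))"

lemma space_form_eq:
  assumes "c \<in> {-1, 0, 1}" "x \<in> space_form c"
  shows "c * (fst x \<bullet> fst x) + (snd x)\<^sup>2 = 1"
  using assms by (auto simp: space_form_def)

lemma velocity_in_rw_tangent:
  assumes c: "c \<in> {-1, 0, 1}"
    and near: "eventually (\<lambda>r. \<gamma> r \<in> rw_space I c) (at s)" and at: "\<gamma> s \<in> rw_space I c"
    and d: "(\<gamma> has_vector_derivative X) (at s)"
  shows "X \<in> rw_tangent c (\<gamma> s)"
proof -
  have d': "(\<gamma> has_derivative (\<lambda>h. h *\<^sub>R X)) (at s)"
    using d by (simp add: has_vector_derivative_def)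
  define F where "F r = c * (fst (snd (\<gamma> r)) \<bullet> fst (snd (\<gamma> r))) + (snd (snd (\<gamma> r)))\<^sup>2" for r
  have eq: "F r = 1" if "\<gamma> r \<in> rw_space I c" for r
    using that space_form_eq[OF c, of "snd (\<gamma> r)"] by (auto simp: F_def rw_space_def)
  have "(F has_derivative (\<lambda>h. h * (2 * (c * (fst (snd (\<gamma> s)) \<bullet> fst (snd X)) + snd (snd (\<gamma> s)) * snd (snd X)))))
          (at s)"
    unfolding F_def
    by (rule has_derivative_eq_rhs, (rule derivative_intros d')+)
      (auto simp: algebra_simps inner_commute)
  moreover have "(F has_derivative (\<lambda>h. 0)) (at s)"
  proof (rule has_derivative_transform_eventually[OF has_derivative_const[of 1]])
    show "eventually (\<lambda>r. 1 = F r) (at s)" using near by eventually_elim (simp add: eq)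
  qed (use eq[OF at] in auto)
  ultimately have "(\<lambda>h. h * (2 * (c * (fst (snd (\<gamma> s)) \<bullet> fst (snd X)) + snd (snd (\<gamma> s)) * snd (snd X)))) = (\<lambda>h. 0)"
    by (rule has_derivative_unique)
  then have "c * (fst (snd (\<gamma> s)) \<bullet> fst (snd X)) + snd (snd (\<gamma> s)) * snd (snd X) = 0"
    by (drule_tac x = 1 in fun_cong) simp
  then show ?thesis
    by (auto simp: rw_tangent_def sf_tangent_def mem_Times_iff)
qed

lemma rw_conn_tangent:
  assumes c: "c \<in> {-1, 0, 1}"
    and at: "\<gamma> s \<in> rw_space I c" "X \<in> rw_tangent c (\<gamma> s)"
    and near: "eventually (\<lambda>r. Y r \<in> rw_tangent c (\<gamma> r)) (nhds s)"
    and d: "(\<gamma> has_vector_derivative X) (at s)" "(Y has_vector_derivative D) (at s)"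
  shows "rw_conn f c (\<gamma> s) X (Y s) D \<in> rw_tangent c (\<gamma> s)"
proof -
  have d': "(\<gamma> has_derivative (\<lambda>h. h *\<^sub>R X)) (at s)" "(Y has_derivative (\<lambda>h. h *\<^sub>R D)) (at s)"
    using d by (simp_all add: has_vector_derivative_def)
  define F where "F r = c * (fst (snd (\<gamma> r)) \<bullet> fst (snd (Y r))) + snd (snd (\<gamma> r)) * snd (snd (Y r))" for r
  have eq: "F r = 0" if "Y r \<in> rw_tangent c (\<gamma> r)" for r
    using that by (auto simp: F_def rw_tangent_def sf_tangent_def)
  have Ys: "Y s \<in> rw_tangent c (\<gamma> s)" using near by (rule eventually_nhds_x_imp_x)
  let ?L = "c * (fst (snd X) \<bullet> fst (snd (Y s)) + fst (snd (\<gamma> s)) \<bullet> fst (snd D))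
      + (snd (snd X) * snd (snd (Y s)) + snd (snd (\<gamma> s)) * snd (snd D))"
  have "(F has_derivative (\<lambda>h. h * ?L)) (at s)"
    unfolding F_def
    by (rule has_derivative_eq_rhs, (rule derivative_intros d')+)
      (auto simp: algebra_simps inner_commute)
  moreover have "(F has_derivative (\<lambda>h. 0)) (at s)"
  proof (rule has_derivative_transform_eventually[OF has_derivative_const[of 0]])
    show "eventually (\<lambda>r. 0 = F r) (at s)"
      using eventually_nhds_conv_at[THEN iffD1, OF near, THEN conjunct1] by eventually_elim (simp add: eq)
  qed (use eq[OF Ys] in auto)
  ultimately have "(\<lambda>h. h * ?L) = (\<lambda>h. 0)"
    by (rule has_derivative_unique)
  then have L: "?L = 0"
    by (drule_tac x = 1 in fun_cong) simp
  have tX: "c * (fst (snd (\<gamma> s)) \<bullet> fst (snd X)) + snd (snd (\<gamma> s)) * snd (snd X) = 0"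
    and tY: "c * (fst (snd (\<gamma> s)) \<bullet> fst (snd (Y s))) + snd (snd (\<gamma> s)) * snd (snd (Y s)) = 0"
    using at(2) Ys by (auto simp: rw_tangent_def sf_tangent_def)
  have q: "c * (fst (snd (\<gamma> s)) \<bullet> fst (snd (\<gamma> s))) + (snd (snd (\<gamma> s)))\<^sup>2 = 1"
    using at(1) space_form_eq[OF c, of "snd (\<gamma> s)"] by (auto simp: rw_space_def)
  obtain t x z where g: "\<gamma> s = (t, x, z)" by (cases "\<gamma> s") auto
  obtain a u w where X: "X = (a, u, w)" by (cases X) auto
  obtain b v y where Y: "Y s = (b, v, y)" by (cases "Y s") auto
  obtain d0 d1 d2 where D: "D = (d0, d1, d2)" by (cases D) auto
  let ?k = "deriv f t / f t" and ?g = "u \<bullet> v + c * (w * y)"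
  have "c * (x \<bullet> (d1 + (c * ?g) *\<^sub>R x + ?k *\<^sub>R (a *\<^sub>R v + b *\<^sub>R u)))
        + z * (d2 + (c * ?g) * z + ?k * (a * y + b * w))
      = (c * (x \<bullet> d1) + z * d2) + c * ?g * (c * (x \<bullet> x) + z\<^sup>2)
        + ?k * (a * (c * (x \<bullet> v) + z * y) + b * (c * (x \<bullet> u) + z * w))"
    by (simp add: inner_add_right algebra_simps power2_eq_square)
  also have "\<dots> = (c * (x \<bullet> d1) + z * d2) + c * ?g"
    using q tX tY by (simp add: g X Y)
  also have "\<dots> = 0"
  proof -
    have cc: "c * c * (w * y) = w * y"
    proof (cases "c = 0")
      case True
      then show ?thesis using tX q by (auto simp: g X)
    qed (use c in auto)
    have "c * ?g = c * (u \<bullet> v) + c * c * (w * y)" by (simp add: algebra_simps)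
    then have "c * ?g = c * (u \<bullet> v) + w * y" unfolding cc .
    moreover have "c * (u \<bullet> v + x \<bullet> d1) + (w * y + z * d2) = 0" using L by (simp add: g X Y D)
    ultimately show ?thesis by (simp only: distrib_left)
  qed
  finally show ?thesis
    by (simp add: g X Y D rw_conn_def rw_tangent_def sf_tangent_def sf_metric_def Let_def)
qed

lemma rw_conn_metric:
  assumes c: "c \<in> {-1, 0, 1}" and fs: "f differentiable (at (fst (\<gamma> s)))" "f (fst (\<gamma> s)) \<noteq> 0"
    and tan: "Y s \<in> rw_tangent c (\<gamma> s)" "Z s \<in> rw_tangent c (\<gamma> s)"
    and d: "(\<gamma> has_vector_derivative X) (at s)" "(Y has_vector_derivative D) (at s)"
      "(Z has_vector_derivative E) (at s)"
  shows "((\<lambda>r. rw_metric f c (\<gamma> r) (Y r) (Z r)) has_real_derivative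
     rw_metric f c (\<gamma> s) (rw_conn f c (\<gamma> s) X (Y s) D) (Z s) +
     rw_metric f c (\<gamma> s) (Y s) (rw_conn f c (\<gamma> s) X (Z s) E)) (at s)"
proof -
  have d': "(\<gamma> has_derivative (\<lambda>h. h *\<^sub>R X)) (at s)" "(Y has_derivative (\<lambda>h. h *\<^sub>R D)) (at s)"
    "(Z has_derivative (\<lambda>h. h *\<^sub>R E)) (at s)"
    using d by (simp_all add: has_vector_derivative_def)
  obtain t x z where g: "\<gamma> s = (t, x, z)" by (cases "\<gamma> s") auto
  obtain a u w where X: "X = (a, u, w)" by (cases X) auto
  obtain b v y where Y: "Y s = (b, v, y)" by (cases "Y s") auto
  obtain b' v' y' where Z: "Z s = (b', v', y')" by (cases "Z s") auto
  obtain d0 d1 d2 where D: "D = (d0, d1, d2)" by (cases D) auto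
  obtain e0 e1 e2 where E: "E = (e0, e1, e2)" by (cases E) auto
  have ft: "f t \<noteq> 0" using fs(2) by (simp add: g)
  have "(f has_derivative (\<lambda>h. h * deriv f t)) (at (fst (\<gamma> s)))"
    using fs(1) DERIV_deriv_iff_real_differentiable[of f t]
    by (simp add: g has_field_derivative_def mult_commute_abs)
  then have fd: "((\<lambda>r. f (fst (\<gamma> r))) has_derivative (\<lambda>h. h * a * deriv f t)) (at s)"
    by (rule has_derivative_compose[rotated, THEN has_derivative_eq_rhs])
      (auto intro!: derivative_eq_intros d' simp: X)
  have main: "((\<lambda>r. rw_metric f c (\<gamma> r) (Y r) (Z r)) has_derivative (\<lambda>h. h *
      (- (d0 * b' + b * e0) + 2 * f t * a * deriv f t * (v \<bullet> v' + c * (y * y'))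
       + (f t)\<^sup>2 * (d1 \<bullet> v' + v \<bullet> e1 + c * (d2 * y' + y * e2))))) (at s)"
    unfolding rw_metric_def sf_metric_def
    by (rule has_derivative_eq_rhs, (rule derivative_intros d' fd)+)
      (auto simp: algebra_simps inner_commute power2_eq_square g Y Z D E)
  have tY: "c * (x \<bullet> v) + z * y = 0" and tZ: "c * (x \<bullet> v') + z * y' = 0"
    using tan by (auto simp: rw_tangent_def sf_tangent_def g Y Z)
  have orth: "c * (x \<bullet> v + c * (z * y)) = 0" "c * (x \<bullet> v' + c * (z * y')) = 0"
    using tY tZ c by auto
  have "- (d0 * b' + b * e0) + 2 * f t * a * deriv f t * (v \<bullet> v' + c * (y * y'))
       + (f t)\<^sup>2 * (d1 \<bullet> v' + v \<bullet> e1 + c * (d2 * y' + y * e2))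
      = rw_metric f c (\<gamma> s) (rw_conn f c (\<gamma> s) X (Y s) D) (Z s) +
        rw_metric f c (\<gamma> s) (Y s) (rw_conn f c (\<gamma> s) X (Z s) E)"
  proof -
    define k where "k = deriv f t / f t"
    define G where "G = u \<bullet> v + c * (w * y)"
    define H where "H = u \<bullet> v' + c * (w * y')"
    define B where "B = v \<bullet> v' + c * (y * y')"
    have dk: "deriv f t = k * f t" using ft by (simp add: k_def)
    have 1: "rw_metric f c (\<gamma> s) (rw_conn f c (\<gamma> s) X (Y s) D) (Z s)
      = - (d0 * b') - (f t)\<^sup>2 * k * G * b' + (f t)\<^sup>2 * (d1 \<bullet> v' + c * (d2 * y'))
        + (f t)\<^sup>2 * (G * (c * (x \<bullet> v' + c * (z * y')))) + (f t)\<^sup>2 * k * (a * B + b * H)"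
      by (simp add: rw_metric_def rw_conn_def sf_metric_def Let_def g X Y Z D dk ft)
        (simp add: G_def H_def B_def inner_add_left algebra_simps power2_eq_square)
    have 2: "rw_metric f c (\<gamma> s) (Y s) (rw_conn f c (\<gamma> s) X (Z s) E)
      = - (b * e0) - (f t)\<^sup>2 * k * H * b + (f t)\<^sup>2 * (v \<bullet> e1 + c * (y * e2))
        + (f t)\<^sup>2 * (H * (c * (x \<bullet> v + c * (z * y)))) + (f t)\<^sup>2 * k * (a * B + b' * G)"
      by (simp add: rw_metric_def rw_conn_def sf_metric_def Let_def g X Y Z E dk ft)
        (simp add: G_def H_def B_def inner_add_right algebra_simps inner_commute power2_eq_square)
    have 3: "2 * f t * a * deriv f t * (v \<bullet> v' + c * (y * y')) = 2 * a * B * ((f t)\<^sup>2 * k)"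
      by (simp add: dk B_def power2_eq_square)
    show ?thesis
      unfolding 1 2 3 orth by (simp add: algebra_simps)
  qed
  with main show ?thesis
    by (simp add: has_field_derivative_def mult_commute_abs)
qed

text \<open>\<open>DXY - DYX\<close> is the Lie bracket of two tangent fields when \<open>DXY\<close> and \<open>DYX\<close> are the derivatives
  of \<open>Y\<close> along \<open>X\<close> and of \<open>X\<close> along \<open>Y\<close>.\<close>

lemma rw_conn_torsion_free:
  "rw_conn f c q X Y DXY - rw_conn f c q Y X DYX = DXY - DYX"
  by (rule prod_eqI) (auto simp: rw_conn_def sf_metric_def Let_def inner_commute algebra_simps)

section \<open>Submanifolds of Robertson-Walker space-times\<close>

definition rw_submanifold ::
    "real set \<Rightarrow> real \<Rightarrow> ('m::{t2_space, second_countable_topology}, 'e::euclidean_space, vec5) submanifold \<Rightarrow> bool" where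
  "rw_submanifold I c S \<longleftrightarrow>
     smooth_atlas (pts S) (charts S) \<and>
     imm S ` pts S \<subseteq> rw_space I c \<and>
     smooth_map S (pts S) (imm S) \<and>
     (\<forall>p\<in>pts S. inj (deriv_in_chart S p (imm S)))"

abbreviation metric_at ::
    "(real \<Rightarrow> real) \<Rightarrow> real \<Rightarrow> ('m, 'e, vec5) submanifold \<Rightarrow> 'm \<Rightarrow> vec5 \<Rightarrow> vec5 \<Rightarrow> real" where
  "metric_at f c S p \<equiv> rw_metric f c (imm S p)"

definition time_like_surface ::
    "real set \<Rightarrow> (real \<Rightarrow> real) \<Rightarrow> real \<Rightarrow>
     ('m::{t2_space, second_countable_topology}, real ^ 2, vec5) submanifold \<Rightarrow> bool" where
  "time_like_surface I f c S \<longleftrightarrow> rw_submanifold I c S \<and>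
     (\<forall>p\<in>pts S. \<exists>u v. tangent_space S p = span {u, v} \<and>
        metric_at f c S p u u = -1 \<and> metric_at f c S p v v = 1 \<and> metric_at f c S p u v = 0)"

definition normal_space ::
    "(real \<Rightarrow> real) \<Rightarrow> real \<Rightarrow> ('m, 'e::euclidean_space, vec5) submanifold \<Rightarrow> 'm \<Rightarrow> vec5 set" where
  "normal_space f c S p =
     {n \<in> rw_tangent c (imm S p). \<forall>X\<in>tangent_space S p. metric_at f c S p n X = 0}"

definition normal_part ::
    "(real \<Rightarrow> real) \<Rightarrow> real \<Rightarrow> ('m, 'e::euclidean_space, vec5) submanifold \<Rightarrow> 'm \<Rightarrow> vec5 \<Rightarrow> vec5" where
  "normal_part f c S p V = (THE n. n \<in> normal_space f c S p \<and> V - n \<in> tangent_space S p)"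

definition tangential_part ::
    "(real \<Rightarrow> real) \<Rightarrow> real \<Rightarrow> ('m, 'e::euclidean_space, vec5) submanifold \<Rightarrow> 'm \<Rightarrow> vec5 \<Rightarrow> vec5" where
  "tangential_part f c S p V = V - normal_part f c S p V"

definition normal_field ::
    "(real \<Rightarrow> real) \<Rightarrow> real \<Rightarrow> ('m, 'e::euclidean_space, vec5) submanifold \<Rightarrow> 'm set \<Rightarrow> ('m \<Rightarrow> vec5) \<Rightarrow> bool" where
  "normal_field f c S U \<xi> \<longleftrightarrow> smooth_map S U \<xi> \<and> (\<forall>q\<in>U. \<xi> q \<in> normal_space f c S q)"

definition cov_deriv ::
    "(real \<Rightarrow> real) \<Rightarrow> real \<Rightarrow> ('m, 'e::euclidean_space, vec5) submanifold \<Rightarrow> 'm \<Rightarrow> vec5 \<Rightarrow> ('m \<Rightarrow> vec5) \<Rightarrow> vec5" where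
  "cov_deriv f c S p X W = rw_conn f c (imm S p) X (W p) (dir_deriv S p X W)"

text \<open>The second fundamental form \<open>h\<^sub>p(X, Y)\<close> is the normal part of the covariant derivative in the
  direction \<open>X\<close> of a local tangent field \<open>W\<close> extending \<open>Y\<close>; the result is the same for all extensions.\<close>

definition sff ::
    "(real \<Rightarrow> real) \<Rightarrow> real \<Rightarrow> ('m::topological_space, 'e::euclidean_space, vec5) submanifold \<Rightarrow>
     'm \<Rightarrow> vec5 \<Rightarrow> vec5 \<Rightarrow> vec5" where
  "sff f c S p X Y = (THE n. \<exists>U W. open_part S U \<and> p \<in> U \<and> tangent_field S U W \<and> W p = Y \<and>
     n = normal_part f c S p (cov_deriv f c S p X W))"

definition relative_null_space ::
    "(real \<Rightarrow> real) \<Rightarrow> real \<Rightarrow> ('m::topological_space, 'e::euclidean_space, vec5) submanifold \<Rightarrow> 'm \<Rightarrow> vec5 set" where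
  "relative_null_space f c S p =
     {X \<in> tangent_space S p. \<forall>Y\<in>tangent_space S p. sff f c S p X Y = 0}"

definition positive_relative_nullity ::
    "(real \<Rightarrow> real) \<Rightarrow> real \<Rightarrow> ('m::topological_space, 'e::euclidean_space, vec5) submanifold \<Rightarrow> bool" where
  "positive_relative_nullity f c S \<longleftrightarrow> (\<forall>p\<in>pts S. dim (relative_null_space f c S p) > 0)"

text \<open>Hypersurfaces are embedded, i.e. the carrier is a subset of the space-time, and have
  nondegenerate induced metric, so that the second fundamental form makes sense. No generality is lost
  by either: an open part of a time-like surface lying in an immersed totally geodesic hypersurface has
  an open part lying in an embedded one, and a degenerate hypersurface has no time-like tangent vectors.\<close>

definition totally_geodesic_hypersurface ::
    "real set \<Rightarrow> (real \<Rightarrow> real) \<Rightarrow> real \<Rightarrow> vec5 set \<Rightarrow> bool" where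
  "totally_geodesic_hypersurface I f c P \<longleftrightarrow>
     (\<exists>H :: (vec5, real ^ 3, vec5) submanifold. pts H = P \<and> imm H = id \<and> rw_submanifold I c H \<and>
        (\<forall>p\<in>P. \<forall>X\<in>tangent_space H p.
           (\<forall>Y\<in>tangent_space H p. metric_at f c H p X Y = 0) \<longrightarrow> X = 0) \<and>
        (\<forall>p\<in>P. \<forall>X\<in>tangent_space H p. \<forall>Y\<in>tangent_space H p. sff f c H p X Y = 0))"

definition T_field ::
    "(real \<Rightarrow> real) \<Rightarrow> real \<Rightarrow> ('m, 'e::euclidean_space, vec5) submanifold \<Rightarrow> 'm \<Rightarrow> vec5" where
  "T_field f c S p = tangential_part f c S p d_dt"

text \<open>A local orthonormal frame of the tangent bundle of a surface; the signs of \<open>\<langle>e\<^sub>i, e\<^sub>i\<rangle> = \<plusminus>1\<close> are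
  left open since the metric is indefinite.\<close>

definition orthonormal_frame ::
    "(real \<Rightarrow> real) \<Rightarrow> real \<Rightarrow> ('m::topological_space, real ^ 2, vec5) submanifold \<Rightarrow> 'm set \<Rightarrow>
     ('m \<Rightarrow> vec5) \<Rightarrow> ('m \<Rightarrow> vec5) \<Rightarrow> bool" where
  "orthonormal_frame f c S U e1 e2 \<longleftrightarrow> tangent_field S U e1 \<and> tangent_field S U e2 \<and>
     (\<forall>q\<in>U. \<bar>metric_at f c S q (e1 q) (e1 q)\<bar> = 1 \<and> \<bar>metric_at f c S q (e2 q) (e2 q)\<bar> = 1 \<and>
        metric_at f c S q (e1 q) (e2 q) = 0)"

end

theory Submission
  imports Defs
begin

text \<open>Since \<open>M\<close> is time-like, its normal spaces are definite and \<open>T\<close> is time-like. Hence there always is a smooth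
  orthonormal frame with \<open>e\<^sub>1\<close> proportional to \<open>T\<close>, and the claim amounts to: if the spaces \<open>\<N>\<^sub>p\<close> are spanned by a field
  \<open>N\<close>, then \<open>N\<close> is proportional to \<open>T\<close>. The Codazzi equation for \<open>N\<close> reads, modulo tangent vectors,
  \<open>h(X, \<nabla>\<^sub>Y N) - h(Y, \<nabla>\<^sub>X N) = \<lambda> \<eta>\<close>, where \<open>\<lambda>\<close> is the quantity of assumption (i) times a factor that vanishes only if \<open>N\<close> is
  proportional to \<open>T\<close>. All values of \<open>h\<close> lie on one line because \<open>h(N, -) = 0\<close>; so where \<open>\<lambda>\<close> and \<open>\<eta>\<close> do not vanish, that line
  is spanned by \<open>\<eta>\<close>. Then the linear span of the position vector and the spatial parts of the tangent vectors is parallel in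
  \<open>\<real>\<^sup>4\<close>, so \<open>M\<close> locally lies in the product of \<open>I\<close> with a totally geodesic surface of \<open>R\<^sup>3(c)\<close>, which is excluded. If \<open>\<eta> = 0\<close> on an
  open set, then \<open>T = \<partial>/\<partial>t\<close> itself lies in \<open>\<N>\<^sub>p\<close>.\<close>

section \<open>Calculus of smooth maps\<close>

text \<open>All computations happen in one chart: \<open>cd\<close> differentiates fields along the
  parametrisation, and statements about \<open>h\<close> become congruences modulo the tangent plane
  \<open>TM\<close>, so no connection in the normal bundle is needed. The quantity in assumption (i)
  is the difference between the curvature \<open>f''/f\<close> of planes containing
  \<partial>/\<partial>t and the curvature \<open>(f'^2 + c)/f^2\<close> of spatial planes; only
  this deviation from constant curvature can give the curvature term in the Codazzi equation a
  normal component. The obstacle is that the Codazzi equation says nothing at points where \<eta> =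
  0, and the point at which \<open>N\<close> fails to be proportional to \<open>T\<close> may be one
  of them. That failure is an open condition, and so is \<eta> \<noteq> 0. Hence either \<eta>
  vanishes on a whole neighbourhood of the point, or a nearby smaller open set avoids its zeros;
  both cases are contradictory, and no density argument at the point itself is required. In the
  parallelism step the coefficients of the linear system are known only to exist pointwise. A
  compactness bound on them replaces continuity and suffices for a Gronwall estimate.\<close>

abbreviation dd :: "'a::euclidean_space \<Rightarrow> ('a \<Rightarrow> 'b::euclidean_space) \<Rightarrow> 'a \<Rightarrow> 'b" where
  "dd v F x \<equiv> frechet_derivative F (at x) v"

lemma dd_eqI: "(F has_derivative F') (at x) \<Longrightarrow> dd v F x = F' v"
  using frechet_derivative_at by metis

lemma differentiable_cong_open:
  assumes "open D" "x \<in> D" "\<And>y. y \<in> D \<Longrightarrow> f y = g y" "f differentiable (at x)"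
  shows "g differentiable (at x)"
  using assms has_derivative_transform_within_open[of f _ x UNIV D g]
  unfolding differentiable_def by auto

lemma dd_cong_open:
  assumes "open D" "x \<in> D" "\<And>y. y \<in> D \<Longrightarrow> f y = g y"
  shows "dd v f x = dd v g x"
proof (cases "f differentiable (at x)")
  case True
  then show ?thesis using frechet_derivative_transform_within_open[OF True assms(1,2,3)] by simp
next
  \<comment> \<open>Without differentiability both derivatives are \<open>SOME\<close> applied to
    the same unsatisfiable predicate, hence equal. So later uses need no differentiability
    check.\<close>
  case False
  then have "\<not> g differentiable (at x)"
    using differentiable_cong_open[OF assms(1,2), of g f] assms(3) by auto
  with False show ?thesis by (simp add: frechet_derivative_def differentiable_def)
qed

lemma Ck_on_cong:
  assumes D: "open D" and eq: "\<And>x. x \<in> D \<Longrightarrow> f x = g x"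
  shows "Ck_on k f D \<longleftrightarrow> Ck_on k g D"
proof -
  have "Ck_on k f D \<Longrightarrow> (\<And>x. x \<in> D \<Longrightarrow> f x = g x) \<Longrightarrow> Ck_on k g D" for f g :: "'a \<Rightarrow> 'b"
  proof (induction k arbitrary: f g)
    case 0
    then show ?case using continuous_on_cong[of D D f g] by simp
  next
    case (Suc k)
    have "Ck_on k (\<lambda>x. dd v g x) D" for v
    proof (rule Suc.IH)
      show "Ck_on k (\<lambda>x. dd v f x) D" using Suc.prems by simp
      show "dd v f x = dd v g x" if "x \<in> D" for x
        by (rule dd_cong_open[OF D that Suc.prems(2)])
    qed
    moreover have "\<forall>x\<in>D. g differentiable (at x)"
      using Suc.prems differentiable_cong_open[OF D, of _ f g] by auto
    ultimately show ?case by simp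
  qed
  from this[of f g] this[of g f] show ?thesis using eq by auto
qed

lemma Ck_on_SucI:
  assumes D: "open D" and hd: "\<And>x. x \<in> D \<Longrightarrow> (f has_derivative f' x) (at x)"
    and C: "\<And>v. Ck_on k (\<lambda>x. f' x v) D"
  shows "Ck_on (Suc k) f D"
proof -
  have "Ck_on k (\<lambda>x. dd v f x) D" for v
    by (rule Ck_on_cong[THEN iffD2, OF D _ C[of v]]) (rule dd_eqI[OF hd])
  moreover have "\<forall>x\<in>D. f differentiable (at x)"
    using hd differentiableI by blast
  ultimately show ?thesis by simp
qed

lemma Ck_on_SucD: "Ck_on (Suc k) f D \<Longrightarrow> Ck_on k f D"
proof (induction k arbitrary: f)
  case 0
  then show ?case
    by (auto simp: differentiable_imp_continuous_within continuous_at_imp_continuous_on)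
next
  case (Suc k)
  then show ?case by (metis Ck_on.simps(2))
qed

lemma Ck_on_subset: "Ck_on k f D \<Longrightarrow> E \<subseteq> D \<Longrightarrow> Ck_on k f E"
  by (induction k arbitrary: f) (auto intro: continuous_on_subset)

lemma Ck_on_const: "Ck_on k (\<lambda>x. c) D"
  by (induction k arbitrary: c) auto

lemma Ck_on_bounded_linear: "bounded_linear L \<Longrightarrow> Ck_on k L D"
proof (cases k)
  case 0
  then show "bounded_linear L \<Longrightarrow> Ck_on k L D"
    by (simp add: linear_continuous_on)
next
  case (Suc m)
  assume L: "bounded_linear L"
  then have "dd v L x = L v" for v x
    by (simp add: bounded_linear_imp_has_derivative dd_eqI)
  then show "Ck_on k L D"
    using Suc L Ck_on_const by (auto simp: bounded_linear_imp_differentiable)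
qed

lemma Ck_on_add: "open D \<Longrightarrow> Ck_on k f D \<Longrightarrow> Ck_on k g D \<Longrightarrow> Ck_on k (\<lambda>x. f x + g x) D"
proof (induction k arbitrary: f g)
  case 0
  then show ?case by (auto intro: continuous_intros)
next
  case (Suc k)
  show ?case
  proof (rule Ck_on_SucI[OF Suc.prems(1)])
    show "((\<lambda>x. f x + g x) has_derivative (\<lambda>v. dd v f x + dd v g x)) (at x)" if "x \<in> D" for x
      using Suc.prems that by (intro has_derivative_add) (auto simp: frechet_derivative_works)
    show "Ck_on k (\<lambda>x. dd v f x + dd v g x) D" for v
      by (rule Suc.IH) (use Suc.prems in auto)
  qed
qed

text \<open>One Leibniz induction for an arbitrary bilinear map serves scaling, inner products and
  real products. The induction step pairs a differentiated factor with an undifferentiated one, so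
  both factors must be generalised.\<close>

lemma Ck_on_bilinear:
  assumes p: "bounded_bilinear p" and D: "open D"
  shows "Ck_on k f D \<Longrightarrow> Ck_on k g D \<Longrightarrow> Ck_on k (\<lambda>x. p (f x) (g x)) D"
proof (induction k arbitrary: f g)
  case 0
  then show ?case using bounded_bilinear.continuous_on[OF p] by auto
next
  case (Suc k)
  show ?case
  proof (rule Ck_on_SucI[OF D])
    show "((\<lambda>x. p (f x) (g x)) has_derivative (\<lambda>v. p (f x) (dd v g x) + p (dd v f x) (g x))) (at x)"
      if "x \<in> D" for x
      using Suc.prems that by (intro bounded_bilinear.FDERIV[OF p]) (auto simp: frechet_derivative_works)
    show "Ck_on k (\<lambda>x. p (f x) (dd v g x) + p (dd v f x) (g x)) D" for v
      using Suc.prems Ck_on_SucD[OF Suc.prems(1)] Ck_on_SucD[OF Suc.prems(2)]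
      by (intro Ck_on_add D Suc.IH) auto
  qed
qed

lemma Ck_on_sum:
  "finite A \<Longrightarrow> open D \<Longrightarrow> (\<And>i. i \<in> A \<Longrightarrow> Ck_on k (f i) D) \<Longrightarrow> Ck_on k (\<lambda>x. \<Sum>i\<in>A. f i x) D"
  by (induction A rule: finite_induct) (simp_all add: Ck_on_const Ck_on_add)

lemma Ck_on_compose:
  assumes D: "open D" and E: "open E"
  shows "Ck_on k f D \<Longrightarrow> Ck_on k g E \<Longrightarrow> g ` E \<subseteq> D \<Longrightarrow> Ck_on k (\<lambda>x. f (g x)) E"
proof (induction k arbitrary: f)
  case 0
  then show ?case using continuous_on_compose2[of D f E g] by auto
next
  case (Suc k)
  show ?case
  proof (rule Ck_on_SucI[OF E])
    fix x assume x: "x \<in> E"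
    have lin: "linear (frechet_derivative f (at (g x)))"
      using Suc.prems x by (auto intro!: linear_frechet_derivative)
    have "((\<lambda>x. f (g x)) has_derivative (\<lambda>v. dd (dd v g x) f (g x))) (at x)"
    proof (rule has_derivative_compose[where f = g and f' = "\<lambda>v. dd v g x" and g' = "\<lambda>v. dd v f (g x)"])
      show "(g has_derivative (\<lambda>v. dd v g x)) (at x)"
        using Suc.prems(2) x frechet_derivative_works by auto
      show "(f has_derivative (\<lambda>v. dd v f (g x))) (at (g x))"
        using Suc.prems(1,3) x frechet_derivative_works by auto
    qed
    \<comment> \<open>In the chain rule the direction in which \<open>f\<close> is differentiated
      moves with \<open>x\<close>. Expanding it in the basis leaves derivatives of \<open>f\<close>
      in fixed directions, to which the induction hypothesis applies.\<close>
    moreover have "dd (dd v g x) f (g x) = (\<Sum>b\<in>Basis. (dd v g x \<bullet> b) *\<^sub>R dd b f (g x))" for v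
      using linear_sum[OF lin, of "\<lambda>b. (dd v g x \<bullet> b) *\<^sub>R b" Basis]
      by (simp add: euclidean_representation linear_scale[OF lin])
    ultimately show "((\<lambda>x. f (g x)) has_derivative (\<lambda>v. \<Sum>b\<in>Basis. (dd v g x \<bullet> b) *\<^sub>R dd b f (g x))) (at x)"
      by simp
  next
    show "Ck_on k (\<lambda>x. \<Sum>b\<in>Basis. (dd v g x \<bullet> b) *\<^sub>R dd b f (g x)) E" for v
    proof (intro Ck_on_sum E finite_Basis)
      fix b :: 'a assume "b \<in> Basis"
      have 1: "Ck_on k (\<lambda>x. dd v g x \<bullet> b) E"
        by (rule Ck_on_bilinear[OF bounded_bilinear_inner E]) (use Suc.prems Ck_on_const in auto)
      have 2: "Ck_on k (\<lambda>x. dd b f (g x)) E"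
        by (rule Suc.IH) (use Suc.prems Ck_on_SucD[OF Suc.prems(2)] in auto)
      show "Ck_on k (\<lambda>x. (dd v g x \<bullet> b) *\<^sub>R dd b f (g x)) E"
        by (rule Ck_on_bilinear[OF bounded_bilinear_scaleR E 1 2])
    qed
  qed
qed

text \<open>The derivative is, up to a constant, the square of \<open>inverse\<close>, so the
  induction feeds on itself.\<close>

lemma Ck_on_inverse: "Ck_on k inverse (- {0::real})"
proof (induction k)
  case 0
  then show ?case by (auto intro!: continuous_intros)
next
  case (Suc k)
  have op: "open (- {0::real})" by auto
  show ?case
  proof (rule Ck_on_SucI[OF op])
    show "(inverse has_derivative (\<lambda>v. - v * (inverse x * inverse x))) (at x)" if "x \<in> - {0}" for x :: real
      using that by (auto intro!: derivative_eq_intros simp: fun_eq_iff)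
    show "Ck_on k (\<lambda>x. - v * (inverse x * inverse x)) (- {0::real})" for v
      by (intro Ck_on_bilinear[OF bounded_bilinear_mult op] Suc Ck_on_const)
  qed
qed

lemma Ck_on_sqrt: "Ck_on k sqrt {0<..}"
proof (induction k)
  case 0
  then show ?case by (auto intro!: continuous_intros)
next
  case (Suc k)
  have op: "open {0::real<..}" "open (- {0::real})" by auto
  show ?case
  proof (rule Ck_on_SucI[OF op(1)])
    show "(sqrt has_derivative (\<lambda>v. v / 2 * inverse (sqrt x))) (at x)" if "x \<in> {0<..}" for x :: real
      using that by (auto intro!: derivative_eq_intros simp: fun_eq_iff field_simps)
    have "Ck_on k (\<lambda>x. inverse (sqrt x)) {0<..}"
      by (rule Ck_on_compose[OF op(2,1) Ck_on_inverse Suc]) auto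
    then show "Ck_on k (\<lambda>x. v / 2 * inverse (sqrt x)) {0<..}" for v
      by (intro Ck_on_bilinear[OF bounded_bilinear_mult op(1)] Ck_on_const)
  qed
qed

section \<open>Closure properties of smooth maps\<close>

named_theorems smooth_intros

lemma smooth_on_cong:
  assumes "open D" "\<And>x. x \<in> D \<Longrightarrow> f x = g x"
  shows "smooth_on D f \<longleftrightarrow> smooth_on D g"
  unfolding smooth_on_def by (rule iff_allI, rule Ck_on_cong[OF assms])

lemma smooth_on_subset: "smooth_on D f \<Longrightarrow> E \<subseteq> D \<Longrightarrow> smooth_on E f"
  unfolding smooth_on_def by (blast intro: Ck_on_subset)

lemma smooth_on_continuous: "smooth_on D f \<Longrightarrow> continuous_on D f"
  unfolding smooth_on_def by (drule spec[of _ 0]) simp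

lemma smooth_on_differentiable: "smooth_on D f \<Longrightarrow> x \<in> D \<Longrightarrow> f differentiable (at x)"
  unfolding smooth_on_def by (drule spec[of _ 1]) simp

lemma smooth_on_has_derivative:
  "smooth_on D f \<Longrightarrow> x \<in> D \<Longrightarrow> (f has_derivative (\<lambda>v. dd v f x)) (at x)"
  using frechet_derivative_works smooth_on_differentiable by blast

lemma smooth_on_linear: "smooth_on D f \<Longrightarrow> x \<in> D \<Longrightarrow> linear (\<lambda>v. dd v f x)"
  by (simp add: linear_frechet_derivative smooth_on_differentiable)

lemma smooth_on_dd [smooth_intros]: "smooth_on D f \<Longrightarrow> smooth_on D (\<lambda>x. dd v f x)"
  unfolding smooth_on_def
proof
  fix k assume "\<forall>k. Ck_on k f D"
  then have "Ck_on (Suc k) f D" by blast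
  then show "Ck_on k (\<lambda>x. dd v f x) D" by simp
qed

lemma smooth_on_const [smooth_intros]: "smooth_on D (\<lambda>x. c)"
  by (simp add: smooth_on_def Ck_on_const)

lemma smooth_on_bounded_linear: "bounded_linear L \<Longrightarrow> smooth_on D L"
  by (simp add: smooth_on_def Ck_on_bounded_linear)

lemma smooth_on_ident [smooth_intros]: "smooth_on D (\<lambda>x. x)"
  by (rule smooth_on_bounded_linear) (rule bounded_linear_ident)

lemma smooth_on_compose:
  "open D \<Longrightarrow> open E \<Longrightarrow> smooth_on D f \<Longrightarrow> smooth_on E g \<Longrightarrow> g ` E \<subseteq> D \<Longrightarrow> smooth_on E (\<lambda>x. f (g x))"
  unfolding smooth_on_def using Ck_on_compose by blast

lemma smooth_on_linear_compose:
  "bounded_linear L \<Longrightarrow> open E \<Longrightarrow> smooth_on E g \<Longrightarrow> smooth_on E (\<lambda>x. L (g x))"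
  by (rule smooth_on_compose[of UNIV]) (auto intro: smooth_on_bounded_linear)

lemma smooth_on_fst [smooth_intros]: "open E \<Longrightarrow> smooth_on E g \<Longrightarrow> smooth_on E (\<lambda>x. fst (g x))"
  by (rule smooth_on_linear_compose[OF bounded_linear_fst])

lemma smooth_on_snd [smooth_intros]: "open E \<Longrightarrow> smooth_on E g \<Longrightarrow> smooth_on E (\<lambda>x. snd (g x))"
  by (rule smooth_on_linear_compose[OF bounded_linear_snd])

lemma smooth_on_uminus [smooth_intros]: "open E \<Longrightarrow> smooth_on E g \<Longrightarrow> smooth_on E (\<lambda>x. - g x)"
  by (rule smooth_on_linear_compose[OF bounded_linear_minus[OF bounded_linear_ident]])

lemma smooth_on_add [smooth_intros]:
  "open D \<Longrightarrow> smooth_on D f \<Longrightarrow> smooth_on D g \<Longrightarrow> smooth_on D (\<lambda>x. f x + g x)"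
  unfolding smooth_on_def using Ck_on_add by blast

lemma smooth_on_diff [smooth_intros]:
  "open D \<Longrightarrow> smooth_on D f \<Longrightarrow> smooth_on D g \<Longrightarrow> smooth_on D (\<lambda>x. f x - g x)"
  using smooth_on_add[of D f "\<lambda>x. - g x"] smooth_on_uminus by auto

lemma smooth_on_bilinear:
  "bounded_bilinear p \<Longrightarrow> open D \<Longrightarrow> smooth_on D f \<Longrightarrow> smooth_on D g \<Longrightarrow> smooth_on D (\<lambda>x. p (f x) (g x))"
  unfolding smooth_on_def using Ck_on_bilinear by blast

lemmas smooth_on_scaleR [smooth_intros] = smooth_on_bilinear[OF bounded_bilinear_scaleR]
lemmas smooth_on_inner [smooth_intros] = smooth_on_bilinear[OF bounded_bilinear_inner]

lemma smooth_on_mult [smooth_intros]: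
  fixes f g :: "'a::euclidean_space \<Rightarrow> real"
  shows "open D \<Longrightarrow> smooth_on D f \<Longrightarrow> smooth_on D g \<Longrightarrow> smooth_on D (\<lambda>x. f x * g x)"
  by (rule smooth_on_bilinear[OF bounded_bilinear_mult])

lemma smooth_on_power2 [smooth_intros]:
  fixes f :: "'a::euclidean_space \<Rightarrow> real"
  shows "open D \<Longrightarrow> smooth_on D f \<Longrightarrow> smooth_on D (\<lambda>x. (f x)\<^sup>2)"
  by (simp add: power2_eq_square smooth_on_mult)

lemma smooth_on_divide [smooth_intros]:
  fixes f g :: "'a::euclidean_space \<Rightarrow> real"
  assumes "open D" "smooth_on D f" "smooth_on D g" "\<And>x. x \<in> D \<Longrightarrow> g x \<noteq> 0"
  shows "smooth_on D (\<lambda>x. f x / g x)"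
proof -
  have "smooth_on D (\<lambda>x. inverse (g x))"
  proof (rule smooth_on_compose[OF _ assms(1) _ assms(3)])
    show "smooth_on (- {0::real}) inverse"
      unfolding smooth_on_def by (rule allI, rule Ck_on_inverse)
  qed (use assms(4) in auto)
  then show ?thesis
    using smooth_on_mult[OF assms(1,2)] by (simp add: divide_inverse)
qed

lemma smooth_on_sqrt [smooth_intros]:
  assumes "open D" "smooth_on D g" "\<And>x. x \<in> D \<Longrightarrow> g x > 0"
  shows "smooth_on D (\<lambda>x. sqrt (g x))"
proof (rule smooth_on_compose[OF _ assms(1) _ assms(2)])
  show "smooth_on {0<..} sqrt"
    unfolding smooth_on_def by (rule allI, rule Ck_on_sqrt)
qed (use assms(3) in auto)

lemma smooth_on_Pair [smooth_intros]:
  assumes "open D" "smooth_on D f" "smooth_on D g"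
  shows "smooth_on D (\<lambda>x. (f x, g x))"
proof -
  have "smooth_on D (\<lambda>x. (f x, 0) + (0, g x))"
    by (intro smooth_on_add assms smooth_on_linear_compose[where L = "\<lambda>y. (y, 0)"]
        smooth_on_linear_compose[where L = "\<lambda>y. (0, y)"] bounded_linear_Pair bounded_linear_ident bounded_linear_zero)
  then show ?thesis by simp
qed

lemma smooth_on_deriv [smooth_intros]:
  fixes f :: "real \<Rightarrow> real"
  assumes "open D" "smooth_on D f"
  shows "smooth_on D (deriv f)"
proof -
  have "dd 1 f x = deriv f x" if "x \<in> D" for x
  proof -
    have "(f has_derivative (\<lambda>h. deriv f x * h)) (at x)"
      using smooth_on_differentiable[OF assms(2) that] DERIV_deriv_iff_real_differentiable[of f x]
      by (simp add: has_field_derivative_def)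
    from dd_eqI[OF this, of 1] show ?thesis by simp
  qed
  from smooth_on_cong[OF assms(1) this] show ?thesis using smooth_on_dd[OF assms(2), of 1] by simp
qed

text \<open>Both second derivatives are limits of the same second difference quotient.\<close>

lemma second_difference_mvt:
  fixes F :: "'a::euclidean_space \<Rightarrow> real"
  assumes "smooth_on (ball x r) F" and s: "s > 0" "s * (norm a + norm b) < r"
  shows "\<exists>y. dist x y \<le> s * (norm a + norm b) \<and>
    F (x + s *\<^sub>R a + s *\<^sub>R b) - F (x + s *\<^sub>R a) - F (x + s *\<^sub>R b) + F x = s * s * dd b (\<lambda>z. dd a F z) y"
proof -
  have near: "norm (p *\<^sub>R a + q *\<^sub>R b) \<le> s * (norm a + norm b)" if "0 \<le> p" "p \<le> s" "0 \<le> q" "q \<le> s" for p q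
  proof -
    have "norm (p *\<^sub>R a + q *\<^sub>R b) \<le> p * norm a + q * norm b"
      using norm_triangle_ineq[of "p *\<^sub>R a" "q *\<^sub>R b"] that by simp
    also have "\<dots> \<le> s * norm a + s * norm b" using that by (intro add_mono mult_right_mono) auto
    finally show ?thesis by (simp add: distrib_left)
  qed
  have dist_eq: "dist x (x + u) = norm u" for u by (simp add: dist_norm)
  have inb: "x + p *\<^sub>R a + q *\<^sub>R b \<in> ball x r" if "0 \<le> p" "p \<le> s" "0 \<le> q" "q \<le> s" for p q
    using le_less_trans[OF near[OF that] s(2)] by (simp add: add.assoc dist_eq)
  have hd: "(G has_derivative (\<lambda>v. dd v G (x + p *\<^sub>R a + q *\<^sub>R b))) (at (x + p *\<^sub>R a + q *\<^sub>R b))"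
    if "0 \<le> p" "p \<le> s" "0 \<le> q" "q \<le> s" "smooth_on (ball x r) G" for p q and G :: "'a \<Rightarrow> real"
    using smooth_on_has_derivative[OF that(5) inb[OF that(1-4)]] .
  have d1: "((\<lambda>p. F (x + p *\<^sub>R a + q *\<^sub>R b)) has_real_derivative dd a F (x + p *\<^sub>R a + q *\<^sub>R b)) (at p)"
    if "0 \<le> p" "p \<le> s" "0 \<le> q" "q \<le> s" for p q
  proof -
    have "((\<lambda>p. x + p *\<^sub>R a + q *\<^sub>R b) has_derivative (\<lambda>h. h *\<^sub>R a)) (at p)"
      by (auto intro!: derivative_eq_intros)
    from has_derivative_compose[OF this hd[OF that assms(1)]]
    show ?thesis
      using linear_scale[OF smooth_on_linear[OF assms(1) inb[OF that]]]
      by (simp add: has_field_derivative_def mult_commute_abs)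
  qed
  have d2: "((\<lambda>q. dd a F (x + p *\<^sub>R a + q *\<^sub>R b)) has_real_derivative dd b (\<lambda>z. dd a F z) (x + p *\<^sub>R a + q *\<^sub>R b)) (at q)"
    if "0 \<le> p" "p \<le> s" "0 \<le> q" "q \<le> s" for p q
  proof -
    have sm: "smooth_on (ball x r) (\<lambda>z. dd a F z)" using assms(1) by (rule smooth_on_dd)
    have "((\<lambda>q. x + p *\<^sub>R a + q *\<^sub>R b) has_derivative (\<lambda>h. h *\<^sub>R b)) (at q)"
      by (auto intro!: derivative_eq_intros)
    from has_derivative_compose[OF this hd[OF that sm]]
    show ?thesis
      using linear_scale[OF smooth_on_linear[OF sm inb[OF that]]]
      by (simp add: has_field_derivative_def mult_commute_abs)
  qed
  \<comment> \<open>The second difference is the increment in \<open>p\<close> of a function already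
    differenced in \<open>q\<close>. The mean value theorem is used here in the \<open>a\<close>
    direction, and below in the \<open>b\<close> direction at the intermediate
    \<open>p\<close>.\<close>
  have "\<exists>p. 0 < p \<and> p < s \<and> (F (x + s *\<^sub>R a + s *\<^sub>R b) - F (x + s *\<^sub>R a + 0 *\<^sub>R b)) - (F (x + 0 *\<^sub>R a + s *\<^sub>R b) - F (x + 0 *\<^sub>R a + 0 *\<^sub>R b))
      = (s - 0) * (dd a F (x + p *\<^sub>R a + s *\<^sub>R b) - dd a F (x + p *\<^sub>R a + 0 *\<^sub>R b))"
    by (rule MVT2[OF s(1)], rule DERIV_diff; rule d1) (use s in auto)
  then obtain p where p: "0 < p" "p < s" and e1: "(F (x + s *\<^sub>R a + s *\<^sub>R b) - F (x + s *\<^sub>R a)) - (F (x + s *\<^sub>R b) - F x)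
      = s * (dd a F (x + p *\<^sub>R a + s *\<^sub>R b) - dd a F (x + p *\<^sub>R a + 0 *\<^sub>R b))" by auto
  have "\<exists>q. 0 < q \<and> q < s \<and> dd a F (x + p *\<^sub>R a + s *\<^sub>R b) - dd a F (x + p *\<^sub>R a + 0 *\<^sub>R b)
      = (s - 0) * dd b (\<lambda>z. dd a F z) (x + p *\<^sub>R a + q *\<^sub>R b)"
    by (rule MVT2[OF s(1)], rule d2) (use p in auto)
  then obtain q where q: "0 < q" "q < s" and e2: "dd a F (x + p *\<^sub>R a + s *\<^sub>R b) - dd a F (x + p *\<^sub>R a + 0 *\<^sub>R b)
      = s * dd b (\<lambda>z. dd a F z) (x + p *\<^sub>R a + q *\<^sub>R b)" by auto
  show ?thesis
  proof (intro exI conjI)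
    show "dist x (x + p *\<^sub>R a + q *\<^sub>R b) \<le> s * (norm a + norm b)"
      using near[of p q] p q by (simp add: add.assoc dist_eq)
    show "F (x + s *\<^sub>R a + s *\<^sub>R b) - F (x + s *\<^sub>R a) - F (x + s *\<^sub>R b) + F x = s * s * dd b (\<lambda>z. dd a F z) (x + p *\<^sub>R a + q *\<^sub>R b)"
      using e1 e2 by (simp add: algebra_simps)
  qed
qed

lemma dd_commute_real:
  fixes F :: "'a::euclidean_space \<Rightarrow> real"
  assumes D: "open D" "x \<in> D" and F: "smooth_on D F"
  shows "dd a (\<lambda>z. dd b F z) x = dd b (\<lambda>z. dd a F z) x"
proof -
  obtain r where r: "r > 0" "ball x r \<subseteq> D" using D openE by blast
  have F': "smooth_on (ball x r) F" using F r smooth_on_subset by blast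
  \<comment> \<open>The summand 1 keeps \<open>R\<close> positive when \<open>a = b = 0\<close>, and
    the 2 in the denominator of \<open>s n\<close> makes the bound by \<open>r\<close> strict
    already at \<open>n = 0\<close>.\<close>
  define R where "R = norm a + norm b + 1"
  have R: "R > 0" by (simp add: R_def add_nonneg_pos)
  define s where "s n = r / R / (real n + 2)" for n
  have s: "s n > 0" "s n * (norm a + norm b) < r" for n
  proof -
    show pos: "s n > 0" using r R by (simp add: s_def)
    have "s n * (norm a + norm b) \<le> s n * R"
      using pos by (intro mult_left_mono) (auto simp: R_def)
    also have "\<dots> = r / (real n + 2)" using R by (simp add: s_def)
    also have "\<dots> < r" using r by (simp add: field_simps add_pos_nonneg)
    finally show "s n * (norm a + norm b) < r" .
  qed
  have lim: "(\<lambda>n. s n * (norm a + norm b)) \<longlonglongrightarrow> 0"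
  proof -
    have "filterlim (\<lambda>n. real n + 2) at_top sequentially"
      using filterlim_tendsto_add_at_top[OF tendsto_const filterlim_real_sequentially, of 2] by (simp add: add.commute)
    then have "s \<longlonglongrightarrow> 0"
      unfolding s_def[abs_def] by (rule real_tendsto_divide_at_top[OF tendsto_const])
    then show ?thesis by (rule tendsto_mult_left_zero)
  qed
  \<comment> \<open>Used for both orders of \<open>a\<close> and \<open>b\<close>: the second
    difference is symmetric in its increments, and the condition on the norms lets both orders share
    the step sizes \<open>s n\<close>.\<close>
  have tend: "\<exists>y. (\<lambda>n. dd v (\<lambda>z. dd u F z) (y n)) \<longlonglongrightarrow> dd v (\<lambda>z. dd u F z) x \<and>
      (\<forall>n. F (x + s n *\<^sub>R u + s n *\<^sub>R v) - F (x + s n *\<^sub>R u) - F (x + s n *\<^sub>R v) + F x = s n * s n * dd v (\<lambda>z. dd u F z) (y n))"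
    if uv: "norm u + norm v = norm a + norm b" for u v
  proof -
    have "\<forall>n. \<exists>y. dist x y \<le> s n * (norm u + norm v) \<and>
      F (x + s n *\<^sub>R u + s n *\<^sub>R v) - F (x + s n *\<^sub>R u) - F (x + s n *\<^sub>R v) + F x = s n * s n * dd v (\<lambda>z. dd u F z) y"
      using second_difference_mvt[OF F', of "s n" u v for n] s uv by simp
    then obtain y where y: "\<And>n. dist x (y n) \<le> s n * (norm a + norm b)"
      "\<And>n. F (x + s n *\<^sub>R u + s n *\<^sub>R v) - F (x + s n *\<^sub>R u) - F (x + s n *\<^sub>R v) + F x = s n * s n * dd v (\<lambda>z. dd u F z) (y n)"
      using uv by metis
    have "(\<lambda>n. dist (y n) x) \<longlonglongrightarrow> 0"
      by (rule tendsto_sandwich[OF _ _ tendsto_const lim]) (use y(1) in \<open>simp_all add: dist_commute\<close>)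
    then have yx: "y \<longlonglongrightarrow> x" by (rule tendsto_dist_iff[THEN iffD2])
    have "continuous_on D (\<lambda>z. dd v (\<lambda>z. dd u F z) z)"
      by (intro smooth_on_continuous smooth_on_dd F)
    then have "isCont (\<lambda>z. dd v (\<lambda>z. dd u F z) z) x"
      using D by (simp add: continuous_on_eq_continuous_at)
    then have "(\<lambda>n. dd v (\<lambda>z. dd u F z) (y n)) \<longlonglongrightarrow> dd v (\<lambda>z. dd u F z) x"
      using yx by (rule isCont_tendsto_compose)
    with y(2) show ?thesis by blast
  qed
  obtain y where y: "(\<lambda>n. dd b (\<lambda>z. dd a F z) (y n)) \<longlonglongrightarrow> dd b (\<lambda>z. dd a F z) x"
    "\<And>n. F (x + s n *\<^sub>R a + s n *\<^sub>R b) - F (x + s n *\<^sub>R a) - F (x + s n *\<^sub>R b) + F x = s n * s n * dd b (\<lambda>z. dd a F z) (y n)"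
    using tend[of a b] by auto
  obtain z where z: "(\<lambda>n. dd a (\<lambda>z. dd b F z) (z n)) \<longlonglongrightarrow> dd a (\<lambda>z. dd b F z) x"
    "\<And>n. F (x + s n *\<^sub>R b + s n *\<^sub>R a) - F (x + s n *\<^sub>R b) - F (x + s n *\<^sub>R a) + F x = s n * s n * dd a (\<lambda>z. dd b F z) (z n)"
    using tend[of b a] by auto
  have "s n * s n * dd b (\<lambda>z. dd a F z) (y n) = s n * s n * dd a (\<lambda>z. dd b F z) (z n)" for n
    using y(2)[of n] z(2)[of n] by (simp add: algebra_simps)
  then have "dd b (\<lambda>z. dd a F z) (y n) = dd a (\<lambda>z. dd b F z) (z n)" for n
    using s(1)[of n] by (metis less_irrefl mult_cancel_left mult_pos_pos)
  then show ?thesis using y(1) z(1) LIMSEQ_unique by auto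
qed

lemma dd_commute:
  assumes D: "open D" "x \<in> D" and F: "smooth_on D F"
  shows "dd a (\<lambda>z. dd b F z) x = dd b (\<lambda>z. dd a F z) x"
proof (rule euclidean_eqI)
  fix i
  have dd_inner: "dd v (\<lambda>z. G z \<bullet> i) y = dd v G y \<bullet> i" if "smooth_on D G" "y \<in> D" for v y and G :: "'a \<Rightarrow> 'b"
    by (rule dd_eqI, rule has_derivative_inner_left, rule smooth_on_has_derivative) (use that in auto)
  have sm: "smooth_on D (\<lambda>z. F z \<bullet> i)" using D F by (intro smooth_intros)
  have "dd u (\<lambda>z. dd v (\<lambda>z. F z \<bullet> i) z) x = dd u (\<lambda>z. dd v F z) x \<bullet> i" for u v
  proof -
    have "dd u (\<lambda>z. dd v (\<lambda>z. F z \<bullet> i) z) x = dd u (\<lambda>z. dd v F z \<bullet> i) x"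
      by (rule dd_cong_open[OF D dd_inner[OF F]])
    also have "\<dots> = dd u (\<lambda>z. dd v F z) x \<bullet> i" by (intro dd_inner smooth_on_dd F D)
    finally show ?thesis .
  qed
  then show "dd a (\<lambda>z. dd b F z) x \<bullet> i = dd b (\<lambda>z. dd a F z) x \<bullet> i"
    using dd_commute_real[OF D sm, of a b] by simp
qed

text \<open>Gronwall's inequality in energy form: by Cauchy-Schwarz the derivative of the squared
  norm is at most \<open>2 * K\<close> times the squared norm, so the integrating factor in
  \<open>E\<close> makes it nonincreasing from the value 0.\<close>

lemma linear_ode_zero:
  fixes y y' :: "real \<Rightarrow> 'a::real_inner"
  assumes d: "\<And>s. 0 \<le> s \<Longrightarrow> s \<le> 1 \<Longrightarrow> (y has_vector_derivative y' s) (at s)"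
    and le: "\<And>s. 0 \<le> s \<Longrightarrow> s \<le> 1 \<Longrightarrow> norm (y' s) \<le> K * norm (y s)" and 0: "y 0 = 0"
    and s: "0 \<le> s" "s \<le> 1"
  shows "y s = 0"
proof -
  define E where "E s = (y s \<bullet> y s) * exp (- 2 * K * s)" for s
  have "E s \<le> E 0"
  proof (rule DERIV_nonpos_imp_nonincreasing[OF s(1)], intro exI conjI)
    fix r assume r: "0 \<le> r" "r \<le> s"
    have dr: "(y has_derivative (\<lambda>h. h *\<^sub>R y' r)) (at r)"
      using d[of r] r s by (simp add: has_vector_derivative_def)
    show "(E has_real_derivative ((2 * (y r \<bullet> y' r) - 2 * K * (y r \<bullet> y r)) * exp (- 2 * K * r))) (at r)"
      unfolding E_def has_field_derivative_def
      by (rule has_derivative_eq_rhs, (rule derivative_intros dr)+)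
        (auto simp: algebra_simps inner_commute)
    have "y r \<bullet> y' r \<le> norm (y r) * norm (y' r)" by (rule norm_cauchy_schwarz)
    also have "\<dots> \<le> norm (y r) * (K * norm (y r))" using le[of r] r s by (intro mult_left_mono) auto
    also have "\<dots> = K * (y r \<bullet> y r)" by (simp add: dot_square_norm power2_eq_square)
    finally show "(2 * (y r \<bullet> y' r) - 2 * K * (y r \<bullet> y r)) * exp (- 2 * K * r) \<le> 0"
      by (intro mult_nonpos_nonneg) auto
  qed
  then have "(y s \<bullet> y s) * exp (- 2 * K * s) \<le> 0" by (simp add: E_def 0)
  then have "y s \<bullet> y s \<le> 0" by (simp add: mult_le_0_iff not_le[symmetric])
  then show ?thesis using inner_ge_zero[of "y s"] by (simp add: antisym)
qed

section \<open>Submanifolds in charts\<close>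

lemma smooth_atlasD:
  assumes "smooth_atlas N A" "(C, \<kappa>) \<in> A"
  shows "openin (top_of_set N) C" "open (\<kappa> ` C)" "homeomorphism C (\<kappa> ` C) \<kappa> (inv_into C \<kappa>)" "inj_on \<kappa> C" "C \<subseteq> N"
proof -
  show C: "openin (top_of_set N) C" and "open (\<kappa> ` C)" and hom: "homeomorphism C (\<kappa> ` C) \<kappa> (inv_into C \<kappa>)"
    using assms unfolding smooth_atlas_def by auto
  show "C \<subseteq> N" using C openin_imp_subset by blast
  show "inj_on \<kappa> C"
    by (rule inj_on_inverseI[of C "inv_into C \<kappa>"]) (use hom in \<open>auto simp: homeomorphism_def\<close>)
qed

lemma smooth_atlas_transition:
  assumes "smooth_atlas N A" "(C, \<kappa>) \<in> A" "(C', \<kappa>') \<in> A"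
  shows "smooth_on (\<kappa> ` (C \<inter> C')) (\<kappa>' \<circ> inv_into C \<kappa>)"
  using assms unfolding smooth_atlas_def by fast

lemma chart_image_open:
  assumes A: "smooth_atlas N A" "(C, \<kappa>) \<in> A" and U: "openin (top_of_set N) U"
  shows "open (\<kappa> ` (U \<inter> C))"
proof -
  note C = smooth_atlasD[OF A]
  have "openin (top_of_set N) (U \<inter> C)" using U C(1) by blast
  then have "openin (top_of_set C) (U \<inter> C)"
    by (rule openin_subset_trans) (use C(5) in auto)
  from homeomorphism_imp_open_map[OF C(3) this] show ?thesis
    using C(2) openin_open_eq by blast
qed

lemma chart_preimage_open:
  assumes A: "smooth_atlas N A" "(C, \<kappa>) \<in> A" and B: "open B"
  shows "openin (top_of_set N) {q \<in> C. \<kappa> q \<in> B}"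
proof -
  note C = smooth_atlasD[OF A]
  have "continuous_on C \<kappa>" using C(3) by (simp add: homeomorphism_def)
  then have "openin (top_of_set C) (C \<inter> \<kappa> -` B)" using B by (rule continuous_openin_preimage_gen)
  moreover have "C \<inter> \<kappa> -` B = {q \<in> C. \<kappa> q \<in> B}" by auto
  ultimately show ?thesis using C(1) openin_trans by metis
qed

locale immersion =
  fixes S :: "('m::{t2_space, second_countable_topology}, 'e::euclidean_space, 'v::euclidean_space) submanifold"
  assumes atlas: "smooth_atlas (pts S) (charts S)"
    and imm_smooth: "smooth_map S (pts S) (imm S)"
    and imm_inj: "p \<in> pts S \<Longrightarrow> inj (deriv_in_chart S p (imm S))"
begin

lemmas chartD = smooth_atlasD[OF atlas]

lemma chart_at: "p \<in> pts S \<Longrightarrow> \<exists>C \<kappa>. chart_at S p = (C, \<kappa>) \<and> (C, \<kappa>) \<in> charts S \<and> p \<in> C"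
proof -
  assume "p \<in> pts S"
  moreover have "\<Union> (fst ` charts S) = pts S"
    using atlas unfolding smooth_atlas_def by (rule conjunct1)
  ultimately have "p \<in> \<Union> (fst ` charts S)" by simp
  then have "\<exists>ch. ch \<in> charts S \<and> p \<in> fst ch" by blast
  then have "chart_at S p \<in> charts S \<and> p \<in> fst (chart_at S p)"
    unfolding chart_at_def by (rule someI_ex)
  then show ?thesis by (cases "chart_at S p") auto
qed

lemma smooth_map_in_chart:
  "smooth_map S U W \<Longrightarrow> (C, \<kappa>) \<in> charts S \<Longrightarrow> smooth_on (\<kappa> ` (U \<inter> C)) (W \<circ> inv_into C \<kappa>)"
  unfolding smooth_map_def by fast

lemma dd_change_chart:
  assumes C: "(C, \<kappa>) \<in> charts S" and C': "(C', \<kappa>') \<in> charts S" and p: "p \<in> C" "p \<in> C'"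
    and U: "open_part S U" "p \<in> U" and W: "smooth_map S U W"
  shows "dd v (W \<circ> inv_into C \<kappa>) (\<kappa> p)
    = dd (dd v (\<kappa>' \<circ> inv_into C \<kappa>) (\<kappa> p)) (W \<circ> inv_into C' \<kappa>') (\<kappa>' p)"
proof -
  note D = chartD[OF C] and D' = chartD[OF C']
  let ?\<tau> = "\<kappa>' \<circ> inv_into C \<kappa>"
  have UC: "openin (top_of_set (pts S)) (U \<inter> C')" using U(1) D'(1) unfolding open_part_def by blast
  have op: "open (\<kappa> ` (U \<inter> C' \<inter> C))" by (rule chart_image_open[OF atlas C UC])
  have pin: "\<kappa> p \<in> \<kappa> ` (U \<inter> C' \<inter> C)" using p U by auto
  have tp: "?\<tau> (\<kappa> p) = \<kappa>' p" using p D(4) by simp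
  have d\<tau>: "(?\<tau> has_derivative (\<lambda>v. dd v ?\<tau> (\<kappa> p))) (at (\<kappa> p))"
    by (rule smooth_on_has_derivative[OF smooth_atlas_transition[OF atlas C C']]) (use p in auto)
  have dW: "((W \<circ> inv_into C' \<kappa>') has_derivative (\<lambda>v. dd v (W \<circ> inv_into C' \<kappa>') (\<kappa>' p))) (at (\<kappa>' p))"
    by (rule smooth_on_has_derivative[OF smooth_map_in_chart[OF W C']]) (use p U in auto)
  have "dd v (W \<circ> inv_into C \<kappa>) (\<kappa> p) = dd v (\<lambda>z. (W \<circ> inv_into C' \<kappa>') (?\<tau> z)) (\<kappa> p)"
    by (rule dd_cong_open[OF op pin]) (use D(4) D'(4) in auto)
  also have "\<dots> = dd (dd v ?\<tau> (\<kappa> p)) (W \<circ> inv_into C' \<kappa>') (\<kappa>' p)"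
    by (rule dd_eqI) (rule has_derivative_compose[OF d\<tau>, unfolded tp, OF dW])
  finally show ?thesis .
qed

lemma dd_transition_inverse:
  assumes C: "(C, \<kappa>) \<in> charts S" and C': "(C', \<kappa>') \<in> charts S" and p: "p \<in> C" "p \<in> C'"
  shows "dd (dd v (\<kappa>' \<circ> inv_into C \<kappa>) (\<kappa> p)) (\<kappa> \<circ> inv_into C' \<kappa>') (\<kappa>' p) = v"
proof -
  note D = chartD[OF C] and D' = chartD[OF C']
  let ?\<tau> = "\<kappa>' \<circ> inv_into C \<kappa>"
  have op: "open (\<kappa> ` (C' \<inter> C))" by (rule chart_image_open[OF atlas C D'(1)])
  have pin: "\<kappa> p \<in> \<kappa> ` (C' \<inter> C)" using p by auto
  have tp: "?\<tau> (\<kappa> p) = \<kappa>' p" using p D(4) by simp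
  have d\<tau>: "(?\<tau> has_derivative (\<lambda>v. dd v ?\<tau> (\<kappa> p))) (at (\<kappa> p))"
    by (rule smooth_on_has_derivative[OF smooth_atlas_transition[OF atlas C C']]) (use p in auto)
  have d\<tau>': "((\<kappa> \<circ> inv_into C' \<kappa>') has_derivative (\<lambda>v. dd v (\<kappa> \<circ> inv_into C' \<kappa>') (\<kappa>' p))) (at (\<kappa>' p))"
    by (rule smooth_on_has_derivative[OF smooth_atlas_transition[OF atlas C' C]]) (use p in auto)
  have "v = dd v (\<lambda>z. z) (\<kappa> p)" by simp
  also have "\<dots> = dd v (\<lambda>z. (\<kappa> \<circ> inv_into C' \<kappa>') (?\<tau> z)) (\<kappa> p)"
    by (rule dd_cong_open[OF op pin]) (use D(4) D'(4) in auto)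
  also have "\<dots> = dd (dd v ?\<tau> (\<kappa> p)) (\<kappa> \<circ> inv_into C' \<kappa>') (\<kappa>' p)"
    by (rule dd_eqI) (rule has_derivative_compose[OF d\<tau>, unfolded tp, OF d\<tau>'])
  finally show ?thesis by simp
qed

text \<open>The chart behind \<open>deriv_in_chart\<close> is an unspecified choice; the
  differential \<open>A\<close> of the transition map carries everything over to a chart at hand.
  One \<open>A\<close> serves all maps \<open>W\<close>, which is what lets it cancel in
  \<open>dir_deriv\<close>.\<close>

lemma deriv_in_chart_eq:
  assumes C: "(C, \<kappa>) \<in> charts S" and p: "p \<in> C"
  obtains A where "bij A" "\<And>U W v. open_part S U \<Longrightarrow> p \<in> U \<Longrightarrow> smooth_map S U W \<Longrightarrow>
    deriv_in_chart S p W (A v) = dd v (W \<circ> inv_into C \<kappa>) (\<kappa> p)"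
proof -
  have "p \<in> pts S" using chartD(5)[OF C] p by auto
  then obtain C' \<kappa>' where at: "chart_at S p = (C', \<kappa>')" and C': "(C', \<kappa>') \<in> charts S" and p': "p \<in> C'"
    using chart_at by blast
  define A where "A v = dd v (\<kappa>' \<circ> inv_into C \<kappa>) (\<kappa> p)" for v
  define B where "B v = dd v (\<kappa> \<circ> inv_into C' \<kappa>') (\<kappa>' p)" for v
  have "bij A"
  proof (rule o_bij)
    show "B \<circ> A = id" "A \<circ> B = id"
      using dd_transition_inverse[OF C C' p p'] dd_transition_inverse[OF C' C p' p]
      by (auto simp: A_def B_def fun_eq_iff)
  qed
  moreover have "deriv_in_chart S p W (A v) = dd v (W \<circ> inv_into C \<kappa>) (\<kappa> p)"
    if "open_part S U" "p \<in> U" "smooth_map S U W" for U W v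
    using dd_change_chart[OF C C' p p' that] by (simp add: deriv_in_chart_def at A_def)
  ultimately show ?thesis using that by blast
qed

lemma open_part_pts: "open_part S (pts S)"
  by (simp add: open_part_def)

lemma tangent_space_chart:
  assumes C: "(C, \<kappa>) \<in> charts S" and p: "p \<in> C"
  shows "tangent_space S p = range (\<lambda>v. dd v (imm S \<circ> inv_into C \<kappa>) (\<kappa> p))"
    and "inj (\<lambda>v. dd v (imm S \<circ> inv_into C \<kappa>) (\<kappa> p))"
proof -
  obtain A where A: "bij A" "\<And>U W v. open_part S U \<Longrightarrow> p \<in> U \<Longrightarrow> smooth_map S U W \<Longrightarrow>
    deriv_in_chart S p W (A v) = dd v (W \<circ> inv_into C \<kappa>) (\<kappa> p)"
    using deriv_in_chart_eq[OF C p] by blast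
  have pS: "p \<in> pts S" using chartD(5)[OF C] p by auto
  have eq: "(\<lambda>v. dd v (imm S \<circ> inv_into C \<kappa>) (\<kappa> p)) = deriv_in_chart S p (imm S) \<circ> A"
    using A(2)[OF open_part_pts pS imm_smooth] by (auto simp: fun_eq_iff)
  show "tangent_space S p = range (\<lambda>v. dd v (imm S \<circ> inv_into C \<kappa>) (\<kappa> p))"
    unfolding eq tangent_space_def image_comp[symmetric] using A(1) by (simp add: bij_is_surj)
  show "inj (\<lambda>v. dd v (imm S \<circ> inv_into C \<kappa>) (\<kappa> p))"
    unfolding eq using imm_inj[OF pS] A(1) by (intro inj_compose) (auto simp: bij_is_inj)
qed

lemma dir_deriv_chart:
  assumes C: "(C, \<kappa>) \<in> charts S" and p: "p \<in> C"
    and U: "open_part S U" "p \<in> U" and W: "smooth_map S U W"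
  shows "dir_deriv S p (dd v (imm S \<circ> inv_into C \<kappa>) (\<kappa> p)) W = dd v (W \<circ> inv_into C \<kappa>) (\<kappa> p)"
proof -
  obtain A where A: "bij A" "\<And>U W v. open_part S U \<Longrightarrow> p \<in> U \<Longrightarrow> smooth_map S U W \<Longrightarrow>
    deriv_in_chart S p W (A v) = dd v (W \<circ> inv_into C \<kappa>) (\<kappa> p)"
    using deriv_in_chart_eq[OF C p] by blast
  have pS: "p \<in> pts S" using chartD(5)[OF C] p by auto
  have "inv (deriv_in_chart S p (imm S)) (dd v (imm S \<circ> inv_into C \<kappa>) (\<kappa> p)) = A v"
    unfolding A(2)[OF open_part_pts pS imm_smooth, symmetric] using imm_inj[OF pS] by (rule inv_f_f)
  then show ?thesis
    using A(2)[OF U W] by (simp add: dir_deriv_def)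
qed

text \<open>Smoothness in one chart containing the domain passes to every other chart by composition
  with a smooth transition map.\<close>

lemma smooth_mapI:
  assumes C: "(C, \<kappa>) \<in> charts S" and U: "open_part S U" "U \<subseteq> C"
    and W: "smooth_on (\<kappa> ` U) (W \<circ> inv_into C \<kappa>)"
  shows "smooth_map S U W"
  unfolding smooth_map_def
proof (clarify)
  fix C' \<kappa>' assume C': "(C', \<kappa>') \<in> charts S"
  note D = chartD[OF C] and D' = chartD[OF C']
  have UC: "U \<inter> C = U" using U by auto
  have opU: "openin (top_of_set (pts S)) U" using U by (simp add: open_part_def)
  have op: "open (\<kappa>' ` (U \<inter> C'))" by (rule chart_image_open[OF atlas C' opU])
  have op2: "open (\<kappa> ` U)" using chart_image_open[OF atlas C opU] UC by simp
  have t: "smooth_on (\<kappa>' ` (U \<inter> C')) (\<kappa> \<circ> inv_into C' \<kappa>')"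
    by (rule smooth_on_subset[OF smooth_atlas_transition[OF atlas C' C]]) (use U in auto)
  have "smooth_on (\<kappa>' ` (U \<inter> C')) (\<lambda>z. (W \<circ> inv_into C \<kappa>) ((\<kappa> \<circ> inv_into C' \<kappa>') z))"
    by (rule smooth_on_compose[OF op2 op W t]) (use D'(4) in auto)
  moreover have "(W \<circ> inv_into C \<kappa>) ((\<kappa> \<circ> inv_into C' \<kappa>') z) = (W \<circ> inv_into C' \<kappa>') z"
    if "z \<in> \<kappa>' ` (U \<inter> C')" for z
    using that U D(4) D'(4) by auto
  ultimately show "smooth_on (\<kappa>' ` (U \<inter> C')) (W \<circ> inv_into C' \<kappa>')"
    using smooth_on_cong[OF op, of "\<lambda>z. (W \<circ> inv_into C \<kappa>) ((\<kappa> \<circ> inv_into C' \<kappa>') z)" "W \<circ> inv_into C' \<kappa>'"]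
    by blast
qed

lemma open_part_chart: "(C, \<kappa>) \<in> charts S \<Longrightarrow> open_part S C"
  using chartD(1) by (simp add: open_part_def)

end

lemma rw_submanifold_immersion: "rw_submanifold I c S \<Longrightarrow> immersion S"
  unfolding rw_submanifold_def immersion_def by blast

section \<open>Linear algebra of the Robertson-Walker metric\<close>

lemma smooth_on_sf_metric [smooth_intros]:
  assumes "open D" "smooth_on D X" "smooth_on D Y"
  shows "smooth_on D (\<lambda>z. sf_metric c (X z) (Y z))"
  unfolding sf_metric_def by (intro smooth_intros assms)

lemma sf_metric_simps:
  "sf_metric c (u + u') v = sf_metric c u v + sf_metric c u' v"
  "sf_metric c u (v + v') = sf_metric c u v + sf_metric c u v'"
  "sf_metric c (u - u') v = sf_metric c u v - sf_metric c u' v"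
  "sf_metric c u (v - v') = sf_metric c u v - sf_metric c u v'"
  "sf_metric c (r *\<^sub>R u) v = r * sf_metric c u v"
  "sf_metric c u (r *\<^sub>R v) = r * sf_metric c u v"
  "sf_metric c 0 v = 0" "sf_metric c u 0 = 0"
  by (auto simp: sf_metric_def algebra_simps inner_add_left inner_add_right inner_diff_left inner_diff_right)

lemma sf_metric_commute: "sf_metric c u v = sf_metric c v u"
  by (simp add: sf_metric_def inner_commute mult.commute)

text \<open>Only \<open>c = -1\<close> is delicate, since the ambient form is then indefinite. A
  tangent vector is orthogonal to the time-like position vector, and Cauchy-Schwarz applied to
  \<open>s * w = x' \<bullet> v\<close> with \<open>s^2 = x' \<bullet> x' + 1\<close> gives
  \<open>v \<bullet> v \<le> s^2 * (v \<bullet> v - w^2)\<close>.\<close>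

lemma sf_metric_pos:
  assumes c: "c \<in> {-1, 0, 1}" and x: "x \<in> space_form c" and u: "u \<in> sf_tangent c x" "u \<noteq> 0"
  shows "sf_metric c u u > 0"
proof -
  obtain x' s where xs: "x = (x', s)" by (cases x)
  obtain v w where vw: "u = (v, w)" by (cases u)
  have nz: "v \<noteq> 0 \<or> w \<noteq> 0" using u vw by (auto simp: zero_prod_def)
  have tan: "c * (x' \<bullet> v) + s * w = 0" using u xs vw by (simp add: sf_tangent_def)
  consider "c = 1" | "c = 0" | "c = -1" using c by auto
  then show ?thesis
  proof cases
    case 1
    then show ?thesis using nz vw
      by (cases "v = 0") (auto simp: sf_metric_def add_pos_nonneg power2_eq_square[symmetric])
  next
    case 2
    then have "s = 1" using x xs by (simp add: space_form_def)
    then have "w = 0" using tan 2 by simp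
    then show ?thesis using nz vw 2 by (simp add: sf_metric_def)
  next
    case 3
    then have s2: "s\<^sup>2 = x' \<bullet> x' + 1" "s > 0" using x xs by (auto simp: space_form_def)
    have sw: "s * w = x' \<bullet> v" using tan 3 by simp
    then have "s\<^sup>2 * w\<^sup>2 = (x' \<bullet> v)\<^sup>2" by (simp add: power_mult_distrib[symmetric])
    also have "\<dots> \<le> (x' \<bullet> x') * (v \<bullet> v)" by (rule Cauchy_Schwarz_ineq)
    finally have "v \<bullet> v \<le> s\<^sup>2 * (v \<bullet> v - w\<^sup>2)" by (simp add: s2 algebra_simps)
    moreover have "v \<noteq> 0" using nz sw s2 by auto
    ultimately have "0 < s\<^sup>2 * (v \<bullet> v - w\<^sup>2)" by (meson inner_gt_zero_iff less_le_trans)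
    then have "v \<bullet> v - w\<^sup>2 > 0" by (rule zero_less_mult_pos) (use s2(2) in simp)
    then show ?thesis using vw 3 by (simp add: sf_metric_def power2_eq_square)
  qed
qed

lemma rw_metric_simps:
  "rw_metric f c q (X + X') Y = rw_metric f c q X Y + rw_metric f c q X' Y"
  "rw_metric f c q X (Y + Y') = rw_metric f c q X Y + rw_metric f c q X Y'"
  "rw_metric f c q (X - X') Y = rw_metric f c q X Y - rw_metric f c q X' Y"
  "rw_metric f c q X (Y - Y') = rw_metric f c q X Y - rw_metric f c q X Y'"
  "rw_metric f c q (r *\<^sub>R X) Y = r * rw_metric f c q X Y"
  "rw_metric f c q X (r *\<^sub>R Y) = r * rw_metric f c q X Y"
  "rw_metric f c q 0 Y = 0" "rw_metric f c q X 0 = 0"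
  by (auto simp: rw_metric_def sf_metric_simps algebra_simps)

lemma rw_metric_commute: "rw_metric f c q X Y = rw_metric f c q Y X"
  by (simp add: rw_metric_def sf_metric_commute mult.commute)

lemma subspace_rw_tangent: "subspace (rw_tangent c q)"
  unfolding subspace_def rw_tangent_def sf_tangent_def
  by (auto simp: inner_add_right mem_Times_iff) (simp_all add: algebra_simps, metis distrib_left mult_zero_right)

text \<open>Value and derivative of the differentiated field scale jointly here. The last identity
  splits off a change of the derivative alone, which is how the Leibniz terms of variable
  coefficients are separated.\<close>

lemma rw_conn_linear:
  "rw_conn f c q X (Y + Y') (D + D') = rw_conn f c q X Y D + rw_conn f c q X Y' D'"
  "rw_conn f c q X (r *\<^sub>R Y) (r *\<^sub>R D) = r *\<^sub>R rw_conn f c q X Y D"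
  "rw_conn f c q X Y (D + E) = rw_conn f c q X Y D + E"
  by (rule prod_eqI; simp add: rw_conn_def Let_def sf_metric_simps algebra_simps add_divide_distrib)+

lemma rw_conn_linear_left:
  "rw_conn f c q (X + X') Y (D + D') = rw_conn f c q X Y D + rw_conn f c q X' Y D'"
  "rw_conn f c q (r *\<^sub>R X) Y (r *\<^sub>R D) = r *\<^sub>R rw_conn f c q X Y D"
  by (rule prod_eqI; simp add: rw_conn_def Let_def sf_metric_simps algebra_simps add_divide_distrib)+

lemma rw_conn_commute: "rw_conn f c q X Y D = rw_conn f c q Y X D"
  using rw_conn_torsion_free[of f c q X Y D D] by simp

lemma span_pair_iff: "X \<in> span {u, v} \<longleftrightarrow> (\<exists>a b. X = a *\<^sub>R u + b *\<^sub>R v)"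
proof
  assume "X \<in> span {u, v}"
  then obtain a where "X - a *\<^sub>R u \<in> span {v}" using span_breakdown_eq[of X u "{v}"] by blast
  then obtain b where "X - a *\<^sub>R u = b *\<^sub>R v" unfolding span_singleton by blast
  then have "X = a *\<^sub>R u + b *\<^sub>R v" by (metis add.commute diff_add_cancel)
  then show "\<exists>a b. X = a *\<^sub>R u + b *\<^sub>R v" by blast
next
  assume "\<exists>a b. X = a *\<^sub>R u + b *\<^sub>R v"
  then show "X \<in> span {u, v}" by (elim exE) (simp add: span_add span_scale span_base)
qed

text \<open>Orthogonal projection along a Lorentzian pair; the term in \<open>u\<close> is added
  because \<open>u\<close> has square -1. Pairing a candidate with \<open>u\<close> and
  \<open>v\<close> determines its tangential coefficients, so the description by \<open>THE\<close>
  is met uniquely.\<close>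

lemma normal_part_eq:
  assumes W: "tangent_space S p = span {u, v}" and tan: "u \<in> rw_tangent c (imm S p)" "v \<in> rw_tangent c (imm S p)"
    and on: "metric_at f c S p u u = -1" "metric_at f c S p v v = 1" "metric_at f c S p u v = 0"
    and V: "V \<in> rw_tangent c (imm S p)"
  shows "normal_part f c S p V = V + metric_at f c S p V u *\<^sub>R u - metric_at f c S p V v *\<^sub>R v"
proof -
  note sub = subspace_rw_tangent[of c "imm S p"]
  have on': "metric_at f c S p v u = 0" using on(3) rw_metric_commute by metis
  define n where "n = V + metric_at f c S p V u *\<^sub>R u - metric_at f c S p V v *\<^sub>R v"
  have W': "X \<in> tangent_space S p \<longleftrightarrow> (\<exists>a b. X = a *\<^sub>R u + b *\<^sub>R v)" for X
    unfolding W by (rule span_pair_iff)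
  show ?thesis
    unfolding normal_part_def n_def[symmetric]
  proof (rule the_equality)
    have "n \<in> rw_tangent c (imm S p)" unfolding n_def
      by (intro subspace_diff[OF sub] subspace_add[OF sub] subspace_scale[OF sub] tan V)
    moreover have "metric_at f c S p n X = 0" if "X \<in> tangent_space S p" for X
      using that[unfolded W'] by (auto simp: n_def rw_metric_simps on on')
    moreover have "V - n = (- metric_at f c S p V u) *\<^sub>R u + metric_at f c S p V v *\<^sub>R v" by (simp add: n_def)
    then have "V - n \<in> tangent_space S p" using W' by blast
    ultimately show "n \<in> normal_space f c S p \<and> V - n \<in> tangent_space S p" by (simp add: normal_space_def)
  next
    fix m assume m: "m \<in> normal_space f c S p \<and> V - m \<in> tangent_space S p"
    then obtain a b where ab: "V - m = a *\<^sub>R u + b *\<^sub>R v" using W' by blast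
    then have m_eq: "m = V - a *\<^sub>R u - b *\<^sub>R v" by (simp add: algebra_simps)
    have "u \<in> tangent_space S p" "v \<in> tangent_space S p" unfolding W by (auto intro: span_base)
    then have "metric_at f c S p m u = 0" "metric_at f c S p m v = 0" using m by (auto simp: normal_space_def)
    then have "a = - metric_at f c S p V u" "b = metric_at f c S p V v"
      by (auto simp: m_eq rw_metric_simps on on')
    then show "m = n" by (simp add: m_eq n_def)
  qed
qed

section \<open>Vector fields in the plane of a parametrised surface\<close>

abbreviation b1 :: "real ^ 2" where "b1 \<equiv> axis 1 1"
abbreviation b2 :: "real ^ 2" where "b2 \<equiv> axis 2 1"

lemma vec2_eq: "v = (v $ 1) *\<^sub>R b1 + (v $ 2) *\<^sub>R (b2 :: real ^ 2)"
  by (simp add: vec_eq_iff forall_2 axis_def)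

lemma linear_vec2:
  assumes "linear L" shows "L (v :: real ^ 2) = (v $ 1) *\<^sub>R L b1 + (v $ 2) *\<^sub>R L b2"
  by (subst vec2_eq[of v]) (simp add: linear_add[OF assms] linear_scale[OF assms])

text \<open>The strict Cauchy-Schwarz inequality: \<open>r\<close> is \<open>q \<bullet> q\<close>
  times the component of \<open>p\<close> orthogonal to \<open>q\<close>, scaled to avoid
  division.\<close>

lemma gram_pos:
  fixes p q :: "'a::real_inner"
  assumes ind: "\<And>a b. a *\<^sub>R p + b *\<^sub>R q = 0 \<Longrightarrow> a = 0 \<and> b = 0"
  shows "(p \<bullet> p) * (q \<bullet> q) - (p \<bullet> q)\<^sup>2 > 0"
proof -
  have q: "q \<bullet> q > 0" using ind[of 0 1] by auto
  define r where "r = (q \<bullet> q) *\<^sub>R p - (p \<bullet> q) *\<^sub>R q"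
  have "r \<noteq> 0" using ind[of "q \<bullet> q" "- (p \<bullet> q)"] q by (auto simp: r_def)
  then have "0 < r \<bullet> r" by simp
  also have "r \<bullet> r = (q \<bullet> q) * ((p \<bullet> p) * (q \<bullet> q) - (p \<bullet> q)\<^sup>2)"
    by (simp add: r_def inner_diff_left inner_diff_right inner_commute power2_eq_square algebra_simps)
  finally show ?thesis using q by (simp add: zero_less_mult_iff)
qed

text \<open>Cramer's rule in the Euclidean inner product of the ambient vector space. It gives
  coefficients by a formula in \<open>X\<close>, \<open>p\<close>, \<open>q\<close>, so they inherit
  differentiability.\<close>

lemma gram_coefficients:
  fixes p q :: "'a::real_inner"
  assumes X: "X = a *\<^sub>R p + b *\<^sub>R q" and D: "(p \<bullet> p) * (q \<bullet> q) - (p \<bullet> q)\<^sup>2 \<noteq> 0"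
  shows "((q \<bullet> q) * (X \<bullet> p) - (p \<bullet> q) * (X \<bullet> q)) / ((p \<bullet> p) * (q \<bullet> q) - (p \<bullet> q)\<^sup>2) = a"
    "((p \<bullet> p) * (X \<bullet> q) - (p \<bullet> q) * (X \<bullet> p)) / ((p \<bullet> p) * (q \<bullet> q) - (p \<bullet> q)\<^sup>2) = b"
  using D by (simp_all add: X inner_add_left inner_add_right inner_commute power2_eq_square field_simps)

lemma line_has_vector_derivative:
  fixes F :: "'a::euclidean_space \<Rightarrow> 'b::euclidean_space"
  assumes "F differentiable (at (z + s *\<^sub>R v))"
  shows "((\<lambda>s. F (z + s *\<^sub>R v)) has_vector_derivative dd v F (z + s *\<^sub>R v)) (at s)"
proof -
  have hd: "(F has_derivative frechet_derivative F (at (z + s *\<^sub>R v))) (at (z + s *\<^sub>R v))"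
    using assms frechet_derivative_works by blast
  have "((\<lambda>s. z + s *\<^sub>R v) has_derivative (\<lambda>h. h *\<^sub>R v)) (at s)"
    by (auto intro!: derivative_eq_intros)
  from has_derivative_compose[OF this hd] show ?thesis
    using linear_scale[OF linear_frechet_derivative[OF assms]] by (simp add: has_vector_derivative_def)
qed

lemma eventually_line:
  fixes z :: "'a::real_normed_vector"
  assumes "open D" "z \<in> D"
  shows "eventually (\<lambda>s. z + s *\<^sub>R v \<in> D) (nhds (0::real))"
proof -
  have "open ((\<lambda>s::real. z + s *\<^sub>R v) -` D)"
    by (intro open_vimage assms continuous_intros)
  from eventually_nhds_in_open[OF this, of 0] show ?thesis using assms by simp
qed

lemma dd_in_rw_tangent:
  fixes \<phi> :: "'a::euclidean_space \<Rightarrow> vec5"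
  assumes c: "c \<in> {-1, 0, 1}" and U: "open U" "z \<in> U" and \<phi>: "\<phi> differentiable (at z)"
    and space: "\<And>y. y \<in> U \<Longrightarrow> \<phi> y \<in> rw_space I c"
  shows "dd v \<phi> z \<in> rw_tangent c (\<phi> z)"
proof -
  have "dd v \<phi> z \<in> rw_tangent c ((\<lambda>s. \<phi> (z + s *\<^sub>R v)) 0)"
  proof (rule velocity_in_rw_tangent[OF c, where \<gamma> = "\<lambda>s. \<phi> (z + s *\<^sub>R v)" and I = I])
    show "\<forall>\<^sub>F s in at 0. \<phi> (z + s *\<^sub>R v) \<in> rw_space I c"
      using eventually_line[OF U, of v]
      by (auto simp: eventually_at_filter intro: space elim: eventually_mono)
    show "((\<lambda>s. \<phi> (z + s *\<^sub>R v)) has_vector_derivative dd v \<phi> z) (at 0)"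
      using line_has_vector_derivative[of \<phi> z 0 v] \<phi> by simp
  qed (use space[OF U(2)] in simp)
  then show ?thesis by simp
qed

lemma rw_conn_in_rw_tangent:
  fixes \<phi> :: "'a::euclidean_space \<Rightarrow> vec5"
  assumes c: "c \<in> {-1, 0, 1}" and U: "open U" "z \<in> U" and \<phi>: "\<phi> differentiable (at z)"
    and space: "\<And>y. y \<in> U \<Longrightarrow> \<phi> y \<in> rw_space I c"
    and F: "F differentiable (at z)" "\<And>y. y \<in> U \<Longrightarrow> F y \<in> rw_tangent c (\<phi> y)"
  shows "rw_conn f c (\<phi> z) (dd v \<phi> z) (F z) (dd v F z) \<in> rw_tangent c (\<phi> z)"
proof -
  have "rw_conn f c ((\<lambda>s. \<phi> (z + s *\<^sub>R v)) 0) (dd v \<phi> z) ((\<lambda>s. F (z + s *\<^sub>R v)) 0) (dd v F z)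
      \<in> rw_tangent c ((\<lambda>s. \<phi> (z + s *\<^sub>R v)) 0)"
  proof (rule rw_conn_tangent[OF c, where \<gamma> = "\<lambda>s. \<phi> (z + s *\<^sub>R v)" and Y = "\<lambda>s. F (z + s *\<^sub>R v)" and I = I])
    show "\<forall>\<^sub>F s in nhds 0. F (z + s *\<^sub>R v) \<in> rw_tangent c (\<phi> (z + s *\<^sub>R v))"
      using eventually_line[OF U, of v] F(2) by (auto elim: eventually_mono)
    show "((\<lambda>s. \<phi> (z + s *\<^sub>R v)) has_vector_derivative dd v \<phi> z) (at 0)"
      using line_has_vector_derivative[of \<phi> z 0 v] \<phi> by simp
    show "((\<lambda>s. F (z + s *\<^sub>R v)) has_vector_derivative dd v F z) (at 0)"
      using line_has_vector_derivative[of F z 0 v] F by simp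
  qed (use space[OF U(2)] dd_in_rw_tangent[OF c U \<phi> space] in simp_all)
  then show ?thesis by simp
qed

section \<open>A time-like surface in one coordinate chart\<close>

locale rw_surface_chart =
  fixes I :: "real set" and f :: "real \<Rightarrow> real" and c :: real
    and M :: "('m::{t2_space, second_countable_topology}, real ^ 2, vec5) submanifold"
    and C :: "'m set" and \<kappa> :: "'m \<Rightarrow> real ^ 2"
  assumes c: "c \<in> {-1, 0, 1}" and I: "open I" and f: "smooth_on I f" "\<forall>t\<in>I. f t \<noteq> 0"
    and surface: "time_like_surface I f c M" and chart: "(C, \<kappa>) \<in> charts M"
begin

sublocale immersion M
  by (rule rw_submanifold_immersion[of I c M]) (use surface in \<open>simp add: time_like_surface_def\<close>)

text \<open>\<open>cd v F\<close> is the covariant derivative of a field \<open>F\<close> along the parametrised surface \<open>\<phi>\<close> in the coordinate direction \<open>v\<close>.\<close>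

definition \<Omega> where "\<Omega> = \<kappa> ` C"
definition \<phi> where "\<phi> = imm M \<circ> inv_into C \<kappa>"
definition pt where "pt z = inv_into C \<kappa> z"
definition TM where "TM z = range (\<lambda>v. dd v \<phi> z)"
definition cd where "cd v F z = rw_conn f c (\<phi> z) (dd v \<phi> z) (F z) (dd v F z)"
definition g where "g z X Y = rw_metric f c (\<phi> z) X Y"

lemma \<Omega>: "open \<Omega>"
  using chartD(2)[OF chart] by (simp add: \<Omega>_def)

lemma pt: "z \<in> \<Omega> \<Longrightarrow> pt z \<in> C" "z \<in> \<Omega> \<Longrightarrow> \<kappa> (pt z) = z" "q \<in> C \<Longrightarrow> pt (\<kappa> q) = q" "q \<in> C \<Longrightarrow> \<kappa> q \<in> \<Omega>"
  using chartD(4)[OF chart] by (auto simp: pt_def \<Omega>_def inv_into_into f_inv_into_f)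

lemma C_pts: "C \<subseteq> pts M"
  using chartD(5)[OF chart] .

lemma \<phi>_pt: "imm M (pt z) = \<phi> z"
  by (simp add: \<phi>_def pt_def)

lemma smooth_\<phi>: "smooth_on \<Omega> \<phi>"
  using smooth_map_in_chart[OF imm_smooth chart] C_pts by (simp add: \<Omega>_def \<phi>_def Int_absorb1)

lemma tangent_space_pt: "z \<in> \<Omega> \<Longrightarrow> tangent_space M (pt z) = TM z"
  using tangent_space_chart(1)[OF chart, of "pt z"] pt by (simp add: TM_def \<phi>_def)

lemma inj_d\<phi>: "z \<in> \<Omega> \<Longrightarrow> inj (\<lambda>v. dd v \<phi> z)"
  using tangent_space_chart(2)[OF chart, of "pt z"] pt by (simp add: \<phi>_def)

lemma linear_d\<phi>: "z \<in> \<Omega> \<Longrightarrow> linear (\<lambda>v. dd v \<phi> z)"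
  by (rule smooth_on_linear[OF smooth_\<phi>])

lemma d\<phi>_eq: "z \<in> \<Omega> \<Longrightarrow> dd v \<phi> z = (v $ 1) *\<^sub>R dd b1 \<phi> z + (v $ 2) *\<^sub>R dd b2 \<phi> z"
  using linear_vec2[OF linear_d\<phi>] .

lemma TM_iff: "z \<in> \<Omega> \<Longrightarrow> X \<in> TM z \<longleftrightarrow> (\<exists>a b. X = a *\<^sub>R dd b1 \<phi> z + b *\<^sub>R dd b2 \<phi> z)"
proof -
  assume z: "z \<in> \<Omega>"
  have "\<exists>v. X = dd v \<phi> z" if "X = a *\<^sub>R dd b1 \<phi> z + b *\<^sub>R dd b2 \<phi> z" for a b
    using d\<phi>_eq[OF z, of "vector [a, b]"] that by (intro exI[of _ "vector [a, b]"]) simp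
  moreover have "\<exists>a b. dd v \<phi> z = a *\<^sub>R dd b1 \<phi> z + b *\<^sub>R dd b2 \<phi> z" for v
    using d\<phi>_eq[OF z, of v] by blast
  ultimately show ?thesis unfolding TM_def by blast
qed

lemma d\<phi>_independent:
  assumes "z \<in> \<Omega>" "a *\<^sub>R dd b1 \<phi> z + b *\<^sub>R dd b2 \<phi> z = 0" shows "a = 0 \<and> b = 0"
proof -
  have "dd (vector [a, b]) \<phi> z = dd 0 \<phi> z"
    using d\<phi>_eq[OF assms(1), of "vector [a, b]"] assms(2) linear_0[OF linear_d\<phi>[OF assms(1)]] by simp
  then have "vector [a, b] = (0 :: real ^ 2)" using inj_d\<phi>[OF assms(1)] by (simp add: inj_def)
  then show ?thesis by (simp add: vec_eq_iff forall_2)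
qed

lemma subspace_TM: "z \<in> \<Omega> \<Longrightarrow> subspace (TM z)"
  unfolding TM_def using linear_subspace_image[OF linear_d\<phi> subspace_UNIV] .

lemma d\<phi>_TM: "dd v \<phi> z \<in> TM z"
  by (simp add: TM_def)

lemma rw_space_\<phi>: "z \<in> \<Omega> \<Longrightarrow> \<phi> z \<in> rw_space I c"
proof -
  assume z: "z \<in> \<Omega>"
  have "imm M ` pts M \<subseteq> rw_space I c" using surface by (simp add: time_like_surface_def rw_submanifold_def)
  moreover have "pt z \<in> pts M" using pt(1)[OF z] C_pts by auto
  ultimately have "imm M (pt z) \<in> rw_space I c" by blast
  then show ?thesis by (simp add: \<phi>_pt)
qed

lemma fst_\<phi>: "z \<in> \<Omega> \<Longrightarrow> fst (\<phi> z) \<in> I" and snd_\<phi>: "z \<in> \<Omega> \<Longrightarrow> snd (\<phi> z) \<in> space_form c"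
  using rw_space_\<phi> by (auto simp: rw_space_def mem_Times_iff)

lemma d\<phi>_rw_tangent: "z \<in> \<Omega> \<Longrightarrow> dd v \<phi> z \<in> rw_tangent c (\<phi> z)"
  using dd_in_rw_tangent[OF c \<Omega> _ smooth_on_differentiable[OF smooth_\<phi>] rw_space_\<phi>] by simp

lemma TM_rw_tangent: "z \<in> \<Omega> \<Longrightarrow> TM z \<subseteq> rw_tangent c (\<phi> z)"
  using d\<phi>_rw_tangent by (auto simp: TM_def)

lemma cd_rw_tangent:
  assumes U: "open U" "z \<in> U" "U \<subseteq> \<Omega>" and F: "F differentiable (at z)" "\<And>y. y \<in> U \<Longrightarrow> F y \<in> rw_tangent c (\<phi> y)"
  shows "cd v F z \<in> rw_tangent c (\<phi> z)"
  unfolding cd_def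
  by (rule rw_conn_in_rw_tangent[OF c U(1,2) _ _ F, where I = I])
    (use U smooth_on_differentiable[OF smooth_\<phi>] rw_space_\<phi> in auto)

lemma TM_lorentz:
  assumes z: "z \<in> \<Omega>"
  obtains u v where "TM z = span {u, v}" "g z u u = -1" "g z v v = 1" "g z u v = 0"
proof -
  have "pt z \<in> pts M" using pt(1)[OF z] C_pts by auto
  then have "\<exists>u v. tangent_space M (pt z) = span {u, v} \<and> metric_at f c M (pt z) u u = -1 \<and>
      metric_at f c M (pt z) v v = 1 \<and> metric_at f c M (pt z) u v = 0"
    using surface unfolding time_like_surface_def by blast
  then show ?thesis using that by (auto simp: tangent_space_pt[OF z] \<phi>_pt g_def)
qed

text \<open>The third claim is the bridge used throughout: vanishing of a normal part becomes
  membership in the tangent plane.\<close>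

lemma normal_part_linear:
  assumes z: "z \<in> \<Omega>" and V: "V \<in> rw_tangent c (\<phi> z)" "V' \<in> rw_tangent c (\<phi> z)"
  shows "normal_part f c M (pt z) (V + V') = normal_part f c M (pt z) V + normal_part f c M (pt z) V'"
    "normal_part f c M (pt z) (r *\<^sub>R V) = r *\<^sub>R normal_part f c M (pt z) V"
    "normal_part f c M (pt z) V = 0 \<longleftrightarrow> V \<in> TM z"
    "normal_part f c M (pt z) V \<in> normal_space f c M (pt z)"
    "V - normal_part f c M (pt z) V \<in> TM z"
proof -
  obtain u v where uv: "TM z = span {u, v}" "g z u u = -1" "g z v v = 1" "g z u v = 0"
    using TM_lorentz[OF z] by metis
  note sub = subspace_rw_tangent[of c "\<phi> z"]
  have tan: "u \<in> rw_tangent c (\<phi> z)" "v \<in> rw_tangent c (\<phi> z)"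
    using TM_rw_tangent[OF z] uv(1) by (auto intro: span_base)
  have uvT: "u \<in> TM z" "v \<in> TM z" unfolding uv by (auto intro: span_base)
  have gvu: "g z v u = 0" using uv(4) by (simp add: g_def rw_metric_commute)
  have n: "normal_part f c M (pt z) V = V + g z V u *\<^sub>R u - g z V v *\<^sub>R v" if "V \<in> rw_tangent c (\<phi> z)" for V
    using normal_part_eq[of M "pt z" u v c f V] uv tan that tangent_space_pt[OF z] by (simp add: \<phi>_pt g_def)
  show "normal_part f c M (pt z) (V + V') = normal_part f c M (pt z) V + normal_part f c M (pt z) V'"
    using subspace_add[OF sub V] by (simp add: n V g_def rw_metric_simps algebra_simps)
  show "normal_part f c M (pt z) (r *\<^sub>R V) = r *\<^sub>R normal_part f c M (pt z) V"
    using subspace_scale[OF sub V(1)] by (simp add: n V g_def rw_metric_simps algebra_simps)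
  have diff: "V - normal_part f c M (pt z) V = (- g z V u) *\<^sub>R u + g z V v *\<^sub>R v" by (simp add: n V)
  then show inT: "V - normal_part f c M (pt z) V \<in> TM z"
    unfolding diff by (intro subspace_add subspace_scale subspace_TM z uvT)
  show "normal_part f c M (pt z) V = 0 \<longleftrightarrow> V \<in> TM z"
  proof
    assume "V \<in> TM z"
    then obtain a b where ab: "V = a *\<^sub>R u + b *\<^sub>R v"
      unfolding uv span_pair_iff by blast
    show "normal_part f c M (pt z) V = 0"
      unfolding n[OF V(1)] unfolding ab using uv gvu by (simp add: g_def rw_metric_simps)
  qed (use inT in auto)
  have "g z (normal_part f c M (pt z) V) X = 0" if "X \<in> TM z" for X
  proof -
    obtain a b where "X = a *\<^sub>R u + b *\<^sub>R v"
      using \<open>X \<in> TM z\<close> unfolding uv span_pair_iff by blast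
    then show ?thesis using uv gvu by (simp add: n V g_def rw_metric_simps)
  qed
  moreover have "normal_part f c M (pt z) V \<in> rw_tangent c (\<phi> z)"
    unfolding n[OF V(1)] by (intro subspace_diff[OF sub] subspace_add[OF sub] subspace_scale[OF sub] V tan)
  ultimately show "normal_part f c M (pt z) V \<in> normal_space f c M (pt z)"
    by (simp add: normal_space_def tangent_space_pt[OF z] \<phi>_pt g_def)
qed

lemma normal_part_cong:
  assumes z: "z \<in> \<Omega>" and V: "V \<in> rw_tangent c (\<phi> z)" "V' \<in> rw_tangent c (\<phi> z)" and d: "V - V' \<in> TM z"
  shows "normal_part f c M (pt z) V = normal_part f c M (pt z) V'"
proof -
  have dt: "V - V' \<in> rw_tangent c (\<phi> z)" using d TM_rw_tangent[OF z] by auto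
  have "normal_part f c M (pt z) ((V - V') + V') = normal_part f c M (pt z) (V - V') + normal_part f c M (pt z) V'"
    by (rule normal_part_linear(1)[OF z dt V(2)])
  then show ?thesis using normal_part_linear(3)[OF z dt dt] d by simp
qed

lemma gram_\<phi>: "z \<in> \<Omega> \<Longrightarrow> (dd b1 \<phi> z \<bullet> dd b1 \<phi> z) * (dd b2 \<phi> z \<bullet> dd b2 \<phi> z) - (dd b1 \<phi> z \<bullet> dd b2 \<phi> z)\<^sup>2 > 0"
  using gram_pos[of "dd b1 \<phi> z" "dd b2 \<phi> z"] d\<phi>_independent by blast

text \<open>This is why \<open>h\<close> depends only on the value of its second argument: in the
  Leibniz rule the derivatives of the coefficients multiply tangent vectors, so modulo
  \<open>TM\<close> only the values of the coefficients at \<open>z\<close> survive.\<close>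

lemma cd_tangent_field:
  assumes U: "open U" "z \<in> U" "U \<subseteq> \<Omega>" and F: "F differentiable (at z)" "\<And>y. y \<in> U \<Longrightarrow> F y \<in> TM y"
    and w: "F z = dd w \<phi> z"
  shows "cd v F z - (w $ 1 *\<^sub>R cd v (\<lambda>y. dd b1 \<phi> y) z + w $ 2 *\<^sub>R cd v (\<lambda>y. dd b2 \<phi> y) z) \<in> TM z"
proof -
  have z: "z \<in> \<Omega>" using U by auto
  let ?p = "\<lambda>y. dd b1 \<phi> y" and ?q = "\<lambda>y. dd b2 \<phi> y"
  let ?D = "\<lambda>y. (?p y \<bullet> ?p y) * (?q y \<bullet> ?q y) - (?p y \<bullet> ?q y)\<^sup>2"
  \<comment> \<open>Cramer's formula for the coefficients of \<open>F\<close>; arbitrary pointwise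
    choices would not be known to be differentiable.\<close>
  define \<alpha> where "\<alpha> y = ((?q y \<bullet> ?q y) * (F y \<bullet> ?p y) - (?p y \<bullet> ?q y) * (F y \<bullet> ?q y)) / ?D y" for y
  define \<beta> where "\<beta> y = ((?p y \<bullet> ?p y) * (F y \<bullet> ?q y) - (?p y \<bullet> ?q y) * (F y \<bullet> ?p y)) / ?D y" for y
  have Dz: "?D z \<noteq> 0" using gram_\<phi>[OF z] by auto
  have dp: "?p differentiable (at z)" "?q differentiable (at z)"
    by (intro smooth_on_differentiable[OF _ z] smooth_on_dd smooth_\<phi>)+
  have d\<alpha>: "\<alpha> differentiable (at z)" "\<beta> differentiable (at z)"
    unfolding \<alpha>_def \<beta>_def
    by (intro differentiable_divide differentiable_diff differentiable_mult differentiable_inner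
        differentiable_power dp F Dz)+
  have coef: "F y = \<alpha> y *\<^sub>R ?p y + \<beta> y *\<^sub>R ?q y" if y: "y \<in> U" for y
  proof -
    have y': "y \<in> \<Omega>" using y U by auto
    obtain a b where ab: "F y = a *\<^sub>R ?p y + b *\<^sub>R ?q y" using F(2)[OF y] TM_iff[OF y'] by blast
    show ?thesis
      using gram_coefficients[OF ab] gram_\<phi>[OF y'] ab by (simp add: \<alpha>_def \<beta>_def)
  qed
  have "dd v F z = dd v (\<lambda>y. \<alpha> y *\<^sub>R ?p y + \<beta> y *\<^sub>R ?q y) z"
    by (rule dd_cong_open[OF U(1,2) coef])
  also have "\<dots> = (\<alpha> z *\<^sub>R dd v ?p z + dd v \<alpha> z *\<^sub>R ?p z) + (\<beta> z *\<^sub>R dd v ?q z + dd v \<beta> z *\<^sub>R ?q z)"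
    by (rule dd_eqI[where F' = "\<lambda>v. (\<alpha> z *\<^sub>R dd v ?p z + dd v \<alpha> z *\<^sub>R ?p z) + (\<beta> z *\<^sub>R dd v ?q z + dd v \<beta> z *\<^sub>R ?q z)"])
      (intro has_derivative_add has_derivative_scaleR dp[unfolded frechet_derivative_works] d\<alpha>[unfolded frechet_derivative_works])
  finally have dF: "dd v F z = (\<alpha> z *\<^sub>R dd v ?p z + \<beta> z *\<^sub>R dd v ?q z) + (dd v \<alpha> z *\<^sub>R ?p z + dd v \<beta> z *\<^sub>R ?q z)"
    by simp
  have ab: "\<alpha> z = w $ 1" "\<beta> z = w $ 2"
    using d\<phi>_independent[OF z, of "\<alpha> z - w $ 1" "\<beta> z - w $ 2"] coef[OF U(2)] w d\<phi>_eq[OF z, of w]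
    by (auto simp: algebra_simps)
  have "cd v F z = (w $ 1 *\<^sub>R cd v ?p z + w $ 2 *\<^sub>R cd v ?q z) + (dd v \<alpha> z *\<^sub>R ?p z + dd v \<beta> z *\<^sub>R ?q z)"
    unfolding cd_def dF coef[OF U(2)] ab
    by (simp only: rw_conn_linear(1,2) rw_conn_linear(3)[where E = "dd v \<alpha> z *\<^sub>R ?p z + dd v \<beta> z *\<^sub>R ?q z"])
  moreover have "dd v \<alpha> z *\<^sub>R ?p z + dd v \<beta> z *\<^sub>R ?q z \<in> TM z" using TM_iff[OF z] by blast
  ultimately show ?thesis by simp
qed

lemma cd_d\<phi>_rw_tangent: "z \<in> \<Omega> \<Longrightarrow> cd v (\<lambda>y. dd w \<phi> y) z \<in> rw_tangent c (\<phi> z)"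
  by (rule cd_rw_tangent[OF \<Omega> _ order_refl])
    (use smooth_on_differentiable[OF smooth_on_dd[OF smooth_\<phi>]] d\<phi>_rw_tangent in auto)

text \<open>Symmetry of the second fundamental form: mixed second derivatives agree and the
  connection is torsion free.\<close>

lemma cd_d\<phi>_commute: "z \<in> \<Omega> \<Longrightarrow> cd v (\<lambda>y. dd w \<phi> y) z = cd w (\<lambda>y. dd v \<phi> y) z"
  unfolding cd_def using dd_commute[OF \<Omega> _ smooth_\<phi>, of z v w] rw_conn_commute by simp

lemma cd_d\<phi>_eq:
  assumes z: "z \<in> \<Omega>"
  shows "cd v (\<lambda>y. dd w \<phi> y) z = w $ 1 *\<^sub>R cd v (\<lambda>y. dd b1 \<phi> y) z + w $ 2 *\<^sub>R cd v (\<lambda>y. dd b2 \<phi> y) z"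
proof -
  have "dd v (\<lambda>y. dd w \<phi> y) z = dd v (\<lambda>y. w $ 1 *\<^sub>R dd b1 \<phi> y + w $ 2 *\<^sub>R dd b2 \<phi> y) z"
    by (rule dd_cong_open[OF \<Omega> z d\<phi>_eq])
  also have "\<dots> = w $ 1 *\<^sub>R dd v (\<lambda>y. dd b1 \<phi> y) z + w $ 2 *\<^sub>R dd v (\<lambda>y. dd b2 \<phi> y) z"
    by (rule dd_eqI[where F' = "\<lambda>v. w $ 1 *\<^sub>R dd v (\<lambda>y. dd b1 \<phi> y) z + w $ 2 *\<^sub>R dd v (\<lambda>y. dd b2 \<phi> y) z"])
      (intro has_derivative_add has_derivative_scaleR_right smooth_on_has_derivative[OF smooth_on_dd[OF smooth_\<phi>] z])
  finally have "cd v (\<lambda>y. dd w \<phi> y) z = rw_conn f c (\<phi> z) (dd v \<phi> z) (w $ 1 *\<^sub>R dd b1 \<phi> z + w $ 2 *\<^sub>R dd b2 \<phi> z)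
      (w $ 1 *\<^sub>R dd v (\<lambda>y. dd b1 \<phi> y) z + w $ 2 *\<^sub>R dd v (\<lambda>y. dd b2 \<phi> y) z)"
    by (simp only: cd_def d\<phi>_eq[OF z, of w, symmetric])
  then show ?thesis by (simp only: cd_def rw_conn_linear(1,2))
qed

lemma smooth_map_chartI:
  assumes U: "open_part M U" "U \<subseteq> C" and W: "smooth_on (\<kappa> ` U) F"
  shows "smooth_map M U (\<lambda>q. F (\<kappa> q))"
proof (rule smooth_mapI[OF chart U])
  have "open (\<kappa> ` (U \<inter> C))" using chart_image_open[OF atlas chart] U by (simp add: open_part_def)
  then have op: "open (\<kappa> ` U)" using U by (simp add: Int_absorb2)
  have "F z = ((\<lambda>q. F (\<kappa> q)) \<circ> inv_into C \<kappa>) z" if "z \<in> \<kappa> ` U" for z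
    using that U chartD(4)[OF chart] by auto
  with smooth_on_cong[OF op, of F "(\<lambda>q. F (\<kappa> q)) \<circ> inv_into C \<kappa>"] W
  show "smooth_on (\<kappa> ` U) ((\<lambda>q. F (\<kappa> q)) \<circ> inv_into C \<kappa>)" by blast
qed

lemma cov_deriv_chart:
  assumes z: "z \<in> \<Omega>" and U: "open_part M U" "pt z \<in> U" and W: "smooth_map M U W"
  shows "cov_deriv f c M (pt z) (dd v \<phi> z) W = cd v (\<lambda>y. W (pt y)) z"
  using dir_deriv_chart[OF chart pt(1)[OF z] U W, of v] pt(1,2)[OF z]
  unfolding cov_deriv_def cd_def by (simp add: \<phi>_def pt_def comp_def)

text \<open>The coordinate field with constant components is an admissible extension. Any other
  extension changes the covariant derivative only by a tangent vector, so the value described by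
  \<open>THE\<close> exists and is unique.\<close>

lemma sff_eq:
  assumes z: "z \<in> \<Omega>"
  shows "sff f c M (pt z) (dd v \<phi> z) (dd w \<phi> z) = normal_part f c M (pt z) (cd v (\<lambda>y. dd w \<phi> y) z)"
  unfolding sff_def
proof (rule the_equality)
  let ?W = "\<lambda>q. (\<lambda>y. dd w \<phi> y) (\<kappa> q)"
  have op: "open_part M C" by (rule open_part_chart[OF chart])
  have sm: "smooth_map M C ?W"
    by (rule smooth_map_chartI[OF op order_refl]) (use smooth_on_dd[OF smooth_\<phi>] in \<open>simp add: \<Omega>_def\<close>)
  have "?W q \<in> tangent_space M q" if "q \<in> C" for q
    using tangent_space_pt[OF pt(4)[OF that]] pt(3)[OF that] d\<phi>_TM by simp
  then have tf: "tangent_field M C ?W" using sm by (simp add: tangent_field_def)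
  have "cov_deriv f c M (pt z) (dd v \<phi> z) ?W = cd v (\<lambda>y. ?W (pt y)) z"
    by (rule cov_deriv_chart[OF z op pt(1)[OF z] sm])
  also have "\<dots> = cd v (\<lambda>y. dd w \<phi> y) z"
    unfolding cd_def using dd_cong_open[OF \<Omega> z, of "\<lambda>y. ?W (pt y)" "\<lambda>y. dd w \<phi> y"] pt(2) z by simp
  finally show "\<exists>U W. open_part M U \<and> pt z \<in> U \<and> tangent_field M U W \<and> W (pt z) = dd w \<phi> z \<and>
      normal_part f c M (pt z) (cd v (\<lambda>y. dd w \<phi> y) z) = normal_part f c M (pt z) (cov_deriv f c M (pt z) (dd v \<phi> z) W)"
    using op pt(1,2)[OF z] tf by (intro exI[of _ C] exI[of _ ?W]) simp
next
  fix n assume "\<exists>U W. open_part M U \<and> pt z \<in> U \<and> tangent_field M U W \<and> W (pt z) = dd w \<phi> z \<and>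
      n = normal_part f c M (pt z) (cov_deriv f c M (pt z) (dd v \<phi> z) W)"
  then obtain U W where U: "open_part M U" "pt z \<in> U" and W: "tangent_field M U W" "W (pt z) = dd w \<phi> z"
    and n: "n = normal_part f c M (pt z) (cov_deriv f c M (pt z) (dd v \<phi> z) W)" by blast
  have sm: "smooth_map M U W" using W by (simp add: tangent_field_def)
  let ?F = "\<lambda>y. W (pt y)" and ?V = "\<kappa> ` (U \<inter> C)"
  have op: "open ?V" using chart_image_open[OF atlas chart] U by (simp add: open_part_def)
  have V: "z \<in> ?V" "?V \<subseteq> \<Omega>" using U pt(1,2)[OF z] by (auto simp: \<Omega>_def intro!: image_eqI[of z \<kappa> "pt z"])
  have "smooth_on ?V ?F" using smooth_map_in_chart[OF sm chart] by (simp add: pt_def comp_def)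
  then have dF: "?F differentiable (at z)" using V by (rule_tac smooth_on_differentiable)
  have FT: "?F y \<in> TM y" if "y \<in> ?V" for y
  proof -
    from that obtain q where q: "q \<in> U" "q \<in> C" "y = \<kappa> q" by blast
    have "W q \<in> tangent_space M q" using W(1) q(1) by (simp add: tangent_field_def)
    then show ?thesis using tangent_space_pt[OF pt(4)[OF q(2)]] pt(3)[OF q(2)] q(3) by simp
  qed
  have "cd v ?F z - (w $ 1 *\<^sub>R cd v (\<lambda>y. dd b1 \<phi> y) z + w $ 2 *\<^sub>R cd v (\<lambda>y. dd b2 \<phi> y) z) \<in> TM z"
    by (rule cd_tangent_field[OF op V dF FT W(2)])
  then have "cd v ?F z - cd v (\<lambda>y. dd w \<phi> y) z \<in> TM z" using cd_d\<phi>_eq[OF z, of v w] by simp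
  moreover have "cd v ?F z \<in> rw_tangent c (\<phi> z)"
    by (rule cd_rw_tangent[OF op V dF]) (use FT V(2) TM_rw_tangent in blast)
  ultimately have "normal_part f c M (pt z) (cd v ?F z) = normal_part f c M (pt z) (cd v (\<lambda>y. dd w \<phi> y) z)"
    using normal_part_cong[OF z _ cd_d\<phi>_rw_tangent[OF z]] by blast
  then show "n = normal_part f c M (pt z) (cd v (\<lambda>y. dd w \<phi> y) z)"
    using cov_deriv_chart[OF z U sm] n by simp
qed

end

section \<open>Curvature along a null direction of the second fundamental form\<close>

lemma has_derivative_sf_metric:
  assumes "(X has_derivative X') (at z)" "(Y has_derivative Y') (at z)"
  shows "((\<lambda>y. sf_metric c (X y) (Y y)) has_derivative (\<lambda>v. sf_metric c (X' v) (Y z) + sf_metric c (X z) (Y' v))) (at z)"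
  unfolding sf_metric_def
  by (rule has_derivative_eq_rhs, (rule derivative_intros assms)+) (auto simp: fun_eq_iff algebra_simps)

text \<open>Needed for second covariant derivatives. With respect to time, the connection
  coefficients \<open>f * f'\<close> and \<open>f' / f\<close> have the derivatives
  \<open>(l + k^2) * F\<close> and \<open>l - k^2\<close>.\<close>

lemma has_derivative_rw_conn:
  fixes \<phi> P N D :: "'a::real_normed_vector \<Rightarrow> vec5" and c :: real
  assumes \<phi>: "(\<phi> has_derivative \<phi>') (at z)" and P: "(P has_derivative P') (at z)"
    and N: "(N has_derivative N') (at z)" and D: "(D has_derivative D') (at z)"
    and f: "(f has_real_derivative f1) (at (fst (\<phi> z)))" "(deriv f has_real_derivative f2) (at (fst (\<phi> z)))"
      "f (fst (\<phi> z)) \<noteq> 0"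
  defines "k \<equiv> f1 / f (fst (\<phi> z))" and "l \<equiv> f2 / f (fst (\<phi> z))" and "F \<equiv> (f (fst (\<phi> z)))\<^sup>2"
    and "G \<equiv> sf_metric c (snd (P z)) (snd (N z))"
  defines "G' \<equiv> \<lambda>v. sf_metric c (snd (P' v)) (snd (N z)) + sf_metric c (snd (P z)) (snd (N' v))"
  shows "((\<lambda>y. rw_conn f c (\<phi> y) (P y) (N y) (D y)) has_derivative (\<lambda>v.
     (fst (D' v) + (l + k\<^sup>2) * F * fst (\<phi>' v) * G + k * F * G' v,
      snd (D' v) + (c * G' v) *\<^sub>R snd (\<phi> z) + (c * G) *\<^sub>R snd (\<phi>' v)
      + ((l - k\<^sup>2) * fst (\<phi>' v)) *\<^sub>R (fst (P z) *\<^sub>R snd (N z) + fst (N z) *\<^sub>R snd (P z))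
      + k *\<^sub>R (fst (P' v) *\<^sub>R snd (N z) + fst (P z) *\<^sub>R snd (N' v) + fst (N' v) *\<^sub>R snd (P z) + fst (N z) *\<^sub>R snd (P' v)))))
     (at z)"
proof -
  let ?t = "fst (\<phi> z)"
  have f1: "deriv f ?t = f1" using f(1) by (rule DERIV_imp_deriv)
  have dt: "((\<lambda>y. fst (\<phi> y)) has_derivative (\<lambda>v. fst (\<phi>' v))) (at z)" by (rule has_derivative_fst[OF \<phi>])
  have df: "((\<lambda>y. f (fst (\<phi> y))) has_derivative (\<lambda>v. f1 * fst (\<phi>' v))) (at z)"
    by (rule has_derivative_compose[OF dt]) (use f(1) in \<open>simp add: has_field_derivative_def\<close>)
  have df': "((\<lambda>y. deriv f (fst (\<phi> y))) has_derivative (\<lambda>v. f2 * fst (\<phi>' v))) (at z)"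
    by (rule has_derivative_compose[OF dt]) (use f(2) in \<open>simp add: has_field_derivative_def\<close>)
  have dm: "((\<lambda>y. f (fst (\<phi> y)) * deriv f (fst (\<phi> y))) has_derivative (\<lambda>v. (l + k\<^sup>2) * F * fst (\<phi>' v))) (at z)"
    by (rule has_derivative_eq_rhs[OF has_derivative_mult[OF df df']])
      (use f(3) in \<open>simp add: fun_eq_iff f1 k_def l_def F_def field_simps power2_eq_square\<close>)
  have dk: "((\<lambda>y. deriv f (fst (\<phi> y)) / f (fst (\<phi> y))) has_derivative (\<lambda>v. (l - k\<^sup>2) * fst (\<phi>' v))) (at z)"
    by (rule has_derivative_eq_rhs[OF has_derivative_divide[OF df' df f(3)]])
      (use f(3) in \<open>simp add: fun_eq_iff f1 k_def l_def field_simps power2_eq_square\<close>)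
  have dG: "((\<lambda>y. sf_metric c (snd (P y)) (snd (N y))) has_derivative G') (at z)"
    unfolding G'_def by (intro has_derivative_sf_metric has_derivative_snd P N)
  have kF: "f ?t * deriv f ?t = k * F" "deriv f ?t / f ?t = k"
    using f(3) by (simp_all add: f1 k_def F_def power2_eq_square)
  have 1: "((\<lambda>y. fst (D y) + f (fst (\<phi> y)) * deriv f (fst (\<phi> y)) * sf_metric c (snd (P y)) (snd (N y))) has_derivative
      (\<lambda>v. fst (D' v) + (l + k\<^sup>2) * F * fst (\<phi>' v) * G + k * F * G' v)) (at z)"
    by (rule has_derivative_eq_rhs[OF has_derivative_add[OF has_derivative_fst[OF D] has_derivative_mult[OF dm dG]]])
      (auto simp: fun_eq_iff kF G_def algebra_simps)
  have 2: "((\<lambda>y. snd (D y) + (c * sf_metric c (snd (P y)) (snd (N y))) *\<^sub>R snd (\<phi> y)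
        + (deriv f (fst (\<phi> y)) / f (fst (\<phi> y))) *\<^sub>R (fst (P y) *\<^sub>R snd (N y) + fst (N y) *\<^sub>R snd (P y))) has_derivative
      (\<lambda>v. snd (D' v) + (c * G' v) *\<^sub>R snd (\<phi> z) + (c * G) *\<^sub>R snd (\<phi>' v)
      + ((l - k\<^sup>2) * fst (\<phi>' v)) *\<^sub>R (fst (P z) *\<^sub>R snd (N z) + fst (N z) *\<^sub>R snd (P z))
      + k *\<^sub>R (fst (P' v) *\<^sub>R snd (N z) + fst (P z) *\<^sub>R snd (N' v) + fst (N' v) *\<^sub>R snd (P z) + fst (N z) *\<^sub>R snd (P' v)))) (at z)"
    by (rule has_derivative_eq_rhs[OF has_derivative_add[OF has_derivative_add[OF has_derivative_snd[OF D]
          has_derivative_scaleR[OF has_derivative_mult_right[OF dG, of c] has_derivative_snd[OF \<phi>]]]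
          has_derivative_scaleR[OF dk has_derivative_add[OF
            has_derivative_scaleR[OF has_derivative_fst[OF P] has_derivative_snd[OF N]]
            has_derivative_scaleR[OF has_derivative_fst[OF N] has_derivative_snd[OF P]]]]]])
      (simp add: fun_eq_iff kF G_def algebra_simps)
  show ?thesis
    using has_derivative_Pair[OF 1 2] by (simp add: rw_conn_def Let_def)
qed

text \<open>With \<open>k = f' / f\<close>, \<open>l = f'' / f\<close> and \<open>F = f\<^sup>2\<close> every coefficient of the connection and of its derivatives is a polynomial
  in \<open>k\<close>, \<open>l\<close>, \<open>F\<close> and \<open>c\<close>, so that the two components of the curvature become ring identities.\<close>

lemma curvature_algebra_fst:
  fixes x x1 x2 x12 v v1 v2 :: vec4 and a1 a2 b n12 k l F c :: real
  assumes orth: "c * sf_metric c x1 x = 0" "c * sf_metric c x2 x = 0"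
  defines "V1 \<equiv> v1 + (c * sf_metric c x1 v) *\<^sub>R x + k *\<^sub>R (a1 *\<^sub>R v + b *\<^sub>R x1)"
    and "V2 \<equiv> v2 + (c * sf_metric c x2 v) *\<^sub>R x + k *\<^sub>R (a2 *\<^sub>R v + b *\<^sub>R x2)"
  shows "(n12 + (l + k\<^sup>2) * F * a1 * sf_metric c x2 v + k * F * (sf_metric c x12 v + sf_metric c x2 v1) + k * F * sf_metric c x1 V2)
    - (n12 + (l + k\<^sup>2) * F * a2 * sf_metric c x1 v + k * F * (sf_metric c x12 v + sf_metric c x1 v2) + k * F * sf_metric c x2 V1)
    = l * F * (a1 * sf_metric c x2 v - a2 * sf_metric c x1 v)"
proof (cases "c = 0")
  case True
  then show ?thesis
    by (simp add: V1_def V2_def sf_metric_simps algebra_simps power2_eq_square sf_metric_commute[of _ x2 x1])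
next
  case False
  then have "sf_metric c x1 x = 0" "sf_metric c x2 x = 0" using orth by auto
  then show ?thesis
    by (simp add: V1_def V2_def sf_metric_simps algebra_simps power2_eq_square sf_metric_commute[of _ x2 x1])
qed

text \<open>Mixed derivatives and multiples of the position \<open>x\<close> cancel. What remains is
  the warped product curvature: \<open>c + k^2 * F\<close> is \<open>c + f'^2\<close>, the spatial
  sectional curvature with its denominator absorbed by \<open>sf_metric\<close>, and
  \<open>l\<close> is \<open>f''/f\<close>.\<close>

lemma curvature_algebra_snd:
  fixes x x1 x2 x12 v v1 v2 v12 :: vec4 and a1 a2 a12 b n1 n2 k l F c :: real
  assumes orth: "c * sf_metric c x1 x = 0" "c * sf_metric c x2 x = 0"
  defines "V1 \<equiv> v1 + (c * sf_metric c x1 v) *\<^sub>R x + k *\<^sub>R (a1 *\<^sub>R v + b *\<^sub>R x1)"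
    and "V2 \<equiv> v2 + (c * sf_metric c x2 v) *\<^sub>R x + k *\<^sub>R (a2 *\<^sub>R v + b *\<^sub>R x2)"
    and "B1 \<equiv> n1 + k * F * sf_metric c x1 v" and "B2 \<equiv> n2 + k * F * sf_metric c x2 v"
  shows "(v12 + (c * (sf_metric c x12 v + sf_metric c x2 v1)) *\<^sub>R x + (c * sf_metric c x2 v) *\<^sub>R x1
      + ((l - k\<^sup>2) * a1) *\<^sub>R (a2 *\<^sub>R v + b *\<^sub>R x2)
      + k *\<^sub>R (a12 *\<^sub>R v + a2 *\<^sub>R v1 + n1 *\<^sub>R x2 + b *\<^sub>R x12)
      + (c * sf_metric c x1 V2) *\<^sub>R x + k *\<^sub>R (a1 *\<^sub>R V2 + B2 *\<^sub>R x1))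
    - (v12 + (c * (sf_metric c x12 v + sf_metric c x1 v2)) *\<^sub>R x + (c * sf_metric c x1 v) *\<^sub>R x2
      + ((l - k\<^sup>2) * a2) *\<^sub>R (a1 *\<^sub>R v + b *\<^sub>R x1)
      + k *\<^sub>R (a12 *\<^sub>R v + a1 *\<^sub>R v2 + n2 *\<^sub>R x1 + b *\<^sub>R x12)
      + (c * sf_metric c x2 V1) *\<^sub>R x + k *\<^sub>R (a2 *\<^sub>R V1 + B1 *\<^sub>R x2))
    = (c + k\<^sup>2 * F) *\<^sub>R (sf_metric c x2 v *\<^sub>R x1 - sf_metric c x1 v *\<^sub>R x2) + (l * b) *\<^sub>R (a1 *\<^sub>R x2 - a2 *\<^sub>R x1)"
proof -
  have 1: "c * sf_metric c x1 V2 = c * (sf_metric c x1 v2 + k * (a2 * sf_metric c x1 v + b * sf_metric c x1 x2))"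
    "c * sf_metric c x2 V1 = c * (sf_metric c x2 v1 + k * (a1 * sf_metric c x2 v + b * sf_metric c x1 x2))"
    using orth by (cases "c = 0"; simp add: V1_def V2_def sf_metric_simps sf_metric_commute[of _ x2 x1])+
  show ?thesis
    unfolding 1 unfolding V1_def V2_def B1_def B2_def
    by (simp add: algebra_simps power2_eq_square)
qed

text \<open>A symmetric form on a plane with a nonzero kernel vector has rank at most one. Working
  modulo \<open>S\<close> avoids choosing normal vectors.\<close>

lemma null_symmetric_form:
  fixes h11 h12 h22 :: "'a::real_vector"
  assumes S: "subspace S" and w: "w1 \<noteq> 0 \<or> w2 \<noteq> (0::real)"
    and n: "w1 *\<^sub>R h11 + w2 *\<^sub>R h12 \<in> S" "w1 *\<^sub>R h12 + w2 *\<^sub>R h22 \<in> S"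
  shows "\<exists>\<xi> r11 r12 r22. h11 - r11 *\<^sub>R \<xi> \<in> S \<and> h12 - r12 *\<^sub>R \<xi> \<in> S \<and> h22 - r22 *\<^sub>R \<xi> \<in> S"
proof -
  \<comment> \<open>If the first kernel component is nonzero, both null relations can be solved in
    terms of \<open>h22\<close>, which then serves as \<xi>; the other case follows by exchanging
    the indices.\<close>
  have key: "\<exists>r11 r12. h11 - r11 *\<^sub>R h22 \<in> S \<and> h12 - r12 *\<^sub>R h22 \<in> S"
    if w1: "w1 \<noteq> 0" and n: "w1 *\<^sub>R h11 + w2 *\<^sub>R h12 \<in> S" "w1 *\<^sub>R h12 + w2 *\<^sub>R h22 \<in> S" for w1 w2 and h11 h12 h22 :: 'a
  proof -
    have e12: "h12 - (- w2 / w1) *\<^sub>R h22 \<in> S"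
      using subspace_scale[OF S n(2), of "1 / w1"] w1 by (simp add: scaleR_add_right)
    have "(1 / w1) *\<^sub>R (w1 *\<^sub>R h11 + w2 *\<^sub>R h12) - (w2 / w1) *\<^sub>R (h12 - (- w2 / w1) *\<^sub>R h22) \<in> S"
      by (intro subspace_diff[OF S] subspace_scale[OF S] n(1) e12)
    then have "h11 - (w2 / w1 * (w2 / w1)) *\<^sub>R h22 \<in> S"
      using w1 by (simp add: scaleR_add_right)
    with e12 show ?thesis by blast
  qed
  show ?thesis
  proof (cases "w1 = 0")
    case False
    from key[OF this n] show ?thesis using subspace_0[OF S] by (metis diff_self scaleR_one)
  next
    case True
    have n': "w2 *\<^sub>R h22 + w1 *\<^sub>R h12 \<in> S" "w2 *\<^sub>R h12 + w1 *\<^sub>R h11 \<in> S" using n by (simp_all add: add.commute)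
    have "w2 \<noteq> 0" using True w by simp
    from key[OF this n'] show ?thesis using subspace_0[OF S] by (metis diff_self scaleR_one)
  qed
qed

section \<open>The Codazzi equation for a null field\<close>

context rw_surface_chart
begin

lemma cd_direction:
  assumes z: "z \<in> \<Omega>" and F: "F differentiable (at z)"
  shows "cd v F z = v $ 1 *\<^sub>R cd b1 F z + v $ 2 *\<^sub>R cd b2 F z"
proof -
  have "dd v F z = v $ 1 *\<^sub>R dd b1 F z + v $ 2 *\<^sub>R dd b2 F z"
    by (rule linear_vec2[OF linear_frechet_derivative[OF F]])
  then have "cd v F z = rw_conn f c (\<phi> z) (v $ 1 *\<^sub>R dd b1 \<phi> z + v $ 2 *\<^sub>R dd b2 \<phi> z) (F z) (v $ 1 *\<^sub>R dd b1 F z + v $ 2 *\<^sub>R dd b2 F z)"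
    by (simp only: cd_def d\<phi>_eq[OF z, of v, symmetric])
  then show ?thesis by (simp only: cd_def rw_conn_linear_left)
qed

text \<open>Symmetry moves the null vector into the slot of the differentiated field, so nullity of
  \<open>w\<close> says that all covariant derivatives of one fixed field are tangent.\<close>

lemma relative_null_iff:
  assumes z: "z \<in> \<Omega>"
  shows "dd w \<phi> z \<in> relative_null_space f c M (pt z) \<longleftrightarrow> (\<forall>v. cd v (\<lambda>y. dd w \<phi> y) z \<in> TM z)"
proof -
  have "sff f c M (pt z) (dd w \<phi> z) (dd v \<phi> z) = 0 \<longleftrightarrow> cd v (\<lambda>y. dd w \<phi> y) z \<in> TM z" for v
    using normal_part_linear(3)[OF z cd_d\<phi>_rw_tangent[OF z] cd_d\<phi>_rw_tangent[OF z]]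
    by (simp add: sff_eq[OF z] cd_d\<phi>_commute[OF z, of w v])
  then show ?thesis
    unfolding relative_null_space_def tangent_space_pt[OF z] TM_def by auto
qed

text \<open>The covariant derivative of \<partial>/\<partial>t along \<open>X\<close> is
  \<open>f'/f\<close> times the spatial part of \<open>X\<close>, which is tangent as soon as
  \<open>X\<close> and \<partial>/\<partial>t are. Tangency on an open set is needed for
  \<partial>/\<partial>t to be an extension of its own value.\<close>

lemma d_dt_relative_null:
  assumes U: "open U" "z \<in> U" "U \<subseteq> \<Omega>" and d: "\<And>y. y \<in> U \<Longrightarrow> d_dt \<in> TM y"
  shows "d_dt \<in> relative_null_space f c M (pt z)"
proof -
  have z: "z \<in> \<Omega>" using U by auto
  obtain w where w: "d_dt = dd w \<phi> z" using d[OF U(2)] by (auto simp: TM_def)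
  have "cd v (\<lambda>y. dd w \<phi> y) z \<in> TM z" for v
  proof -
    have "cd v (\<lambda>y. d_dt) z = (deriv f (fst (\<phi> z)) / f (fst (\<phi> z))) *\<^sub>R (dd v \<phi> z - fst (dd v \<phi> z) *\<^sub>R d_dt)"
      by (rule prod_eqI) (simp_all add: cd_def rw_conn_def d_dt_def Let_def sf_metric_simps)
    also have "\<dots> \<in> TM z"
      by (intro subspace_scale[OF subspace_TM[OF z]] subspace_diff[OF subspace_TM[OF z]] d\<phi>_TM d U)
    finally have 1: "cd v (\<lambda>y. d_dt) z \<in> TM z" .
    have "cd v (\<lambda>y. d_dt) z - cd v (\<lambda>y. dd w \<phi> y) z \<in> TM z"
      using cd_tangent_field[OF U _ d w, of v] cd_d\<phi>_eq[OF z, of v w] by simp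
    from subspace_diff[OF subspace_TM[OF z] 1 this] show ?thesis by simp
  qed
  then show ?thesis unfolding w relative_null_iff[OF z] by blast
qed

lemma f_derivatives:
  assumes z: "z \<in> \<Omega>"
  shows "(f has_real_derivative deriv f (fst (\<phi> z))) (at (fst (\<phi> z)))"
    "(deriv f has_real_derivative deriv (deriv f) (fst (\<phi> z))) (at (fst (\<phi> z)))" "f (fst (\<phi> z)) \<noteq> 0"
  using f fst_\<phi>[OF z] smooth_on_differentiable[OF f(1)] smooth_on_differentiable[OF smooth_on_deriv[OF I f(1)]]
  by (auto simp: DERIV_deriv_iff_real_differentiable)

text \<open>Position is normal to \<open_sphere>-like models only through the factor
  \<open>c\<close>: for \<open>c = 0\<close> the statement is trivial, while
  \<open>c * c = 1\<close> otherwise turns it into the tangency equation.\<close>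

lemma sf_metric_position:
  assumes z: "z \<in> \<Omega>" shows "c * sf_metric c (snd (dd v \<phi> z)) (snd (\<phi> z)) = 0"
proof -
  have "snd (dd v \<phi> z) \<in> sf_tangent c (snd (\<phi> z))"
    using d\<phi>_rw_tangent[OF z] by (auto simp: rw_tangent_def mem_Times_iff)
  then show ?thesis using c by (auto simp: sf_tangent_def sf_metric_def inner_commute mult.commute)
qed

text \<open>The curvature of the ambient space applied to \<open>N\<close>, modulo tangent vectors.
  The first factor is \<open>f^2\<close> times the quantity in assumption (i); the second vanishes
  exactly when \<open>N\<close> is orthogonal to the kernel of dt on the tangent plane.\<close>

lemma curvature:
  assumes U: "open U" "z \<in> U" "U \<subseteq> \<Omega>" and N: "smooth_on U N"
  defines "t \<equiv> fst (\<phi> z)" and "G1 \<equiv> sf_metric c (snd (dd b1 \<phi> z)) (snd (N z))"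
    and "G2 \<equiv> sf_metric c (snd (dd b2 \<phi> z)) (snd (N z))"
  shows "\<exists>X\<in>TM z. cd b1 (\<lambda>y. cd b2 N y) z - cd b2 (\<lambda>y. cd b1 N y) z =
    X + ((f t * deriv (deriv f) t - (deriv f t)\<^sup>2 - c) * (fst (dd b1 \<phi> z) * G2 - fst (dd b2 \<phi> z) * G1)) *\<^sub>R d_dt"
proof -
  have z: "z \<in> \<Omega>" using U by auto
  note fd = f_derivatives[OF z]
  define k l F where "k = deriv f t / f t" and "l = deriv (deriv f) t / f t" and "F = (f t)\<^sup>2"
  have m: "f t * deriv f t = k * F" "deriv f t / f t = k"
    using fd(3) by (simp_all add: k_def F_def power2_eq_square t_def)
  define x x1 x2 x12 where "x = snd (\<phi> z)" and "x1 = snd (dd b1 \<phi> z)" and "x2 = snd (dd b2 \<phi> z)"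
    and "x12 = snd (dd b1 (\<lambda>y. dd b2 \<phi> y) z)"
  define a1 a2 a12 where "a1 = fst (dd b1 \<phi> z)" and "a2 = fst (dd b2 \<phi> z)" and "a12 = fst (dd b1 (\<lambda>y. dd b2 \<phi> y) z)"
  define v v1 v2 v12 where "v = snd (N z)" and "v1 = snd (dd b1 N z)" and "v2 = snd (dd b2 N z)" and "v12 = snd (dd b1 (\<lambda>y. dd b2 N y) z)"
  define b n1 n2 n12 where "b = fst (N z)" and "n1 = fst (dd b1 N z)" and "n2 = fst (dd b2 N z)" and "n12 = fst (dd b1 (\<lambda>y. dd b2 N y) z)"
  have G: "G1 = sf_metric c x1 v" "G2 = sf_metric c x2 v" by (simp_all add: G1_def G2_def x1_def x2_def v_def)
  have d\<phi>: "((\<lambda>y. dd w \<phi> y) has_derivative (\<lambda>v. dd v (\<lambda>y. dd w \<phi> y) z)) (at z)" for w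
    by (rule smooth_on_has_derivative[OF smooth_on_dd[OF smooth_\<phi>] z])
  have dN: "((\<lambda>y. dd w N y) has_derivative (\<lambda>v. dd v (\<lambda>y. dd w N y) z)) (at z)" for w
    by (rule smooth_on_has_derivative[OF smooth_on_dd[OF N] U(2)])
  have xc: "dd b2 (\<lambda>y. dd b1 \<phi> y) z = dd b1 (\<lambda>y. dd b2 \<phi> y) z" by (rule dd_commute[OF \<Omega> z smooth_\<phi>])
  have Nc: "dd b2 (\<lambda>y. dd b1 N y) z = dd b1 (\<lambda>y. dd b2 N y) z" by (rule dd_commute[OF U(1,2) N])
  note der = dd_eqI[OF has_derivative_rw_conn[OF smooth_on_has_derivative[OF smooth_\<phi> z] d\<phi>
      smooth_on_has_derivative[OF N U(2)] dN fd], folded t_def, folded k_def l_def F_def]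
  define V1 V2 B1 B2 where "V1 = v1 + (c * sf_metric c x1 v) *\<^sub>R x + k *\<^sub>R (a1 *\<^sub>R v + b *\<^sub>R x1)"
    and "V2 = v2 + (c * sf_metric c x2 v) *\<^sub>R x + k *\<^sub>R (a2 *\<^sub>R v + b *\<^sub>R x2)"
    and "B1 = n1 + k * F * sf_metric c x1 v" and "B2 = n2 + k * F * sf_metric c x2 v"
  have c1: "cd b1 N z = (B1, V1)" and c2: "cd b2 N z = (B2, V2)"
    by (rule prod_eqI; simp add: cd_def rw_conn_def Let_def t_def[symmetric] m V1_def V2_def B1_def B2_def
        x_def x1_def x2_def v_def v1_def v2_def a1_def a2_def b_def n1_def n2_def)+
  have d12: "dd b1 (\<lambda>y. cd b2 N y) z =
     (n12 + (l + k\<^sup>2) * F * a1 * sf_metric c x2 v + k * F * (sf_metric c x12 v + sf_metric c x2 v1),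
      v12 + (c * (sf_metric c x12 v + sf_metric c x2 v1)) *\<^sub>R x + (c * sf_metric c x2 v) *\<^sub>R x1
      + ((l - k\<^sup>2) * a1) *\<^sub>R (a2 *\<^sub>R v + b *\<^sub>R x2)
      + k *\<^sub>R (a12 *\<^sub>R v + a2 *\<^sub>R v1 + n1 *\<^sub>R x2 + b *\<^sub>R x12))"
    unfolding cd_def der
    by (simp add: x_def x1_def x2_def x12_def v_def v1_def v2_def v12_def a1_def a2_def a12_def b_def n1_def n2_def n12_def)
  have d21: "dd b2 (\<lambda>y. cd b1 N y) z =
     (n12 + (l + k\<^sup>2) * F * a2 * sf_metric c x1 v + k * F * (sf_metric c x12 v + sf_metric c x1 v2),
      v12 + (c * (sf_metric c x12 v + sf_metric c x1 v2)) *\<^sub>R x + (c * sf_metric c x1 v) *\<^sub>R x2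
      + ((l - k\<^sup>2) * a2) *\<^sub>R (a1 *\<^sub>R v + b *\<^sub>R x1)
      + k *\<^sub>R (a12 *\<^sub>R v + a1 *\<^sub>R v2 + n2 *\<^sub>R x1 + b *\<^sub>R x12))"
    unfolding cd_def der xc Nc
    by (simp add: x_def x1_def x2_def x12_def v_def v1_def v2_def v12_def a1_def a2_def a12_def b_def n1_def n2_def n12_def)
  have orth: "c * sf_metric c x1 x = 0" "c * sf_metric c x2 x = 0"
    using sf_metric_position[OF z] by (simp_all add: x_def x1_def x2_def)
  \<comment> \<open>\<open>X\<close> has the spatial part of the curvature, each spatial vector
    being completed to the tangent vector it comes from. Its time component differs from that of the
    curvature, and the mismatch is the multiple of \<open>d_dt\<close>.\<close>
  define X where "X = ((c + k\<^sup>2 * F) * sf_metric c x2 v) *\<^sub>R dd b1 \<phi> z - ((c + k\<^sup>2 * F) * sf_metric c x1 v) *\<^sub>R dd b2 \<phi> z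
    + (l * b * a1) *\<^sub>R dd b2 \<phi> z - (l * b * a2) *\<^sub>R dd b1 \<phi> z"
  have "X \<in> TM z" unfolding X_def
    by (intro subspace_add[OF subspace_TM[OF z]] subspace_diff[OF subspace_TM[OF z]] subspace_scale[OF subspace_TM[OF z]] d\<phi>_TM)
  moreover have "cd b1 (\<lambda>y. cd b2 N y) z - cd b2 (\<lambda>y. cd b1 N y) z
     = X + ((l * F - k\<^sup>2 * F - c) * (a1 * G2 - a2 * G1)) *\<^sub>R d_dt"
  proof (rule prod_eqI)
    have "fst (cd b1 (\<lambda>y. cd b2 N y) z - cd b2 (\<lambda>y. cd b1 N y) z) =
      (n12 + (l + k\<^sup>2) * F * a1 * sf_metric c x2 v + k * F * (sf_metric c x12 v + sf_metric c x2 v1) + k * F * sf_metric c x1 V2)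
      - (n12 + (l + k\<^sup>2) * F * a2 * sf_metric c x1 v + k * F * (sf_metric c x12 v + sf_metric c x1 v2) + k * F * sf_metric c x2 V1)"
      unfolding cd_def[of b1 "\<lambda>y. cd b2 N y"] cd_def[of b2 "\<lambda>y. cd b1 N y"] d12 d21 c1 c2
      by (simp add: rw_conn_def Let_def t_def[symmetric] m x1_def x2_def)
    also have "\<dots> = l * F * (a1 * sf_metric c x2 v - a2 * sf_metric c x1 v)"
      unfolding V1_def V2_def by (rule curvature_algebra_fst[OF orth])
    also have "\<dots> = fst (X + ((l * F - k\<^sup>2 * F - c) * (a1 * G2 - a2 * G1)) *\<^sub>R d_dt)"
      by (simp add: X_def d_dt_def G a1_def[symmetric] a2_def[symmetric] algebra_simps)
    finally show "fst (cd b1 (\<lambda>y. cd b2 N y) z - cd b2 (\<lambda>y. cd b1 N y) z) = \<dots>" .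
    have "snd (cd b1 (\<lambda>y. cd b2 N y) z - cd b2 (\<lambda>y. cd b1 N y) z) =
      (v12 + (c * (sf_metric c x12 v + sf_metric c x2 v1)) *\<^sub>R x + (c * sf_metric c x2 v) *\<^sub>R x1
      + ((l - k\<^sup>2) * a1) *\<^sub>R (a2 *\<^sub>R v + b *\<^sub>R x2)
      + k *\<^sub>R (a12 *\<^sub>R v + a2 *\<^sub>R v1 + n1 *\<^sub>R x2 + b *\<^sub>R x12)
      + (c * sf_metric c x1 V2) *\<^sub>R x + k *\<^sub>R (a1 *\<^sub>R V2 + B2 *\<^sub>R x1))
    - (v12 + (c * (sf_metric c x12 v + sf_metric c x1 v2)) *\<^sub>R x + (c * sf_metric c x1 v) *\<^sub>R x2
      + ((l - k\<^sup>2) * a2) *\<^sub>R (a1 *\<^sub>R v + b *\<^sub>R x1)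
      + k *\<^sub>R (a12 *\<^sub>R v + a1 *\<^sub>R v2 + n2 *\<^sub>R x1 + b *\<^sub>R x12)
      + (c * sf_metric c x2 V1) *\<^sub>R x + k *\<^sub>R (a2 *\<^sub>R V1 + B1 *\<^sub>R x2))"
      unfolding cd_def[of b1 "\<lambda>y. cd b2 N y"] cd_def[of b2 "\<lambda>y. cd b1 N y"] d12 d21 c1 c2
      by (simp add: rw_conn_def Let_def t_def[symmetric] m x1_def x2_def a1_def a2_def x_def)
    also have "\<dots> = (c + k\<^sup>2 * F) *\<^sub>R (sf_metric c x2 v *\<^sub>R x1 - sf_metric c x1 v *\<^sub>R x2) + (l * b) *\<^sub>R (a1 *\<^sub>R x2 - a2 *\<^sub>R x1)"
      unfolding V1_def V2_def B1_def B2_def by (rule curvature_algebra_snd[OF orth])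
    also have "\<dots> = snd (X + ((l * F - k\<^sup>2 * F - c) * (a1 * G2 - a2 * G1)) *\<^sub>R d_dt)"
      by (simp add: X_def d_dt_def x1_def[symmetric] x2_def[symmetric] algebra_simps)
    finally show "snd (cd b1 (\<lambda>y. cd b2 N y) z - cd b2 (\<lambda>y. cd b1 N y) z) = \<dots>" .
  qed
  moreover have "l * F - k\<^sup>2 * F - c = f t * deriv (deriv f) t - (deriv f t)\<^sup>2 - c"
    using fd(3) by (simp add: l_def k_def F_def t_def power2_eq_square)
  ultimately show ?thesis unfolding a1_def a2_def by auto
qed

text \<open>\<open>N\<close> annihilates the second fundamental form, whose values therefore lie on one normal line spanned by \<open>\<xi>\<close>;
  the Codazzi equation for \<open>N\<close> identifies that line with the one spanned by the normal part of \<open>d_dt\<close>.\<close>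

lemma second_fundamental_form_along_d_dt:
  assumes U: "open U" "z \<in> U" "U \<subseteq> \<Omega>" and N: "smooth_on U N" "\<And>y. y \<in> U \<Longrightarrow> N y \<in> relative_null_space f c M (pt y)" "N z \<noteq> 0"
    and notT: "fst (dd b1 \<phi> z) * sf_metric c (snd (dd b2 \<phi> z)) (snd (N z)) - fst (dd b2 \<phi> z) * sf_metric c (snd (dd b1 \<phi> z)) (snd (N z)) \<noteq> 0"
    and i: "f (fst (\<phi> z)) * deriv (deriv f) (fst (\<phi> z)) - (deriv f (fst (\<phi> z)))\<^sup>2 - c \<noteq> 0"
    and d: "d_dt \<notin> TM z"
  shows "\<exists>r. cd v (\<lambda>y. dd u \<phi> y) z - r *\<^sub>R d_dt \<in> TM z"
proof -
  have z: "z \<in> \<Omega>" using U by auto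
  note S = subspace_TM[OF z]
  note Sadd = subspace_add[OF S] and Sdiff = subspace_diff[OF S] and Sscale = subspace_scale[OF S]
  have NT: "N y \<in> TM y" if "y \<in> U" for y
    using N(2)[OF that] tangent_space_pt[of y] that U(3) by (auto simp: relative_null_space_def)
  have Ndiff: "N differentiable (at y)" if "y \<in> U" for y
    using smooth_on_differentiable[OF N(1) that] .
  \<comment> \<open>Required on all of \<open>U\<close> rather than at \<open>z\<close>: it makes
    \<open>cd u N\<close> a tangent field, which can then be differentiated once more.\<close>
  have cdN: "cd v N y \<in> TM y" if y: "y \<in> U" for v y
  proof -
    have y': "y \<in> \<Omega>" using y U by auto
    obtain w where w: "N y = dd w \<phi> y" using NT[OF y] by (auto simp: TM_def)
    have "cd v N y - cd v (\<lambda>y. dd w \<phi> y) y \<in> TM y"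
      using cd_tangent_field[OF U(1) y U(3) Ndiff[OF y] NT w, of v] cd_d\<phi>_eq[OF y', of v w] by simp
    moreover have "cd v (\<lambda>y. dd w \<phi> y) y \<in> TM y"
      using N(2)[OF y] relative_null_iff[OF y'] w by simp
    ultimately show ?thesis using subspace_add[OF subspace_TM[OF y']] by (metis diff_add_cancel)
  qed
  obtain w where w: "N z = dd w \<phi> z" using NT[OF U(2)] by (auto simp: TM_def)
  define h where "h v w = cd v (\<lambda>y. dd w \<phi> y) z" for v w
  have w0: "w $ 1 \<noteq> 0 \<or> w $ 2 \<noteq> 0" using N(3) w d\<phi>_eq[OF z, of w] by auto
  have hw: "w $ 1 *\<^sub>R h v b1 + w $ 2 *\<^sub>R h v b2 \<in> TM z" for v
  proof -
    have "cd v (\<lambda>y. dd w \<phi> y) z \<in> TM z" using N(2)[OF U(2)] relative_null_iff[OF z, of w] w by simp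
    then show ?thesis unfolding h_def cd_d\<phi>_eq[OF z, of v w] .
  qed
  have h21: "h b2 b1 = h b1 b2" unfolding h_def by (rule cd_d\<phi>_commute[OF z])
  obtain \<xi> r11 r12 r22 where \<xi>: "h b1 b1 - r11 *\<^sub>R \<xi> \<in> TM z" "h b1 b2 - r12 *\<^sub>R \<xi> \<in> TM z" "h b2 b2 - r22 *\<^sub>R \<xi> \<in> TM z"
    using null_symmetric_form[OF S w0 hw[of b1] hw[of b2, unfolded h21]] by blast
  have comb: "\<exists>r. h v w - r *\<^sub>R \<xi> \<in> TM z" for v w
  proof -
    have hv: "h v w = v $ 1 *\<^sub>R (w $ 1 *\<^sub>R h b1 b1 + w $ 2 *\<^sub>R h b1 b2) + v $ 2 *\<^sub>R (w $ 1 *\<^sub>R h b1 b2 + w $ 2 *\<^sub>R h b2 b2)"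
      unfolding h21[symmetric] unfolding h_def
      using cd_direction[OF z smooth_on_differentiable[OF smooth_on_dd[OF smooth_\<phi>] z], of v w]
        cd_d\<phi>_eq[OF z, of b1 w] cd_d\<phi>_eq[OF z, of b2 w] by (simp only: cd_d\<phi>_commute[OF z, of b2 b1])
    have "v $ 1 *\<^sub>R (w $ 1 *\<^sub>R (h b1 b1 - r11 *\<^sub>R \<xi>) + w $ 2 *\<^sub>R (h b1 b2 - r12 *\<^sub>R \<xi>))
      + v $ 2 *\<^sub>R (w $ 1 *\<^sub>R (h b1 b2 - r12 *\<^sub>R \<xi>) + w $ 2 *\<^sub>R (h b2 b2 - r22 *\<^sub>R \<xi>)) \<in> TM z"
      by (intro Sadd Sscale \<xi>)
    then show ?thesis
      by (intro exI[of _ "v $ 1 * (w $ 1 * r11 + w $ 2 * r12) + v $ 2 * (w $ 1 * r12 + w $ 2 * r22)"])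
        (simp add: hv algebra_simps)
  qed
  \<comment> \<open>Since \<open>cd u N\<close> is tangent with value \<open>q\<close>, its
    derivative agrees modulo \<open>TM\<close> with \<open>h v q\<close>, which lies on the line of
    \<xi>.\<close>
  have cdcd: "\<exists>r. cd v (\<lambda>y. cd u N y) z - r *\<^sub>R \<xi> \<in> TM z" for u v
  proof -
    have sm: "smooth_on U (\<lambda>y. dd u \<phi> y)" "smooth_on U \<phi>"
      using smooth_\<phi> smooth_on_dd U(3) smooth_on_subset by blast+
    have "(\<lambda>y. cd u N y) differentiable (at z)"
      unfolding cd_def
      using has_derivative_rw_conn[OF smooth_on_has_derivative[OF sm(2) U(2)] smooth_on_has_derivative[OF sm(1) U(2)]
          smooth_on_has_derivative[OF N(1) U(2)] smooth_on_has_derivative[OF smooth_on_dd[OF N(1)] U(2)] f_derivatives[OF z]]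
      by (rule differentiableI)
    moreover obtain q where q: "cd u N z = dd q \<phi> z" using cdN[OF U(2)] by (auto simp: TM_def)
    ultimately have 1: "cd v (\<lambda>y. cd u N y) z - h v q \<in> TM z"
      using cd_tangent_field[OF U, of "\<lambda>y. cd u N y" q v] cdN cd_d\<phi>_eq[OF z, of v q] by (simp add: h_def)
    obtain r where "h v q - r *\<^sub>R \<xi> \<in> TM z" using comb by blast
    from Sadd[OF 1 this] show ?thesis by auto
  qed
  define K where "K = (f (fst (\<phi> z)) * deriv (deriv f) (fst (\<phi> z)) - (deriv f (fst (\<phi> z)))\<^sup>2 - c) *
    (fst (dd b1 \<phi> z) * sf_metric c (snd (dd b2 \<phi> z)) (snd (N z)) - fst (dd b2 \<phi> z) * sf_metric c (snd (dd b1 \<phi> z)) (snd (N z)))"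
  have K: "K \<noteq> 0" using notT i by (simp add: K_def)
  obtain X where X: "X \<in> TM z" and Keq: "cd b1 (\<lambda>y. cd b2 N y) z - cd b2 (\<lambda>y. cd b1 N y) z = X + K *\<^sub>R d_dt"
    using curvature[OF U N(1)] unfolding K_def by blast
  obtain r s where r: "cd b1 (\<lambda>y. cd b2 N y) z - r *\<^sub>R \<xi> \<in> TM z" and s: "cd b2 (\<lambda>y. cd b1 N y) z - s *\<^sub>R \<xi> \<in> TM z"
    using cdcd by metis
  have "(cd b1 (\<lambda>y. cd b2 N y) z - r *\<^sub>R \<xi>) - (cd b2 (\<lambda>y. cd b1 N y) z - s *\<^sub>R \<xi>) - X \<in> TM z"
    by (intro Sdiff r s X)
  moreover have "(cd b1 (\<lambda>y. cd b2 N y) z - r *\<^sub>R \<xi>) - (cd b2 (\<lambda>y. cd b1 N y) z - s *\<^sub>R \<xi>) - X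
      = (cd b1 (\<lambda>y. cd b2 N y) z - cd b2 (\<lambda>y. cd b1 N y) z) - X - (r - s) *\<^sub>R \<xi>"
    by (simp add: algebra_simps)
  ultimately have L: "K *\<^sub>R d_dt - (r - s) *\<^sub>R \<xi> \<in> TM z" by (simp add: Keq)
  \<comment> \<open>Otherwise \<xi> would drop out and leave a nonzero multiple of
    \<open>d_dt\<close> in \<open>TM\<close>. With \<open>r - s\<close> invertible, \<xi> can be
    exchanged for \<open>d_dt\<close>.\<close>
  have rs: "r - s \<noteq> 0"
  proof
    assume "r - s = 0"
    then have "(1 / K) *\<^sub>R K *\<^sub>R d_dt \<in> TM z" using Sscale[OF L, of "1 / K"] by simp
    then show False using d K by simp
  qed
  obtain e where e: "cd v (\<lambda>y. dd u \<phi> y) z - e *\<^sub>R \<xi> \<in> TM z" using comb[of v u] unfolding h_def by blast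
  have "(cd v (\<lambda>y. dd u \<phi> y) z - e *\<^sub>R \<xi>) - (e / (r - s)) *\<^sub>R (K *\<^sub>R d_dt - (r - s) *\<^sub>R \<xi>) \<in> TM z"
    by (intro Sdiff Sscale e L)
  then have "cd v (\<lambda>y. dd u \<phi> y) z - (e / (r - s) * K) *\<^sub>R d_dt \<in> TM z"
    using rs by (simp add: scaleR_diff_right)
  then show ?thesis by blast
qed

end

section \<open>Totally geodesic hypersurfaces from slices of \<open>R\<^sup>3(c)\<close>\<close>

lemma dd_in_subspace:
  fixes F :: "'a::euclidean_space \<Rightarrow> 'b::euclidean_space"
  assumes S: "subspace S" and U: "open U" "z \<in> U" and F: "F differentiable (at z)" "\<And>y. y \<in> U \<Longrightarrow> F y \<in> S"
  shows "dd v F z \<in> S"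
proof -
  have "dd v F z \<bullet> n = 0" if n: "n \<in> S\<^sup>\<bottom>" for n
  proof -
    have "((\<lambda>y. F y \<bullet> n) has_derivative (\<lambda>v. dd v F z \<bullet> n)) (at z)"
      using F(1) unfolding frechet_derivative_works by (rule has_derivative_inner_left)
    from dd_eqI[OF this, of v] have "dd v F z \<bullet> n = dd v (\<lambda>y. F y \<bullet> n) z" by simp
    also have "\<dots> = dd v (\<lambda>y. 0 :: real) z"
      by (rule dd_cong_open[OF U]) (use F(2) n in \<open>auto simp: orthogonal_comp_def orthogonal_def\<close>)
    finally show ?thesis by simp
  qed
  then have "dd v F z \<in> S\<^sup>\<bottom>\<^sup>\<bottom>" by (auto simp: orthogonal_comp_def orthogonal_def inner_commute)
  then show ?thesis using orthogonal_comp_self[OF S] by simp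
qed

text \<open>The form whose unit level contains \<open_model>. For \<open>c = 1\<close> and
  \<open>c = -1\<close> it is \<open>c * sf_metric c\<close>; at \<open>c = 0\<close> it degenerates
  to the product of the last coordinates, which still encodes position and tangency and allows a
  uniform treatment.\<close>

definition sf_form :: "real \<Rightarrow> vec4 \<Rightarrow> vec4 \<Rightarrow> real" where
  "sf_form c u v = c * (fst u \<bullet> fst v) + snd u * snd v"

lemma sf_form_simps:
  "sf_form c (u + u') v = sf_form c u v + sf_form c u' v"
  "sf_form c u (v + v') = sf_form c u v + sf_form c u v'"
  "sf_form c (r *\<^sub>R u) v = r * sf_form c u v"
  "sf_form c u (r *\<^sub>R v) = r * sf_form c u v"
  by (auto simp: sf_form_def algebra_simps inner_add_left inner_add_right)

lemma sf_form_commute: "sf_form c u v = sf_form c v u"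
  by (simp add: sf_form_def inner_commute mult.commute)

lemma sf_form_tangent: "u \<in> sf_tangent c x \<longleftrightarrow> sf_form c x u = 0"
  by (simp add: sf_form_def sf_tangent_def)

lemma sf_form_self: "c \<in> {-1, 0, 1} \<Longrightarrow> x \<in> space_form c \<Longrightarrow> sf_form c x x = 1"
  using space_form_eq[of c x] by (simp add: sf_form_def power2_eq_square)

lemma sf_form_metric:
  assumes c: "c \<in> {-1, 0, 1}" and x: "x \<in> space_form c" and u: "u \<in> sf_tangent c x"
  shows "sf_form c u v = c * sf_metric c u v"
proof (cases "c = 0")
  case True
  then have "snd x = 1" using x by (auto simp: space_form_def)
  then have "snd u = 0" using u True by (simp add: sf_tangent_def)
  then show ?thesis using True by (simp add: sf_form_def)
next
  case False
  then have "c * c = 1" using c by auto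
  then have "c * (c * (snd u * snd v)) = snd u * snd v" by (metis mult.assoc mult_1)
  then show ?thesis by (simp add: sf_form_def sf_metric_def distrib_left)
qed

text \<open>The unit level has a second component for \<open>c = 0\<close> and
  \<open>c = -1\<close>. A positive product with \<open>x0\<close> selects the right one; for
  \<open>c = -1\<close> this is the reversed Cauchy-Schwarz inequality for time-like
  vectors.\<close>

lemma sf_form_space_form:
  assumes c: "c \<in> {-1, 0, 1}" and x0: "x0 \<in> space_form c" and x: "sf_form c x x = 1"
    and pos: "c \<noteq> 1 \<Longrightarrow> sf_form c x0 x > 0"
  shows "x \<in> space_form c"
proof -
  consider "c = 1" | "c = 0" | "c = -1" using c by auto
  then show ?thesis
  proof cases
    case 1
    then show ?thesis using x by (cases x) (simp add: sf_form_def space_form_def power2_eq_square)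
  next
    case 2
    then have "snd x0 = 1" using x0 by (auto simp: space_form_def)
    moreover have "sf_form c x0 x = snd x0 * snd x" "sf_form c x x = (snd x)\<^sup>2"
      by (simp_all add: sf_form_def 2 power2_eq_square)
    ultimately have "snd x > 0" "(snd x)\<^sup>2 = 1" using x pos 2 by auto
    then have "snd x = 1" unfolding power2_eq_1_iff by linarith
    then show ?thesis using 2 by (cases x) (simp add: space_form_def)
  next
    case 3
    obtain u0 s0 where x0e: "x0 = (u0, s0)" by (cases x0)
    obtain u s where xe: "x = (u, s)" by (cases x)
    have s0: "u0 \<bullet> u0 - s0\<^sup>2 = -1" "s0 > 0" using x0 3 by (auto simp: x0e space_form_def)
    have us: "s\<^sup>2 - u \<bullet> u = 1" using x 3 by (simp add: sf_form_def xe power2_eq_square)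
    have p: "s0 * s - u0 \<bullet> u > 0" using pos 3 by (simp add: sf_form_def x0e xe)
    have "s > 0"
    proof (rule ccontr)
      assume "\<not> s > 0"
      then have s: "s \<le> 0" by simp
      have "(norm u0)\<^sup>2 \<le> s0\<^sup>2" using s0(1) by (simp add: dot_square_norm)
      then have n0: "norm u0 \<le> s0" by (rule power2_le_imp_le) (use s0(2) in simp)
      have "(norm u)\<^sup>2 \<le> (- s)\<^sup>2" using us by (simp add: dot_square_norm)
      then have n: "norm u \<le> - s" by (rule power2_le_imp_le) (use s in simp)
      have "- (u0 \<bullet> u) \<le> norm u0 * norm u" using Cauchy_Schwarz_ineq2[of u0 u] by linarith
      also have "\<dots> \<le> s0 * (- s)" using n0 n s0(2) by (intro mult_mono) auto
      finally show False using p by simp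
    qed
    then show ?thesis using us 3 by (simp add: space_form_def xe)
  qed
qed

locale slice =
  fixes I :: "real set" and f :: "real \<Rightarrow> real" and c :: real and x0 v1 v2 :: vec4
  assumes c: "c \<in> {-1, 0, 1}" and I: "open I" and f: "\<forall>t\<in>I. f t \<noteq> 0"
    and x0: "x0 \<in> space_form c" and tan: "v1 \<in> sf_tangent c x0" "v2 \<in> sf_tangent c x0"
    and on: "sf_metric c v1 v1 = 1" "sf_metric c v2 v2 = 1" "sf_metric c v1 v2 = 0"
begin

text \<open>Stereographic projection from \<open>- x0\<close>; for \<open>c = 0\<close> these are affine coordinates.\<close>

definition dn :: "real ^ 3 \<Rightarrow> real" where "dn y = 1 + c * ((y $ 2)\<^sup>2 + (y $ 3)\<^sup>2) / 4"
definition co0 where "co0 y = (2 - dn y) / dn y"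
definition co1 where "co1 y = y $ 2 / dn y"
definition co2 where "co2 y = y $ 3 / dn y"
definition \<psi> :: "real ^ 3 \<Rightarrow> vec5" where
  "\<psi> y = (y $ 1, co0 y *\<^sub>R x0 + co1 y *\<^sub>R v1 + co2 y *\<^sub>R v2)"
text \<open>For \<open>c\<close> equal to 0 or 1 the condition on \<open>dn\<close> always holds;
  for \<open>c = -1\<close> it is the disc of radius 2 of the Poincare model, in the last two
  coordinates.\<close>

definition D where "D = {y. y $ 1 \<in> I \<and> dn y > 0}"
definition P where "P = \<psi> ` D"
text \<open>\<open>ht\<close> measures the height above the pole \<open>- x0\<close>, and
  \<open>tg\<close> is the component orthogonal to \<open>x0\<close>. With them the inverse of
  \<psi> becomes a formula that is smooth on an open set of the ambient vector space, not merely on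
  \<open>P\<close>.\<close>

definition ht where "ht p = 1 + sf_form c x0 (snd p)" for p :: vec5
definition tg where "tg p = snd p - sf_form c x0 (snd p) *\<^sub>R x0" for p :: vec5
definition \<kappa> :: "vec5 \<Rightarrow> real ^ 3" where
  "\<kappa> p = fst p *\<^sub>R axis 1 1 + (2 * sf_metric c v1 (tg p) / ht p) *\<^sub>R axis 2 1
     + (2 * sf_metric c v2 (tg p) / ht p) *\<^sub>R axis 3 1"
definition H :: "(vec5, real ^ 3, vec5) submanifold" where
  "H = \<lparr>pts = P, charts = {(P, \<kappa>)}, imm = id\<rparr>"
definition V where "V = span {x0, v1, v2}"

lemma form: "sf_form c x0 x0 = 1" "sf_form c x0 v1 = 0" "sf_form c x0 v2 = 0" "sf_form c v1 x0 = 0" "sf_form c v2 x0 = 0"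
    "sf_form c v1 v1 = c" "sf_form c v2 v2 = c" "sf_form c v1 v2 = 0" "sf_form c v2 v1 = 0"
proof -
  show "sf_form c x0 x0 = 1" by (rule sf_form_self[OF c x0])
  show 1: "sf_form c x0 v1 = 0" "sf_form c x0 v2 = 0" using tan by (simp_all add: sf_form_tangent)
  show "sf_form c v1 x0 = 0" "sf_form c v2 x0 = 0" using 1 by (simp_all add: sf_form_commute[of c _ x0])
  show "sf_form c v1 v1 = c" "sf_form c v2 v2 = c" and 2: "sf_form c v1 v2 = 0"
    using sf_form_metric[OF c x0 tan(1)] sf_form_metric[OF c x0 tan(2)] on by simp_all
  show "sf_form c v2 v1 = 0" using 2 by (simp add: sf_form_commute[of c _ v1])
qed

lemma component_smooth: "smooth_on E (\<lambda>y :: real ^ 3. y $ i)"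
  by (rule smooth_on_bounded_linear) (rule bounded_linear_vec_nth)

lemma dn_smooth: "open E \<Longrightarrow> smooth_on E dn"
  unfolding dn_def[abs_def] by (intro smooth_intros component_smooth) auto

lemma open_D: "open D"
proof -
  have "D = (\<lambda>y. y $ 1) -` I \<inter> dn -` {0<..}" by (auto simp: D_def)
  moreover have "open ((\<lambda>y :: real ^ 3. y $ 1) -` I)"
    by (intro open_vimage I continuous_intros)
  moreover have "open (dn -` {0<..})"
    by (intro open_vimage smooth_on_continuous[OF dn_smooth]) auto
  ultimately show ?thesis by auto
qed

lemma co_smooth: "smooth_on D co0" "smooth_on D co1" "smooth_on D co2"
  unfolding co0_def[abs_def] co1_def[abs_def] co2_def[abs_def]
  by (intro smooth_intros open_D dn_smooth component_smooth; auto simp: D_def)+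

lemma \<psi>_smooth: "smooth_on D \<psi>"
  unfolding \<psi>_def[abs_def] by (intro smooth_intros open_D co_smooth component_smooth)

lemma co_eq:
  assumes "y \<in> D"
  shows "(co0 y)\<^sup>2 + c * ((co1 y)\<^sup>2 + (co2 y)\<^sup>2) = 1" "1 + co0 y = 2 / dn y" "dn y > 0"
proof -
  show d: "dn y > 0" using assms by (simp add: D_def)
  show "1 + co0 y = 2 / dn y" using d by (simp add: co0_def field_simps)
  have r: "c * ((y $ 2)\<^sup>2 + (y $ 3)\<^sup>2) = 4 * dn y - 4" by (simp add: dn_def)
  have "(co0 y)\<^sup>2 + c * ((co1 y)\<^sup>2 + (co2 y)\<^sup>2) = ((2 - dn y)\<^sup>2 + c * ((y $ 2)\<^sup>2 + (y $ 3)\<^sup>2)) / (dn y)\<^sup>2"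
    by (simp add: co0_def co1_def co2_def power_divide add_divide_distrib[symmetric])
  also have "\<dots> = 1" unfolding r using d by (simp add: power2_eq_square algebra_simps)
  finally show "(co0 y)\<^sup>2 + c * ((co1 y)\<^sup>2 + (co2 y)\<^sup>2) = 1" .
qed

lemma slice_in_space_form:
  assumes "a\<^sup>2 + c * (b\<^sup>2 + d\<^sup>2) = 1" "c \<noteq> 1 \<Longrightarrow> a > 0"
  shows "a *\<^sub>R x0 + b *\<^sub>R v1 + d *\<^sub>R v2 \<in> space_form c"
  by (rule sf_form_space_form[OF c x0])
    (use assms in \<open>simp_all add: sf_form_simps form power2_eq_square algebra_simps\<close>)

lemma \<psi>_rw_space: "y \<in> D \<Longrightarrow> \<psi> y \<in> rw_space I c"
proof -
  assume y: "y \<in> D"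
  have "co0 y > 0" if "c \<noteq> 1"
  proof -
    have "c * ((y $ 2)\<^sup>2 + (y $ 3)\<^sup>2) \<le> 0" using that c by (intro mult_nonpos_nonneg) auto
    then have "dn y \<le> 1" by (simp add: dn_def)
    then show ?thesis using co_eq(3)[OF y] by (simp add: co0_def)
  qed
  then show ?thesis
    using slice_in_space_form[OF co_eq(1)[OF y]] y by (simp add: rw_space_def \<psi>_def D_def)
qed

lemma \<kappa>_\<psi>: "y \<in> D \<Longrightarrow> \<kappa> (\<psi> y) = y"
proof -
  assume y: "y \<in> D"
  have ht: "ht (\<psi> y) = 2 / dn y" using co_eq(2)[OF y] by (simp add: ht_def \<psi>_def sf_form_simps form)
  have tg: "tg (\<psi> y) = co1 y *\<^sub>R v1 + co2 y *\<^sub>R v2" by (simp add: tg_def \<psi>_def sf_form_simps form)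
  have "2 * sf_metric c v1 (tg (\<psi> y)) / ht (\<psi> y) = y $ 2" "2 * sf_metric c v2 (tg (\<psi> y)) / ht (\<psi> y) = y $ 3"
    unfolding ht tg using co_eq(3)[OF y] on
    by (simp_all add: sf_metric_simps sf_metric_commute[of c v2 v1] co1_def co2_def)
  then show ?thesis unfolding \<kappa>_def by (simp add: vec_eq_iff forall_3 axis_def \<psi>_def)
qed

lemma P_inv: "inj_on \<kappa> P" "\<kappa> ` P = D" "y \<in> D \<Longrightarrow> inv_into P \<kappa> y = \<psi> y" "p \<in> P \<Longrightarrow> \<kappa> p \<in> D" "p \<in> P \<Longrightarrow> \<psi> (\<kappa> p) = p"
proof -
  show 1: "\<psi> (\<kappa> p) = p" "\<kappa> p \<in> D" if "p \<in> P" for p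
  proof -
    from that obtain y where y: "y \<in> D" "p = \<psi> y" unfolding P_def by blast
    then show "\<psi> (\<kappa> p) = p" "\<kappa> p \<in> D" by (simp_all add: \<kappa>_\<psi>)
  qed
  show inj: "inj_on \<kappa> P" by (rule inj_on_inverseI[of P \<psi>]) (rule 1)
  show "\<kappa> ` P = D" by (simp add: P_def image_image \<kappa>_\<psi> cong: image_cong)
  show "inv_into P \<kappa> y = \<psi> y" if "y \<in> D" for y
    using inv_into_f_f[OF inj, of "\<psi> y"] that by (simp add: P_def \<kappa>_\<psi>)
qed

lemma ht_smooth: "open E \<Longrightarrow> smooth_on E ht"
  unfolding ht_def[abs_def] sf_form_def by (intro smooth_intros) auto

lemma open_ht: "open {p. ht p > 0}"
  using open_vimage[of "{0<..}" ht] smooth_on_continuous[OF ht_smooth[of UNIV]] by (simp add: vimage_def)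

lemma P_ht: "P \<subseteq> {p. ht p > 0}"
proof
  fix p assume "p \<in> P"
  then obtain y where y: "y \<in> D" "p = \<psi> y" by (auto simp: P_def)
  have "ht p = 2 / dn y" using co_eq(2)[OF y(1)] by (simp add: y(2) ht_def \<psi>_def sf_form_simps form)
  then show "p \<in> {p. ht p > 0}" using co_eq(3)[OF y(1)] by simp
qed

lemma \<kappa>_smooth: "smooth_on {p. ht p > 0} \<kappa>"
  unfolding \<kappa>_def[abs_def] tg_def sf_form_def
  by (intro smooth_intros open_ht ht_smooth) auto

lemma atlas: "smooth_atlas P {(P, \<kappa>)}"
proof -
  have "continuous_on P \<kappa>" using continuous_on_subset[OF smooth_on_continuous[OF \<kappa>_smooth] P_ht] .
  moreover have "continuous_on D (inv_into P \<kappa>)"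
    using smooth_on_continuous[OF \<psi>_smooth] continuous_on_cong[of D D "inv_into P \<kappa>" \<psi>] P_inv(3) by simp
  ultimately have "homeomorphism P (\<kappa> ` P) \<kappa> (inv_into P \<kappa>)"
    unfolding homeomorphism_def P_inv(2) using P_inv by (auto simp: P_def \<kappa>_\<psi>)
  moreover have "smooth_on D (\<kappa> \<circ> inv_into P \<kappa>)"
    using smooth_on_cong[OF open_D, of "\<kappa> \<circ> inv_into P \<kappa>" "\<lambda>y. y"] smooth_on_ident P_inv(3) \<kappa>_\<psi> by simp
  ultimately show ?thesis
    unfolding smooth_atlas_def using open_D P_inv(2) by simp
qed

lemma chart_map: "smooth_on D (id \<circ> inv_into P \<kappa>)"
  using smooth_on_cong[OF open_D, of "id \<circ> inv_into P \<kappa>" \<psi>] \<psi>_smooth P_inv(3) by simp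

lemma dd_chart_map: "y \<in> D \<Longrightarrow> dd v (id \<circ> inv_into P \<kappa>) y = dd v \<psi> y"
  by (rule dd_cong_open[OF open_D]) (use P_inv(3) in auto)

text \<open>The smooth ambient left inverse \<kappa> can be differentiated, so its differential is a
  left inverse of that of \<psi>.\<close>

lemma inj_d\<psi>: "y \<in> D \<Longrightarrow> inj (\<lambda>v. dd v \<psi> y)"
proof -
  assume y: "y \<in> D"
  have hp: "\<psi> y \<in> {p. ht p > 0}" using P_ht y by (auto simp: P_def)
  have "dd (dd v \<psi> y) \<kappa> (\<psi> y) = v" for v
  proof -
    have "dd (dd v \<psi> y) \<kappa> (\<psi> y) = dd v (\<lambda>y. \<kappa> (\<psi> y)) y"
      using dd_eqI[OF has_derivative_compose[OF smooth_on_has_derivative[OF \<psi>_smooth y] smooth_on_has_derivative[OF \<kappa>_smooth hp]], of v] by simp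
    also have "\<dots> = dd v (\<lambda>y. y) y" by (rule dd_cong_open[OF open_D y \<kappa>_\<psi>])
    finally show ?thesis by simp
  qed
  then show ?thesis by (rule inj_on_inverseI)
qed

lemma deriv_in_chart_H: "deriv_in_chart H p W = (\<lambda>v. dd v (W \<circ> inv_into P \<kappa>) (\<kappa> p))" if "p \<in> P"
proof -
  have "chart_at H p = (P, \<kappa>)"
    unfolding chart_at_def by (rule some_equality) (use that in \<open>auto simp: H_def\<close>)
  then show ?thesis by (simp add: deriv_in_chart_def)
qed

section \<open>The slice as a totally geodesic hypersurface\<close>

lemma rw_submanifold_H: "rw_submanifold I c H"
proof -
  have "smooth_map H P id" using chart_map by (simp add: smooth_map_def H_def P_inv(2))
  moreover have "inj (deriv_in_chart H p id)" if "p \<in> P" for p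
    using inj_d\<psi>[OF P_inv(4)[OF that]] dd_chart_map[OF P_inv(4)[OF that]] by (simp add: deriv_in_chart_H[OF that])
  moreover have "P \<subseteq> rw_space I c" using \<psi>_rw_space by (auto simp: P_def)
  ultimately show ?thesis using atlas by (simp add: rw_submanifold_def H_def)
qed

sublocale H: immersion H
  using rw_submanifold_H by (rule rw_submanifold_immersion)

lemma H_chart: "(P, \<kappa>) \<in> charts H" and H_simps: "pts H = P" "imm H = id"
  by (simp_all add: H_def)

lemma tangent_space_H: "p \<in> P \<Longrightarrow> tangent_space H p = range (\<lambda>v. dd v \<psi> (\<kappa> p))"
  using H.tangent_space_chart(1)[OF H_chart] dd_chart_map[OF P_inv(4)] by (simp add: H_simps)

lemma V_iff: "u \<in> V \<longleftrightarrow> (\<exists>a b d. u = a *\<^sub>R x0 + b *\<^sub>R v1 + d *\<^sub>R v2)"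
proof
  assume "u \<in> V"
  then obtain a where "u - a *\<^sub>R x0 \<in> span {v1, v2}" unfolding V_def span_breakdown_eq[of u x0] by blast
  then obtain b d where "u - a *\<^sub>R x0 = b *\<^sub>R v1 + d *\<^sub>R v2" using span_pair_iff by blast
  then have "u = a *\<^sub>R x0 + b *\<^sub>R v1 + d *\<^sub>R v2" by (simp add: algebra_simps)
  then show "\<exists>a b d. u = a *\<^sub>R x0 + b *\<^sub>R v1 + d *\<^sub>R v2" by blast
next
  assume "\<exists>a b d. u = a *\<^sub>R x0 + b *\<^sub>R v1 + d *\<^sub>R v2"
  then show "u \<in> V" unfolding V_def by (elim exE) (simp add: span_add span_scale span_base)
qed

lemma subspace_UV: "subspace (UNIV \<times> V :: vec5 set)"
  by (intro subspace_Times subspace_UNIV) (simp add: V_def)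

lemma \<psi>_V: "\<psi> y \<in> UNIV \<times> V"
  using V_iff by (auto simp: \<psi>_def)

text \<open>The right-hand side contains the left-hand side and, not containing \<open>(0, snd p)\<close>, has dimension at most 3.\<close>

lemma tangent_space_H_eq:
  assumes p: "p \<in> P"
  shows "tangent_space H p = rw_tangent c p \<inter> (UNIV \<times> V)"
proof -
  let ?y = "\<kappa> p" and ?E = "rw_tangent c p \<inter> (UNIV \<times> V) :: vec5 set"
  note y = P_inv(4)[OF p] and py = P_inv(5)[OF p]
  have dif: "\<psi> differentiable (at ?y)" by (rule smooth_on_differentiable[OF \<psi>_smooth y])
  have lin: "linear (\<lambda>v. dd v \<psi> ?y)" by (rule smooth_on_linear[OF \<psi>_smooth y])
  have sub: "range (\<lambda>v. dd v \<psi> ?y) \<subseteq> ?E"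
    using dd_in_rw_tangent[OF c open_D y dif \<psi>_rw_space] dd_in_subspace[OF subspace_UV open_D y dif \<psi>_V]
    unfolding py by blast
  have subE: "subspace ?E" by (intro subspace_inter subspace_rw_tangent subspace_UV)
  have nE: "(0, snd p) \<notin> span ?E"
  proof
    assume "(0, snd p) \<in> span ?E"
    moreover have "span ?E = ?E" using subE by (rule span_eq_iff[THEN iffD2])
    ultimately have "(0, snd p) \<in> rw_tangent c p" by blast
    then have "sf_form c (snd p) (snd p) = 0" by (auto simp: rw_tangent_def sf_form_tangent)
    moreover have "snd p \<in> space_form c" using \<psi>_rw_space[OF y] py by (auto simp: rw_space_def mem_Times_iff)
    ultimately show False using sf_form_self[OF c, of "snd p"] by simp
  qed
  let ?B = "{(1, 0), (0, x0), (0, v1), (0, v2)} :: vec5 set"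
  have UV: "UNIV \<times> V \<subseteq> span ?B"
  proof
    fix q :: vec5 assume "q \<in> UNIV \<times> V"
    then obtain t a b d where "q = (t, a *\<^sub>R x0 + b *\<^sub>R v1 + d *\<^sub>R v2)" using V_iff by auto
    then have "q = t *\<^sub>R (1, 0) + a *\<^sub>R (0, x0) + b *\<^sub>R (0, v1) + d *\<^sub>R (0, v2)" by simp
    also have "\<dots> \<in> span ?B" by (intro span_add span_scale span_base) auto
    finally show "q \<in> span ?B" .
  qed
  have "(0, snd p) \<in> UNIV \<times> V" using \<psi>_V[of ?y] py by (auto simp: mem_Times_iff)
  then have "insert (0, snd p) ?E \<subseteq> span ?B" using UV by auto
  then have "dim (insert (0, snd p) ?E) \<le> card ?B" by (rule dim_le_card) simp
  also have "card ?B \<le> 4" by (simp add: card_insert_if)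
  finally have "dim ?E \<le> 3" using nE by (simp add: dim_insert)
  moreover have "dim (range (\<lambda>v. dd v \<psi> ?y)) = 3"
    using dim_image_eq[OF lin, of UNIV] inj_d\<psi>[OF y] by (simp add: dim_UNIV)
  ultimately have "range (\<lambda>v. dd v \<psi> ?y) = ?E"
    by (intro subspace_dim_equal linear_subspace_image[OF lin subspace_UNIV] subE sub) simp
  then show ?thesis using tangent_space_H[OF p] by simp
qed

lemma tangent_space_H_iff:
  "p \<in> P \<Longrightarrow> X \<in> tangent_space H p \<longleftrightarrow> snd X \<in> sf_tangent c (snd p) \<and> snd X \<in> V"
  by (simp add: tangent_space_H_eq rw_tangent_def mem_Times_iff)

text \<open>The tangent space splits into time and spatial directions, so \<open>X\<close> may be
  tested against \<open>(1, 0)\<close> and against its own spatial part, where the metric is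
  definite.\<close>

lemma nondegenerate_H:
  assumes p: "p \<in> P" and X: "X \<in> tangent_space H p" and n: "\<And>Y. Y \<in> tangent_space H p \<Longrightarrow> rw_metric f c p X Y = 0"
  shows "X = 0"
proof -
  have sp: "snd p \<in> space_form c" "fst p \<in> I"
    using \<psi>_rw_space[OF P_inv(4)[OF p]] P_inv(5)[OF p] by (auto simp: rw_space_def mem_Times_iff)
  have Xt: "snd X \<in> sf_tangent c (snd p)" "snd X \<in> V" using X tangent_space_H_iff[OF p, of X] by simp_all
  have z: "0 \<in> V" "0 \<in> sf_tangent c (snd p)" by (simp_all add: V_def span_zero sf_tangent_def)
  have "(1, 0) \<in> tangent_space H p" "(0, snd X) \<in> tangent_space H p"
    using Xt z by (simp_all add: tangent_space_H_iff[OF p])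
  from n[OF this(1)] n[OF this(2)] have "fst X = 0" "(f (fst p))\<^sup>2 * sf_metric c (snd X) (snd X) = 0"
    by (simp_all add: rw_metric_def sf_metric_simps)
  then have "fst X = 0" "sf_metric c (snd X) (snd X) = 0" using f sp by auto
  then have "fst X = 0" "snd X = 0" using sf_metric_pos[OF c sp(1) Xt(1)] by force+
  then show ?thesis by (simp add: prod_eq_iff)
qed

lemma normal_part_H:
  assumes p: "p \<in> P" and X: "X \<in> tangent_space H p"
  shows "normal_part f c H p X = 0"
  unfolding normal_part_def
proof (rule the_equality)
  show "0 \<in> normal_space f c H p \<and> X - 0 \<in> tangent_space H p"
    using X subspace_0[OF subspace_rw_tangent] by (simp add: normal_space_def rw_metric_simps)
next
  fix n assume n: "n \<in> normal_space f c H p \<and> X - n \<in> tangent_space H p"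
  have "subspace (tangent_space H p)"
    unfolding tangent_space_H_eq[OF p] by (intro subspace_inter subspace_rw_tangent subspace_UV)
  then have "X - (X - n) \<in> tangent_space H p" using n X subspace_diff by blast
  then show "n = 0" using n nondegenerate_H[OF p, of n] by (simp add: normal_space_def H_simps)
qed

text \<open>The geometric core of total geodesy: \<open>V\<close> is a linear space containing the
  position and the spatial parts of the tangent vectors, and every spatial term of
  \<open>rw_conn\<close> is a combination of such vectors and of the derivative of a
  \<open>V\<close>-valued map.\<close>

lemma cov_deriv_H:
  assumes p: "p \<in> P" and X: "X \<in> tangent_space H p" and U: "open_part H U" "p \<in> U" and W: "tangent_field H U W"
  shows "cov_deriv f c H p X W \<in> tangent_space H p"
proof -
  let ?y = "\<kappa> p" and ?F = "W \<circ> inv_into P \<kappa>" and ?Y = "\<kappa> ` (U \<inter> P)"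
  note y = P_inv(4)[OF p] and py = P_inv(5)[OF p]
  have sm: "smooth_map H U W" and WT: "\<And>q. q \<in> U \<Longrightarrow> W q \<in> tangent_space H q" using W by (auto simp: tangent_field_def)
  have op: "open ?Y" using chart_image_open[OF H.atlas H_chart] U by (simp add: open_part_def)
  have Y: "?y \<in> ?Y" "?Y \<subseteq> D" using p U P_inv(4) by auto
  have dF: "?F differentiable (at ?y)"
    using smooth_on_differentiable[OF H.smooth_map_in_chart[OF sm H_chart] Y(1)] .
  have d\<psi>: "\<psi> differentiable (at ?y)" by (rule smooth_on_differentiable[OF \<psi>_smooth y])
  obtain a where a: "X = dd a \<psi> ?y" using X tangent_space_H[OF p] by auto
  have Fp: "?F ?y = W p" using P_inv(3)[OF y] py by simp
  have FT: "?F q \<in> rw_tangent c (\<psi> q) \<inter> (UNIV \<times> V)" if q: "q \<in> ?Y" for q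
  proof -
    have "inv_into P \<kappa> q = \<psi> q" "\<psi> q \<in> P" using q Y P_inv(3) by (auto simp: P_def)
    moreover have "\<psi> q \<in> U" using q P_inv(5) by auto
    ultimately show ?thesis using WT[of "\<psi> q"] tangent_space_H_eq[of "\<psi> q"] by simp
  qed
  have "dir_deriv H p X W = dd a ?F ?y"
    using H.dir_deriv_chart[OF H_chart p U sm, of a] dd_chart_map[OF y] by (simp add: H_simps a)
  then have eq: "cov_deriv f c H p X W = rw_conn f c (\<psi> ?y) (dd a \<psi> ?y) (?F ?y) (dd a ?F ?y)"
    unfolding cov_deriv_def Fp by (simp add: H_simps py a)
  have 1: "cov_deriv f c H p X W \<in> rw_tangent c (\<psi> ?y)"
    unfolding eq by (rule rw_conn_in_rw_tangent[OF c op Y(1) d\<psi> _ dF]) (use FT Y \<psi>_rw_space in auto)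
  have V: "subspace V" by (simp add: V_def)
  have "snd (dd a \<psi> ?y) \<in> V" "snd (?F ?y) \<in> V" "snd (dd a ?F ?y) \<in> V" "snd (\<psi> ?y) \<in> V"
    using X tangent_space_H_eq[OF p] a FT[OF Y(1)] dd_in_subspace[OF subspace_UV op Y(1) dF, of a] FT \<psi>_V[of ?y]
    by (auto simp: mem_Times_iff)
  then have "snd (cov_deriv f c H p X W) \<in> V"
    unfolding eq rw_conn_def Let_def snd_conv by (intro subspace_add[OF V] subspace_scale[OF V])
  with 1 show ?thesis using tangent_space_H_eq[OF p] py by (auto simp: mem_Times_iff)
qed

lemma sff_H:
  assumes p: "p \<in> P" and X: "X \<in> tangent_space H p" and Y: "Y \<in> tangent_space H p"
  shows "sff f c H p X Y = 0"
  unfolding sff_def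
proof (rule the_equality)
  obtain b where b: "Y = dd b \<psi> (\<kappa> p)" using Y tangent_space_H[OF p] by auto
  let ?W = "\<lambda>q. dd b \<psi> (\<kappa> q)"
  have op: "open_part H P" using H.open_part_pts by (simp add: H_simps)
  have "smooth_on D (?W \<circ> inv_into P \<kappa>)"
    using smooth_on_cong[OF open_D, of "?W \<circ> inv_into P \<kappa>" "\<lambda>y. dd b \<psi> y"] smooth_on_dd[OF \<psi>_smooth] P_inv(3) \<kappa>_\<psi> by simp
  then have "smooth_map H P ?W" by (intro H.smooth_mapI[OF H_chart op order_refl]) (simp add: P_inv(2))
  then have tf: "tangent_field H P ?W" using tangent_space_H by (simp add: tangent_field_def)
  show "\<exists>U W. open_part H U \<and> p \<in> U \<and> tangent_field H U W \<and> W p = Y \<and> 0 = normal_part f c H p (cov_deriv f c H p X W)"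
    using op p tf b normal_part_H[OF p cov_deriv_H[OF p X op p tf]] by (intro exI[of _ P] exI[of _ ?W]) simp
next
  fix n assume "\<exists>U W. open_part H U \<and> p \<in> U \<and> tangent_field H U W \<and> W p = Y \<and> n = normal_part f c H p (cov_deriv f c H p X W)"
  then show "n = 0" using normal_part_H[OF p cov_deriv_H[OF p X]] by blast
qed

lemma totally_geodesic: "totally_geodesic_hypersurface I f c P"
  unfolding totally_geodesic_hypersurface_def
  using rw_submanifold_H nondegenerate_H sff_H by (intro exI[of _ H]) (auto simp: H_simps)

lemma P_memI:
  assumes p: "p \<in> rw_space I c" and V: "snd p \<in> V" and ht: "sf_form c x0 (snd p) > -1"
  shows "p \<in> P"
proof -
  obtain a b d where abd: "snd p = a *\<^sub>R x0 + b *\<^sub>R v1 + d *\<^sub>R v2" using V V_iff by blast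
  have "snd p \<in> space_form c" "fst p \<in> I" using p by (auto simp: rw_space_def mem_Times_iff)
  then have eq: "a\<^sup>2 + c * (b\<^sup>2 + d\<^sup>2) = 1" using sf_form_self[OF c, of "snd p"]
    by (simp add: abd sf_form_simps form power2_eq_square algebra_simps)
  have a: "1 + a > 0" using ht by (simp add: abd sf_form_simps form)
  \<comment> \<open>The stereographic coordinates of \<open>p\<close>; \<open>1 + a\<close> is its
    height above the pole, positive by the assumption on \<open>sf_form\<close>.\<close>
  define y :: "real ^ 3" where "y = fst p *\<^sub>R axis 1 1 + (2 * b / (1 + a)) *\<^sub>R axis 2 1 + (2 * d / (1 + a)) *\<^sub>R axis 3 1"
  have y: "y $ 1 = fst p" "y $ 2 = 2 * b / (1 + a)" "y $ 3 = 2 * d / (1 + a)" by (simp_all add: y_def axis_def)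
  have "(2 * b / (1 + a))\<^sup>2 + (2 * d / (1 + a))\<^sup>2 = 4 * ((b\<^sup>2 + d\<^sup>2) / (1 + a)\<^sup>2)"
    by (simp add: power_divide power_mult_distrib add_divide_distrib)
  then have "dn y = 1 + c * (4 * ((b\<^sup>2 + d\<^sup>2) / (1 + a)\<^sup>2)) / 4"
    by (simp only: dn_def y)
  then have "dn y = 1 + c * (b\<^sup>2 + d\<^sup>2) / (1 + a)\<^sup>2" by (simp del: distrib_left_numeral)
  also have "c * (b\<^sup>2 + d\<^sup>2) = (1 - a) * (1 + a)" using eq by (simp add: power2_eq_square algebra_simps)
  also have "(1 - a) * (1 + a) / (1 + a)\<^sup>2 = (1 - a) / (1 + a)" using a by (simp add: power2_eq_square)
  also have "1 + (1 - a) / (1 + a) = 2 / (1 + a)" using a by (simp add: field_simps)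
  finally have dn: "dn y = 2 / (1 + a)" .
  have "co0 y = a" "co1 y = b" "co2 y = d" using a by (simp_all add: co0_def co1_def co2_def dn y field_simps)
  then have "\<psi> y = p" by (simp add: \<psi>_def y abd[symmetric])
  moreover have "y \<in> D" using a \<open>fst p \<in> I\<close> by (simp add: D_def dn y)
  ultimately show ?thesis by (auto simp: P_def)
qed

end

section \<open>Surfaces whose second fundamental form points along \<open>\<partial>/\<partial>t\<close>\<close>

text \<open>The products of \<open>n\<close> with the three fields satisfy a linear homogeneous
  system along each segment from \<open>z0\<close> and start at zero. Ranging over all such
  \<open>n\<close> shows that \<open>X\<close> never leaves its initial span.\<close>

lemma constant_span:
  fixes X X1 X2 :: "real ^ 2 \<Rightarrow> 'a::euclidean_space"
  assumes sm: "smooth_on \<Omega> X" "smooth_on \<Omega> X1" "smooth_on \<Omega> X2" and r: "r > 0" "cball z0 r \<subseteq> \<Omega>"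
    and dX: "\<And>z v. z \<in> \<Omega> \<Longrightarrow> dd v X z = v $ 1 *\<^sub>R X1 z + v $ 2 *\<^sub>R X2 z"
    and ind: "\<And>z a b d. z \<in> \<Omega> \<Longrightarrow> a *\<^sub>R X z + b *\<^sub>R X1 z + d *\<^sub>R X2 z = 0 \<Longrightarrow> a = 0 \<and> b = 0 \<and> d = 0"
    and par: "\<And>z v. z \<in> \<Omega> \<Longrightarrow> \<exists>a b d. dd v X1 z = a *\<^sub>R X z + b *\<^sub>R X1 z + d *\<^sub>R X2 z"
      "\<And>z v. z \<in> \<Omega> \<Longrightarrow> \<exists>a b d. dd v X2 z = a *\<^sub>R X z + b *\<^sub>R X1 z + d *\<^sub>R X2 z"
    and n: "n \<bullet> X z0 = 0" "n \<bullet> X1 z0 = 0" "n \<bullet> X2 z0 = 0" and z: "z \<in> cball z0 r"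
  shows "n \<bullet> X z = 0"
proof -
  define L where "L z q = fst q *\<^sub>R X z + fst (snd q) *\<^sub>R X1 z + snd (snd q) *\<^sub>R X2 z" for z and q :: "real \<times> real \<times> real"
  have cont: "continuous_on (cball z0 r) X" "continuous_on (cball z0 r) X1" "continuous_on (cball z0 r) X2"
    using sm r(2) smooth_on_continuous continuous_on_subset by blast+
  \<comment> \<open>The coefficients in \<open>par\<close> need not be continuous. By independence
    and compactness the norm of \<open>L\<close> has a positive minimum \<open>m\<close> on unit
    coefficient vectors, so bounds on the derivatives bound the coefficients.\<close>
  let ?K = "cball z0 r \<times> sphere (0 :: real \<times> real \<times> real) 1"
  have cc: "continuous_on ?K (\<lambda>p. F (fst p))" if "continuous_on (cball z0 r) F" for F :: "real ^ 2 \<Rightarrow> 'a"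
    by (rule continuous_on_compose2[OF that]) (auto intro!: continuous_intros)
  have "continuous_on ?K (\<lambda>p. norm (L (fst p) (snd p)))"
    unfolding L_def by (intro continuous_intros cc cont)
  moreover have "compact ?K" by (intro compact_Times compact_cball compact_sphere)
  moreover have "(1, 0, 0) \<in> sphere (0 :: real \<times> real \<times> real) 1" by (simp add: norm_Pair)
  then have "?K \<noteq> {}" using r(1) by fastforce
  ultimately obtain p where p: "p \<in> ?K" "\<And>q. q \<in> ?K \<Longrightarrow> norm (L (fst p) (snd p)) \<le> norm (L (fst q) (snd q))"
    using continuous_attains_inf[of ?K "\<lambda>p. norm (L (fst p) (snd p))"] by blast
  define m where "m = norm (L (fst p) (snd p))"
  have "m > 0"
  proof (rule ccontr)
    assume "\<not> m > 0"
    then have "L (fst p) (snd p) = 0" by (simp add: m_def)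
    moreover have "fst p \<in> \<Omega>" using p(1) r(2) by auto
    ultimately have "fst (snd p) = 0 \<and> fst (snd (snd p)) = 0 \<and> snd (snd (snd p)) = 0" using ind unfolding L_def by blast
    then have "snd p = 0" by (simp add: prod_eq_iff)
    moreover have "norm (snd p) = 1" using p(1) by auto
    ultimately show False by simp
  qed
  have Lm: "m * norm q \<le> norm (L w q)" if w: "w \<in> cball z0 r" for w q
  proof (cases "q = 0")
    case False
    have "L w ((1 / norm q) *\<^sub>R q) = (1 / norm q) *\<^sub>R L w q" by (simp add: L_def scaleR_add_right)
    moreover have "(w, (1 / norm q) *\<^sub>R q) \<in> ?K" using w False by simp
    from p(2)[OF this] have "m \<le> norm (L w ((1 / norm q) *\<^sub>R q))" by (simp add: m_def)
    ultimately show ?thesis using False by (simp add: field_simps)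
  qed (simp add: L_def)
  define d where "d = z - z0"
  have seg: "z0 + s *\<^sub>R d \<in> cball z0 r" if "0 \<le> s" "s \<le> 1" for s
  proof -
    have "norm (s *\<^sub>R d) \<le> norm d" using that by (simp add: mult_left_le_one_le)
    also have "\<dots> \<le> r" using z by (simp add: d_def dist_norm norm_minus_commute)
    finally show ?thesis by (simp add: dist_norm)
  qed
  have bnd: "\<exists>B. \<forall>w\<in>cball z0 r. norm (dd d F w) \<le> B" if "smooth_on \<Omega> F" for F :: "real ^ 2 \<Rightarrow> 'a"
  proof -
    have "continuous_on (cball z0 r) (\<lambda>w. dd d F w)"
      using continuous_on_subset[OF smooth_on_continuous[OF smooth_on_dd[OF that]] r(2)] .
    then have "compact ((\<lambda>w. dd d F w) ` cball z0 r)" by (rule compact_continuous_image) (rule compact_cball)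
    then have "bounded ((\<lambda>w. dd d F w) ` cball z0 r)" by (rule compact_imp_bounded)
    then show ?thesis unfolding bounded_iff by auto
  qed
  obtain B1 B2 where B: "\<And>w. w \<in> cball z0 r \<Longrightarrow> norm (dd d X1 w) \<le> B1" "\<And>w. w \<in> cball z0 r \<Longrightarrow> norm (dd d X2 w) \<le> B2"
    using bnd[OF sm(2)] bnd[OF sm(3)] by blast
  define y where "y s = (n \<bullet> X (z0 + s *\<^sub>R d), n \<bullet> X1 (z0 + s *\<^sub>R d), n \<bullet> X2 (z0 + s *\<^sub>R d))" for s
  define y' where "y' s = (n \<bullet> dd d X (z0 + s *\<^sub>R d), n \<bullet> dd d X1 (z0 + s *\<^sub>R d), n \<bullet> dd d X2 (z0 + s *\<^sub>R d))" for s
  have hv: "((\<lambda>s. n \<bullet> F (z0 + s *\<^sub>R d)) has_vector_derivative n \<bullet> dd d F (z0 + s *\<^sub>R d)) (at s)"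
    if "0 \<le> s" "s \<le> 1" "smooth_on \<Omega> F" for s and F :: "real ^ 2 \<Rightarrow> 'a"
    by (rule bounded_linear.has_vector_derivative[OF bounded_linear_inner_right line_has_vector_derivative])
      (rule smooth_on_differentiable[OF that(3)], use seg[OF that(1,2)] r(2) in blast)
  have comp: "\<bar>n \<bullet> X (z0 + s *\<^sub>R d)\<bar> \<le> norm (y s)" "\<bar>n \<bullet> X1 (z0 + s *\<^sub>R d)\<bar> \<le> norm (y s)" "\<bar>n \<bullet> X2 (z0 + s *\<^sub>R d)\<bar> \<le> norm (y s)" for s
    using norm_fst_le[of "fst (y s)" "snd (y s)"] norm_snd_le[of "snd (y s)" "fst (y s)"]
      norm_fst_le[of "fst (snd (y s))" "snd (snd (y s))"] norm_snd_le[of "snd (snd (y s))" "fst (snd (y s))"]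
    by (simp_all add: y_def)
  have parb: "\<bar>n \<bullet> W\<bar> \<le> B / m * norm (y s)"
    if s: "0 \<le> s" "s \<le> 1" and W: "\<exists>a b e. W = a *\<^sub>R X (z0 + s *\<^sub>R d) + b *\<^sub>R X1 (z0 + s *\<^sub>R d) + e *\<^sub>R X2 (z0 + s *\<^sub>R d)" "norm W \<le> B" for s W B
  proof -
    obtain a b e where abe: "W = a *\<^sub>R X (z0 + s *\<^sub>R d) + b *\<^sub>R X1 (z0 + s *\<^sub>R d) + e *\<^sub>R X2 (z0 + s *\<^sub>R d)" using W(1) by blast
    define q where "q = (a, b, e)"
    have "W = L (z0 + s *\<^sub>R d) q" by (simp add: L_def q_def abe)
    then have "m * norm q \<le> B" using Lm[OF seg[OF s], of q] W(2) by simp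
    then have q: "norm q \<le> B / m" using \<open>m > 0\<close> by (simp add: field_simps)
    have "n \<bullet> W = q \<bullet> y s" by (simp add: abe q_def y_def inner_add_right)
    also have "\<bar>q \<bullet> y s\<bar> \<le> norm q * norm (y s)" by (rule Cauchy_Schwarz_ineq2)
    also have "\<dots> \<le> B / m * norm (y s)" using q by (intro mult_right_mono) auto
    finally show ?thesis by simp
  qed
  have "y 1 = 0"
  \<comment> \<open>The constant collects the contributions of the three components: the first two
    summands come from \<open>dX\<close>, the others from bounding the coefficients of the
    derivatives of \<open>X1\<close> and \<open>X2\<close>.\<close>
  proof (rule linear_ode_zero[where y' = y' and K = "\<bar>d $ 1\<bar> + \<bar>d $ 2\<bar> + B1 / m + B2 / m"])
    fix s :: real assume s: "0 \<le> s" "s \<le> 1"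
    show "(y has_vector_derivative y' s) (at s)"
      unfolding y_def[abs_def] y'_def by (intro has_vector_derivative_Pair hv s sm)
    have w: "z0 + s *\<^sub>R d \<in> \<Omega>" using seg[OF s] r(2) by auto
    have 1: "\<bar>n \<bullet> dd d X (z0 + s *\<^sub>R d)\<bar> \<le> \<bar>d $ 1\<bar> * norm (y s) + \<bar>d $ 2\<bar> * norm (y s)"
    proof -
      have "\<bar>n \<bullet> dd d X (z0 + s *\<^sub>R d)\<bar> \<le> \<bar>d $ 1\<bar> * \<bar>n \<bullet> X1 (z0 + s *\<^sub>R d)\<bar> + \<bar>d $ 2\<bar> * \<bar>n \<bullet> X2 (z0 + s *\<^sub>R d)\<bar>"
        unfolding dX[OF w] inner_add_right inner_scaleR_right abs_mult[symmetric] by (rule abs_triangle_ineq)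
      also have "\<dots> \<le> \<bar>d $ 1\<bar> * norm (y s) + \<bar>d $ 2\<bar> * norm (y s)"
        by (intro add_mono mult_left_mono comp) auto
      finally show ?thesis .
    qed
    have 2: "\<bar>n \<bullet> dd d X1 (z0 + s *\<^sub>R d)\<bar> \<le> B1 / m * norm (y s)"
      by (rule parb[OF s par(1)[OF w] B(1)[OF seg[OF s]]])
    have 3: "\<bar>n \<bullet> dd d X2 (z0 + s *\<^sub>R d)\<bar> \<le> B2 / m * norm (y s)"
      by (rule parb[OF s par(2)[OF w] B(2)[OF seg[OF s]]])
    have "norm (y' s) \<le> norm (fst (y' s)) + (norm (fst (snd (y' s))) + norm (snd (snd (y' s))))"
      using norm_Pair_le[of "fst (y' s)" "snd (y' s)"] norm_Pair_le[of "fst (snd (y' s))" "snd (snd (y' s))"] by simp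
    then show "norm (y' s) \<le> (\<bar>d $ 1\<bar> + \<bar>d $ 2\<bar> + B1 / m + B2 / m) * norm (y s)"
      using 1 2 3 by (simp add: y'_def algebra_simps)
  qed (auto simp: y_def n zero_prod_def)
  then show ?thesis by (simp add: y_def d_def zero_prod_def)
qed

context rw_surface_chart
begin

lemma spatial_tangent: "z \<in> \<Omega> \<Longrightarrow> snd (dd v \<phi> z) \<in> sf_tangent c (snd (\<phi> z))"
  using d\<phi>_rw_tangent[of z v] by (auto simp: rw_tangent_def mem_Times_iff)

text \<open>Pairing with the position kills the tangent vectors and isolates \<open>a\<close>. The
  remaining relation makes a tangent vector a multiple of \<open>d_dt\<close>, which must vanish
  because \<open>d_dt\<close> is not tangent.\<close>

lemma spatial_independent:
  assumes z: "z \<in> \<Omega>" and d: "d_dt \<notin> TM z"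
    and eq: "a *\<^sub>R snd (\<phi> z) + b *\<^sub>R snd (dd b1 \<phi> z) + e *\<^sub>R snd (dd b2 \<phi> z) = 0"
  shows "a = 0 \<and> b = 0 \<and> e = 0"
proof -
  have "sf_form c (snd (\<phi> z)) (a *\<^sub>R snd (\<phi> z) + b *\<^sub>R snd (dd b1 \<phi> z) + e *\<^sub>R snd (dd b2 \<phi> z)) = a"
    using spatial_tangent[OF z] sf_form_self[OF c snd_\<phi>[OF z]] by (simp add: sf_form_simps sf_form_tangent)
  then have a: "a = 0" unfolding eq by (simp add: sf_form_def)
  define s where "s = b * fst (dd b1 \<phi> z) + e * fst (dd b2 \<phi> z)"
  have comb: "b *\<^sub>R dd b1 \<phi> z + e *\<^sub>R dd b2 \<phi> z = s *\<^sub>R d_dt"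
    using eq a by (intro prod_eqI) (simp_all add: s_def d_dt_def)
  have "s = 0"
  proof (rule ccontr)
    assume s: "s \<noteq> 0"
    have "(1 / s) *\<^sub>R (b *\<^sub>R dd b1 \<phi> z + e *\<^sub>R dd b2 \<phi> z) \<in> TM z"
      by (intro subspace_scale[OF subspace_TM[OF z]] subspace_add[OF subspace_TM[OF z]] d\<phi>_TM)
    then show False using s d unfolding comb by simp
  qed
  then show ?thesis using a d\<phi>_independent[OF z] comb by auto
qed

text \<open>Since \<open>d_dt\<close> has no spatial part, the assumption on \<open>cd\<close>
  together with the formula for \<open>rw_conn\<close> keeps the derivatives of the spatial tangent
  vectors in the span of these vectors and the position. So this 3-dimensional span is constant and
  determines the slice.\<close>

lemma lies_in_slice:
  assumes U: "open U" "z0 \<in> U" "U \<subseteq> \<Omega>" and d: "\<And>z. z \<in> U \<Longrightarrow> d_dt \<notin> TM z"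
    and h: "\<And>z v w. z \<in> U \<Longrightarrow> \<exists>r. cd v (\<lambda>y. dd w \<phi> y) z - r *\<^sub>R d_dt \<in> TM z"
  shows "\<exists>U P. open_part M U \<and> U \<noteq> {} \<and> totally_geodesic_hypersurface I f c P \<and> imm M ` U \<subseteq> P"
proof -
  define X where "X z = snd (\<phi> z)" for z
  define Y where "Y v z = snd (dd v \<phi> z)" for v z
  have z0: "z0 \<in> \<Omega>" using U by auto
  have smU: "smooth_on U \<phi>" using smooth_\<phi> U(3) smooth_on_subset by blast
  have smX: "smooth_on U X" and smY: "smooth_on U (Y v)" for v
    unfolding X_def[abs_def] Y_def[abs_def] by (intro smooth_intros U(1) smU)+
  have dX: "dd v X z = Y v z" if "z \<in> U" for v z
    unfolding X_def[abs_def] Y_def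
    by (rule dd_eqI[OF has_derivative_snd[OF smooth_on_has_derivative[OF smU that]]])
  have dY: "dd v (Y w) z = snd (dd v (\<lambda>y. dd w \<phi> y) z)" if "z \<in> U" for v w z
    unfolding Y_def[abs_def]
    by (rule dd_eqI[OF has_derivative_snd[OF smooth_on_has_derivative[OF smooth_on_dd[OF smU] that]]])
  have Y_eq: "Y v z = v $ 1 *\<^sub>R Y b1 z + v $ 2 *\<^sub>R Y b2 z" if "z \<in> U" for v z
    unfolding Y_def using d\<phi>_eq[of z v] that U(3) by auto
  have par: "\<exists>a b e. dd v (Y w) z = a *\<^sub>R X z + b *\<^sub>R Y b1 z + e *\<^sub>R Y b2 z" if z: "z \<in> U" for v w z
  proof -
    have z': "z \<in> \<Omega>" using z U by auto
    obtain r where "cd v (\<lambda>y. dd w \<phi> y) z - r *\<^sub>R d_dt \<in> TM z" using h[OF z] by blast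
    then obtain a b where ab: "cd v (\<lambda>y. dd w \<phi> y) z - r *\<^sub>R d_dt = a *\<^sub>R dd b1 \<phi> z + b *\<^sub>R dd b2 \<phi> z"
      using TM_iff[OF z'] by blast
    have "snd (cd v (\<lambda>y. dd w \<phi> y) z) = a *\<^sub>R Y b1 z + b *\<^sub>R Y b2 z"
      using arg_cong[OF ab, of snd] by (simp add: d_dt_def Y_def)
    moreover define G k a1 a2 where "G = sf_metric c (Y v z) (Y w z)" and "k = deriv f (fst (\<phi> z)) / f (fst (\<phi> z))"
      and "a1 = fst (dd v \<phi> z)" and "a2 = fst (dd w \<phi> z)"
    have "snd (cd v (\<lambda>y. dd w \<phi> y) z) = dd v (Y w) z + (c * G) *\<^sub>R X z + k *\<^sub>R (a1 *\<^sub>R Y w z + a2 *\<^sub>R Y v z)"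
      by (simp add: cd_def rw_conn_def Let_def dY[OF z] G_def k_def a1_def a2_def X_def Y_def)
    ultimately have "dd v (Y w) z = a *\<^sub>R Y b1 z + b *\<^sub>R Y b2 z - (c * G) *\<^sub>R X z - k *\<^sub>R (a1 *\<^sub>R Y w z + a2 *\<^sub>R Y v z)"
      by (simp add: algebra_simps)
    also have "\<dots> = (- (c * G)) *\<^sub>R X z + (a - k * (a1 * w $ 1 + a2 * v $ 1)) *\<^sub>R Y b1 z + (b - k * (a1 * w $ 2 + a2 * v $ 2)) *\<^sub>R Y b2 z"
      unfolding Y_eq[OF z, of v] Y_eq[OF z, of w] by (simp add: algebra_simps)
    finally show ?thesis by blast
  qed
  obtain r where r: "r > 0" "cball z0 r \<subseteq> U" using iffD1[OF open_contains_cball U(1)] U(2) by blast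
  define S where "S = span {X z0, Y b1 z0, Y b2 z0}"
  have XS: "X z \<in> S" if z: "z \<in> cball z0 r" for z
  proof -
    have "n \<bullet> X z = 0" if n: "n \<in> S\<^sup>\<bottom>" for n
    proof (rule constant_span[where \<Omega> = U and X = X and ?X1.0 = "Y b1" and ?X2.0 = "Y b2", OF smX smY smY r])
      show "\<exists>a b e. dd v (Y b1) z = a *\<^sub>R X z + b *\<^sub>R Y b1 z + e *\<^sub>R Y b2 z"
        "\<exists>a b e. dd v (Y b2) z = a *\<^sub>R X z + b *\<^sub>R Y b1 z + e *\<^sub>R Y b2 z" if "z \<in> U" for z v
        by (rule par[OF that])+
      show "z \<in> cball z0 r" by (rule z)
      show "dd v X z = v $ 1 *\<^sub>R Y b1 z + v $ 2 *\<^sub>R Y b2 z" if "z \<in> U" for z v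
        by (rule trans[OF dX[OF that] Y_eq[OF that]])
      show "a = 0 \<and> b = 0 \<and> e = 0" if "z \<in> U" "a *\<^sub>R X z + b *\<^sub>R Y b1 z + e *\<^sub>R Y b2 z = 0" for z a b e
        using spatial_independent[OF _ d[OF that(1)]] that U(3) unfolding X_def Y_def by blast
      have nS: "n \<bullet> u = 0" if "u \<in> S" for u
        using n that by (simp add: orthogonal_comp_def orthogonal_def inner_commute[of n])
      show "n \<bullet> X z0 = 0" "n \<bullet> Y b1 z0 = 0" "n \<bullet> Y b2 z0 = 0"
        by (rule nS, simp add: S_def span_base)+
    qed
    then have "X z \<in> S\<^sup>\<bottom>\<^sup>\<bottom>" by (simp add: orthogonal_comp_def orthogonal_def)
    then show ?thesis using orthogonal_comp_self[of S] by (simp add: S_def)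
  qed
  have x0: "X z0 \<in> space_form c" using snd_\<phi>[OF z0] by (simp add: X_def)
  define u1 u2 where "u1 = Y b1 z0" and "u2 = Y b2 z0"
  have ut: "u1 \<in> sf_tangent c (X z0)" "u2 \<in> sf_tangent c (X z0)"
    using spatial_tangent[OF z0] by (simp_all add: u1_def u2_def X_def Y_def)
  have uind: "a = 0 \<and> b = 0" if "a *\<^sub>R u1 + b *\<^sub>R u2 = 0" for a b
    using spatial_independent[OF z0 d[OF U(2)], of 0 a b] that by (simp add: u1_def u2_def Y_def)
  have st: "a *\<^sub>R u + b *\<^sub>R v \<in> sf_tangent c (X z0)" if "u \<in> sf_tangent c (X z0)" "v \<in> sf_tangent c (X z0)" for a b u v
    using that by (simp add: sf_form_tangent sf_form_simps)
  \<comment> \<open>Gram-Schmidt for \<open>sf_metric\<close>, which is definite on the tangent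
    space at the base point, supplies the orthonormal pair for the slice.\<close>
  define s1 where "s1 = sqrt (sf_metric c u1 u1)"
  define v1 where "v1 = (1 / s1) *\<^sub>R u1"
  have "u1 \<noteq> 0" using uind[of 1 0] by auto
  then have p1: "sf_metric c u1 u1 > 0" using sf_metric_pos[OF c x0 ut(1)] by simp
  then have s1: "s1 > 0" "s1 * s1 = sf_metric c u1 u1" by (simp_all add: s1_def)
  define w where "w = u2 - sf_metric c u2 v1 *\<^sub>R v1"
  have w_eq: "w = (- (sf_metric c u2 v1 / s1)) *\<^sub>R u1 + 1 *\<^sub>R u2" by (simp add: w_def v1_def)
  have wt: "w \<in> sf_tangent c (X z0)" unfolding w_eq by (rule st[OF ut])
  have "w \<noteq> 0" using uind[of "- (sf_metric c u2 v1 / s1)" 1] w_eq by auto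
  then have p2: "sf_metric c w w > 0" using sf_metric_pos[OF c x0 wt] by simp
  define s2 where "s2 = sqrt (sf_metric c w w)"
  define v2 where "v2 = (1 / s2) *\<^sub>R w"
  have s2: "s2 > 0" "s2 * s2 = sf_metric c w w" using p2 by (simp_all add: s2_def)
  have on: "sf_metric c v1 v1 = 1" "sf_metric c v2 v2 = 1"
    using s1 s2 by (simp_all add: v1_def v2_def sf_metric_simps s1(2)[symmetric] s2(2)[symmetric])
  have "sf_metric c v1 w = 0" by (simp add: w_def sf_metric_simps on sf_metric_commute[of c v1 u2])
  then have on2: "sf_metric c v1 v2 = 0" by (simp add: v2_def sf_metric_simps)
  have vt: "v1 \<in> sf_tangent c (X z0)" "v2 \<in> sf_tangent c (X z0)"
    using st[OF ut(1) ut(1), of "1 / s1" 0] st[OF wt wt, of "1 / s2" 0] by (simp_all add: v1_def v2_def)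
  interpret sl: slice I f c "X z0" v1 v2
    by unfold_locales (use c I f(2) x0 vt on on2 in auto)
  have "u1 = s1 *\<^sub>R v1" "u2 = s2 *\<^sub>R v2 + sf_metric c u2 v1 *\<^sub>R v1"
    using s1 s2 by (simp_all add: v1_def v2_def w_def)
  then have "u1 \<in> sl.V" "u2 \<in> sl.V" "X z0 \<in> sl.V"
    unfolding sl.V_def by (metis insertI1 insertI2 span_add span_base span_scale)+
  then have SV: "S \<subseteq> sl.V" unfolding S_def using span_minimal[of _ sl.V] by (simp add: u1_def u2_def sl.V_def)
  \<comment> \<open>The chart of the slice misses points where \<open>sf_form\<close> with the base
    point is at most -1. At \<open>z0\<close> the value is 1, so continuity leaves a
    neighbourhood.\<close>
  define B where "B = ball z0 r \<inter> {z \<in> U. sf_form c (X z0) (X z) > -1}"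
  have "open {z \<in> U. sf_form c (X z0) (X z) > -1}"
  proof -
    have "continuous_on U (\<lambda>z. sf_form c (X z0) (X z))"
      unfolding sf_form_def by (intro continuous_intros smooth_on_continuous[OF smX])
    from continuous_open_preimage[OF this U(1) open_greaterThan, of "-1"] show ?thesis by (simp add: vimage_def Int_def)
  qed
  then have "open B" by (simp add: B_def open_Int)
  then have "open_part M {q \<in> C. \<kappa> q \<in> B}"
    unfolding open_part_def by (rule chart_preimage_open[OF atlas chart])
  moreover have "pt z0 \<in> {q \<in> C. \<kappa> q \<in> B}"
    using pt(1,2)[OF z0] r U(2) sf_form_self[OF c x0] by (simp add: B_def)
  moreover have "imm M ` {q \<in> C. \<kappa> q \<in> B} \<subseteq> sl.P"
  proof (rule image_subsetI)
    fix q assume "q \<in> {q \<in> C. \<kappa> q \<in> B}"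
    then have q: "q \<in> C" "\<kappa> q \<in> B" by simp_all
    have im: "imm M q = \<phi> (\<kappa> q)" using \<phi>_pt[of "\<kappa> q"] pt(3)[OF q(1)] by simp
    have "X (\<kappa> q) \<in> sl.V" using XS[of "\<kappa> q"] q(2) SV by (auto simp: B_def)
    then show "imm M q \<in> sl.P" unfolding im
      using rw_space_\<phi>[OF pt(4)[OF q(1)]] q(2) by (intro sl.P_memI) (simp_all add: X_def B_def)
  qed
  ultimately show ?thesis using sl.totally_geodesic by blast
qed

end

section \<open>The frame adapted to \<open>T\<close>\<close>

context rw_surface_chart
begin

lemma smooth_f\<phi>: "smooth_on \<Omega> (\<lambda>z. f (fst (\<phi> z)))" "smooth_on \<Omega> (\<lambda>z. deriv f (fst (\<phi> z)))"
proof -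
  have t: "smooth_on \<Omega> (\<lambda>z. fst (\<phi> z))" by (intro smooth_intros \<Omega> smooth_\<phi>)
  have im: "(\<lambda>z. fst (\<phi> z)) ` \<Omega> \<subseteq> I" using fst_\<phi> by blast
  show "smooth_on \<Omega> (\<lambda>z. f (fst (\<phi> z)))"
    by (rule smooth_on_compose[OF I \<Omega> f(1) t im])
  show "smooth_on \<Omega> (\<lambda>z. deriv f (fst (\<phi> z)))"
    by (rule smooth_on_compose[OF I \<Omega> smooth_on_deriv[OF I f(1)] t im])
qed

lemma smooth_g: "smooth_on \<Omega> X \<Longrightarrow> smooth_on \<Omega> Y \<Longrightarrow> smooth_on \<Omega> (\<lambda>z. g z (X z) (Y z))"
  unfolding g_def rw_metric_def by (intro smooth_intros \<Omega> smooth_f\<phi>)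

lemma f_nonzero: "z \<in> \<Omega> \<Longrightarrow> f (fst (\<phi> z)) \<noteq> 0"
  using f(2) fst_\<phi> by blast

lemma smooth_cd: "smooth_on \<Omega> F \<Longrightarrow> smooth_on \<Omega> (\<lambda>z. cd v F z)"
  unfolding cd_def rw_conn_def Let_def
  by (intro smooth_intros \<Omega> smooth_f\<phi> smooth_\<phi> f_nonzero)

text \<open>\<open>E2\<close> spans the kernel of \<open>dt\<close> on the tangent plane, that is the orthogonal complement of \<open>T\<close>.\<close>

definition E2 where "E2 z = fst (dd b2 \<phi> z) *\<^sub>R dd b1 \<phi> z - fst (dd b1 \<phi> z) *\<^sub>R dd b2 \<phi> z"
text \<open>The determinant pattern of \<open>E2\<close> with the linear form
  \<open>g z _ (E2 z)\<close> in place of dt; hence \<open>E1\<close> spans the orthogonal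
  complement of \<open>E2\<close>, that is the direction of \<open>T\<close>, without any
  division.\<close>

definition E1 where "E1 z = g z (dd b2 \<phi> z) (E2 z) *\<^sub>R dd b1 \<phi> z - g z (dd b1 \<phi> z) (E2 z) *\<^sub>R dd b2 \<phi> z"
definition e1 where "e1 z = (1 / sqrt (- g z (E1 z) (E1 z))) *\<^sub>R E1 z"
definition e2 where "e2 z = (1 / sqrt (g z (E2 z) (E2 z))) *\<^sub>R E2 z"

lemmas g_simps = rw_metric_simps[of f c "\<phi> z" for z, folded g_def]

lemma g_commute: "g z X Y = g z Y X"
  by (simp add: g_def rw_metric_commute)

lemma E_TM: "z \<in> \<Omega> \<Longrightarrow> E1 z \<in> TM z" "z \<in> \<Omega> \<Longrightarrow> E2 z \<in> TM z"
  unfolding E1_def E2_def by (intro subspace_diff subspace_scale subspace_TM d\<phi>_TM; simp)+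

lemma fst_E2: "fst (E2 z) = 0"
  by (simp add: E2_def)

lemma g_spatial:
  assumes z: "z \<in> \<Omega>" and X: "X \<in> TM z" "fst X = 0" "X \<noteq> 0" shows "g z X X > 0"
proof -
  have "snd X \<in> sf_tangent c (snd (\<phi> z))" using spatial_tangent[OF z] X(1) by (auto simp: TM_def)
  moreover have "snd X \<noteq> 0" using X(2,3) by (simp add: prod_eq_iff)
  ultimately have "sf_metric c (snd X) (snd X) > 0" by (rule sf_metric_pos[OF c snd_\<phi>[OF z]])
  then show ?thesis using f_nonzero[OF z] X(2) by (simp add: g_def rw_metric_def)
qed

text \<open>If dt vanished on the tangent plane, the plane would be spatial and hence positive
  definite, contradicting its unit time-like vector.\<close>

lemma E2_nonzero:
  assumes z: "z \<in> \<Omega>" shows "E2 z \<noteq> 0"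
proof
  assume "E2 z = 0"
  then have "fst (dd b2 \<phi> z) *\<^sub>R dd b1 \<phi> z + (- fst (dd b1 \<phi> z)) *\<^sub>R dd b2 \<phi> z = 0" by (simp add: E2_def)
  from d\<phi>_independent[OF z this] have 0: "fst (dd b1 \<phi> z) = 0" "fst (dd b2 \<phi> z) = 0" by simp_all
  obtain u v where uv: "TM z = span {u, v}" "g z u u = -1" using TM_lorentz[OF z] by metis
  have u: "u \<in> TM z" unfolding uv(1) by (simp add: span_base)
  then obtain a b where "u = a *\<^sub>R dd b1 \<phi> z + b *\<^sub>R dd b2 \<phi> z" using TM_iff[OF z] by blast
  then have "fst u = 0" using 0 by simp
  moreover have "u \<noteq> 0" using uv(2) by (auto simp: g_simps)
  ultimately show False using g_spatial[OF z u] uv(2) by simp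
qed

lemma g_E2: "z \<in> \<Omega> \<Longrightarrow> g z (E2 z) (E2 z) > 0"
  using g_spatial E_TM(2) fst_E2 E2_nonzero by blast

lemma g_E1_E2: "g z (E1 z) (E2 z) = 0"
  by (simp add: E1_def g_simps)

lemma g_E2_expand: "g z (E2 z) (E2 z) = fst (dd b2 \<phi> z) * g z (dd b1 \<phi> z) (E2 z) - fst (dd b1 \<phi> z) * g z (dd b2 \<phi> z) (E2 z)"
  by (subst (2) E2_def) (simp add: g_simps g_commute[of z "E2 z"])

text \<open>In a Lorentzian plane the orthogonal complement of a space-like vector is time-like. In
  coordinates, orthogonality gives \<open>q * b = p * a\<close>, while \<open>b * b > a * a\<close>,
  so \<open>q * q < p * p\<close>.\<close>

lemma g_E1:
  assumes z: "z \<in> \<Omega>" shows "g z (E1 z) (E1 z) < 0"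
proof -
  obtain u v where uv: "TM z = span {u, v}" "g z u u = -1" "g z v v = 1" "g z u v = 0" using TM_lorentz[OF z] by metis
  have gvu: "g z v u = 0" using uv(4) g_commute by simp
  obtain a b where ab: "E2 z = a *\<^sub>R u + b *\<^sub>R v" using E_TM(2)[OF z] span_pair_iff unfolding uv(1) by blast
  obtain p q where pq: "E1 z = p *\<^sub>R u + q *\<^sub>R v" using E_TM(1)[OF z] span_pair_iff unfolding uv(1) by blast
  have 1: "b * b > a * a" using g_E2[OF z] unfolding ab by (simp add: g_simps uv gvu)
  have 2: "q * b = p * a" using g_E1_E2[of z] unfolding ab pq by (simp add: g_simps uv gvu mult.commute)
  have "E1 z \<noteq> 0"
  proof
    assume "E1 z = 0"
    then have "g z (dd b2 \<phi> z) (E2 z) *\<^sub>R dd b1 \<phi> z + (- g z (dd b1 \<phi> z) (E2 z)) *\<^sub>R dd b2 \<phi> z = 0" by (simp add: E1_def)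
    from d\<phi>_independent[OF z this] show False using g_E2[OF z] g_E2_expand[of z] by simp
  qed
  then have 3: "p \<noteq> 0 \<or> q \<noteq> 0" using pq by auto
  have bpos: "b * b > 0" using 1 zero_le_square[of a] by linarith
  have "p \<noteq> 0" using 3 2 bpos by auto
  then have "p * p > 0" using not_real_square_gt_zero by blast
  with 1 have "(p * p) * (a * a) < (p * p) * (b * b)" by (rule mult_strict_left_mono)
  moreover have "(p * p) * (a * a) = (q * q) * (b * b)" using 2 by (metis mult.assoc mult.left_commute)
  ultimately have "(q * q) * (b * b) < (p * p) * (b * b)" by simp
  then have "q * q < p * p" by (rule mult_right_less_imp_less) simp
  then show ?thesis unfolding pq by (simp add: g_simps uv gvu)
qed

lemma e_orthonormal:
  assumes z: "z \<in> \<Omega>" shows "g z (e1 z) (e1 z) = -1" "g z (e2 z) (e2 z) = 1" "g z (e1 z) (e2 z) = 0"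
  using g_E1[OF z] g_E2[OF z] g_E1_E2[of z] by (simp_all add: e1_def e2_def g_simps)

lemma e_TM: "z \<in> \<Omega> \<Longrightarrow> e1 z \<in> TM z" "z \<in> \<Omega> \<Longrightarrow> e2 z \<in> TM z"
  unfolding e1_def e2_def by (intro subspace_scale subspace_TM E_TM; simp)+

lemma TM_E:
  assumes z: "z \<in> \<Omega>" shows "TM z = span {E1 z, E2 z}"
proof
  show "span {E1 z, E2 z} \<subseteq> TM z"
    by (rule span_minimal) (use E_TM[OF z] subspace_TM[OF z] in auto)
  define p q a1 a2 \<Delta> where "p = g z (dd b2 \<phi> z) (E2 z)" and "q = g z (dd b1 \<phi> z) (E2 z)"
    and "a1 = fst (dd b1 \<phi> z)" and "a2 = fst (dd b2 \<phi> z)" and "\<Delta> = g z (E2 z) (E2 z)"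
  have D: "\<Delta> = a2 * q - a1 * p" "\<Delta> \<noteq> 0"
    using g_E2[OF z] g_E2_expand[of z] by (simp_all add: \<Delta>_def p_def q_def a1_def a2_def)
  have E: "E1 z = p *\<^sub>R dd b1 \<phi> z - q *\<^sub>R dd b2 \<phi> z" "E2 z = a2 *\<^sub>R dd b1 \<phi> z - a1 *\<^sub>R dd b2 \<phi> z"
    by (simp_all add: E1_def p_def q_def) (simp add: E2_def a1_def a2_def)
  show "TM z \<subseteq> span {E1 z, E2 z}"
  proof
    fix X assume "X \<in> TM z"
    then obtain x y where X: "X = x *\<^sub>R dd b1 \<phi> z + y *\<^sub>R dd b2 \<phi> z" using TM_iff[OF z] by blast
    \<comment> \<open>Cramer's rule: the determinant of \<open>E1\<close>, \<open>E2\<close> in the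
      coordinate basis is, up to sign, the square \<Delta> of \<open>E2\<close>.\<close>
    have "(- (a1 * x + a2 * y)) *\<^sub>R E1 z + (q * x + p * y) *\<^sub>R E2 z
        = (x * \<Delta>) *\<^sub>R dd b1 \<phi> z + (y * \<Delta>) *\<^sub>R dd b2 \<phi> z"
      unfolding E D(1) by (simp add: algebra_simps)
    also have "\<dots> = \<Delta> *\<^sub>R X" unfolding X by (simp add: scaleR_add_right mult.commute)
    finally have "X = (1 / \<Delta>) *\<^sub>R ((- (a1 * x + a2 * y)) *\<^sub>R E1 z + (q * x + p * y) *\<^sub>R E2 z)"
      using D(2) by simp
    also have "\<dots> \<in> span {E1 z, E2 z}" by (intro span_scale span_add) (auto intro: span_base)
    finally show "X \<in> span {E1 z, E2 z}" .
  qed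
qed

lemma TM_e:
  assumes z: "z \<in> \<Omega>" shows "TM z = span {e1 z, e2 z}"
proof
  show "span {e1 z, e2 z} \<subseteq> TM z"
    by (rule span_minimal) (use e_TM[OF z] subspace_TM[OF z] in auto)
  have "E1 z = sqrt (- g z (E1 z) (E1 z)) *\<^sub>R e1 z" "E2 z = sqrt (g z (E2 z) (E2 z)) *\<^sub>R e2 z"
    using g_E1[OF z] g_E2[OF z] by (simp_all add: e1_def e2_def)
  then have "E1 z \<in> span {e1 z, e2 z}" "E2 z \<in> span {e1 z, e2 z}"
    by (metis insertI1 span_base span_scale, metis insertI1 insertI2 span_base span_scale)
  then show "TM z \<subseteq> span {e1 z, e2 z}" unfolding TM_E[OF z] by (intro span_minimal) auto
qed

lemma normal_part_e:
  assumes z: "z \<in> \<Omega>" and V: "V \<in> rw_tangent c (\<phi> z)"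
  shows "normal_part f c M (pt z) V = V + g z V (e1 z) *\<^sub>R e1 z - g z V (e2 z) *\<^sub>R e2 z"
proof -
  have "e1 z \<in> rw_tangent c (\<phi> z)" "e2 z \<in> rw_tangent c (\<phi> z)"
    using e_TM[OF z] TM_rw_tangent[OF z] by blast+
  then show ?thesis
    using normal_part_eq[of M "pt z" "e1 z" "e2 z" c f V] TM_e[OF z] tangent_space_pt[OF z] e_orthonormal[OF z] V
    by (simp add: \<phi>_pt g_def)
qed

text \<open>Pairing with \<partial>/\<partial>t is minus the time component, and \<open>e2\<close>
  has none, so projecting onto the frame leaves \<open>T = fst e1\<close> times \<open>e1\<close>.
  This factor is nonzero since spatial tangent vectors are not time-like.\<close>

lemma T_field_e1:
  assumes z: "z \<in> \<Omega>" shows "\<exists>r. r \<noteq> 0 \<and> e1 z = r *\<^sub>R T_field f c M (pt z)"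
proof -
  have d: "d_dt \<in> rw_tangent c (\<phi> z)" by (simp add: d_dt_def rw_tangent_def sf_tangent_def)
  have gd: "g z d_dt X = - fst X" for X by (simp add: g_def rw_metric_def d_dt_def sf_metric_simps)
  have "fst (e2 z) = 0" by (simp add: e2_def fst_E2)
  then have T: "T_field f c M (pt z) = fst (e1 z) *\<^sub>R e1 z"
    using normal_part_e[OF z d] by (simp add: T_field_def tangential_part_def gd)
  have "fst (e1 z) \<noteq> 0"
  proof
    assume "fst (e1 z) = 0"
    moreover have "e1 z \<noteq> 0" using e_orthonormal(1)[OF z] by (auto simp: g_simps)
    ultimately show False using g_spatial[OF z e_TM(1)[OF z]] e_orthonormal(1)[OF z] by simp
  qed
  then show ?thesis unfolding T by (intro exI[of _ "1 / fst (e1 z)"]) simp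
qed

lemma relative_null_scale:
  assumes z: "z \<in> \<Omega>" and X: "X \<in> relative_null_space f c M (pt z)"
  shows "r *\<^sub>R X \<in> relative_null_space f c M (pt z)"
proof -
  have "X \<in> TM z" using X tangent_space_pt[OF z] by (simp add: relative_null_space_def)
  then obtain w where w: "X = dd w \<phi> z" by (auto simp: TM_def)
  have rw: "r *\<^sub>R X = dd (r *\<^sub>R w) \<phi> z" using linear_scale[OF linear_d\<phi>[OF z]] w by simp
  have "cd v (\<lambda>y. dd (r *\<^sub>R w) \<phi> y) z = r *\<^sub>R cd v (\<lambda>y. dd w \<phi> y) z" for v
    unfolding cd_d\<phi>_eq[OF z, of v w] cd_d\<phi>_eq[OF z, of v "r *\<^sub>R w"] by (simp add: scaleR_add_right)
  moreover have "\<forall>v. cd v (\<lambda>y. dd w \<phi> y) z \<in> TM z" using X relative_null_iff[OF z, of w] w by simp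
  ultimately have "dd (r *\<^sub>R w) \<phi> z \<in> relative_null_space f c M (pt z)"
    unfolding relative_null_iff[OF z] by (simp add: subspace_scale[OF subspace_TM[OF z]])
  then show ?thesis by (simp only: rw)
qed

lemma smooth_E: "smooth_on \<Omega> E1" "smooth_on \<Omega> E2"
proof -
  show 2: "smooth_on \<Omega> E2" unfolding E2_def[abs_def] by (intro smooth_intros \<Omega> smooth_\<phi>)
  show "smooth_on \<Omega> E1" unfolding E1_def[abs_def] by (intro smooth_intros smooth_g 2 \<Omega> smooth_\<phi>)
qed

lemma smooth_norm_E: "smooth_on \<Omega> (\<lambda>z. 1 / sqrt (- g z (E1 z) (E1 z)))" "smooth_on \<Omega> (\<lambda>z. 1 / sqrt (g z (E2 z) (E2 z)))"
  by (intro smooth_intros smooth_g smooth_E \<Omega>; use g_E1 g_E2 in force)+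

lemma smooth_e: "smooth_on \<Omega> e1" "smooth_on \<Omega> e2"
  unfolding e1_def[abs_def] e2_def[abs_def]
  by (intro smooth_on_scaleR smooth_norm_E smooth_E \<Omega>)+

lemma tangent_field_chart:
  assumes "smooth_on \<Omega> F" "\<And>z. z \<in> \<Omega> \<Longrightarrow> F z \<in> TM z"
  shows "tangent_field M C (\<lambda>q. F (\<kappa> q))"
  unfolding tangent_field_def
proof
  show "smooth_map M C (\<lambda>q. F (\<kappa> q))"
    by (rule smooth_map_chartI[OF open_part_chart[OF chart] order_refl]) (use assms(1) in \<open>simp add: \<Omega>_def\<close>)
  show "\<forall>q\<in>C. F (\<kappa> q) \<in> tangent_space M q"
    using assms(2) tangent_space_pt pt(3,4) by metis
qed

lemma orthonormal_frame_e: "orthonormal_frame f c M C (\<lambda>q. e1 (\<kappa> q)) (\<lambda>q. e2 (\<kappa> q))"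
  unfolding orthonormal_frame_def
proof (intro conjI ballI)
  fix q assume q: "q \<in> C"
  have im: "imm M q = \<phi> (\<kappa> q)" using \<phi>_pt[of "\<kappa> q"] pt(3)[OF q] by simp
  note on = e_orthonormal[OF pt(4)[OF q], unfolded g_def]
  show "\<bar>metric_at f c M q (e1 (\<kappa> q)) (e1 (\<kappa> q))\<bar> = 1" "\<bar>metric_at f c M q (e2 (\<kappa> q)) (e2 (\<kappa> q))\<bar> = 1"
    "metric_at f c M q (e1 (\<kappa> q)) (e2 (\<kappa> q)) = 0"
    unfolding im on by simp_all
qed (intro tangent_field_chart smooth_e e_TM; simp)+

text \<open>The pointwise description of \<open>sff\<close> hides smoothness. With the smooth
  components \<open>w1\<close>, \<open>w2\<close> of \<open>e2\<close> it is the normal part of a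
  combination of derivatives of coordinate fields, and the frame makes that projection
  explicit.\<close>

lemma sff_e2_normal_field: "normal_field f c M C (\<lambda>q. sff f c M q (e2 (\<kappa> q)) (e2 (\<kappa> q)))"
proof -
  define s where "s z = 1 / sqrt (g z (E2 z) (E2 z))" for z
  define w1 w2 where "w1 z = s z * fst (dd b2 \<phi> z)" and "w2 z = - (s z * fst (dd b1 \<phi> z))" for z
  define n where "n z = w1 z *\<^sub>R (w1 z *\<^sub>R cd b1 (\<lambda>y. dd b1 \<phi> y) z + w2 z *\<^sub>R cd b1 (\<lambda>y. dd b2 \<phi> y) z)
    + w2 z *\<^sub>R (w1 z *\<^sub>R cd b2 (\<lambda>y. dd b1 \<phi> y) z + w2 z *\<^sub>R cd b2 (\<lambda>y. dd b2 \<phi> y) z)" for z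
  define \<xi> where "\<xi> z = n z + g z (n z) (e1 z) *\<^sub>R e1 z - g z (n z) (e2 z) *\<^sub>R e2 z" for z
  have ss: "smooth_on \<Omega> s" using smooth_norm_E(2) by (simp add: s_def[abs_def])
  have sw: "smooth_on \<Omega> w1" "smooth_on \<Omega> w2"
    unfolding w1_def[abs_def] w2_def[abs_def] by (intro smooth_intros \<Omega> ss smooth_\<phi>)+
  have "smooth_on \<Omega> n" unfolding n_def[abs_def]
    by (intro smooth_on_add smooth_on_scaleR \<Omega> sw smooth_cd smooth_on_dd smooth_\<phi>)
  then have sx: "smooth_on \<Omega> \<xi>" unfolding \<xi>_def[abs_def]
    by (intro smooth_on_add smooth_on_diff smooth_on_scaleR \<Omega> smooth_g smooth_e)
  have eq: "sff f c M (pt z) (e2 z) (e2 z) = normal_part f c M (pt z) (n z)" "n z \<in> rw_tangent c (\<phi> z)" if z: "z \<in> \<Omega>" for z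
  proof -
    define w where "w = w1 z *\<^sub>R b1 + w2 z *\<^sub>R (b2 :: real ^ 2)"
    have w: "w $ 1 = w1 z" "w $ 2 = w2 z" by (simp_all add: w_def axis_def)
    have "e2 z = s z *\<^sub>R E2 z" by (simp add: e2_def s_def)
    then have e2: "e2 z = dd w \<phi> z"
      unfolding d\<phi>_eq[OF z, of w] w by (simp add: E2_def w1_def w2_def scaleR_diff_right)
    have n: "n z = cd w (\<lambda>y. dd w \<phi> y) z"
      unfolding cd_direction[OF z smooth_on_differentiable[OF smooth_on_dd[OF smooth_\<phi>] z], of w w]
        cd_d\<phi>_eq[OF z, of b1 w] cd_d\<phi>_eq[OF z, of b2 w] w n_def ..
    show "sff f c M (pt z) (e2 z) (e2 z) = normal_part f c M (pt z) (n z)" unfolding e2 n by (rule sff_eq[OF z])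
    show "n z \<in> rw_tangent c (\<phi> z)" unfolding n by (rule cd_d\<phi>_rw_tangent[OF z])
  qed
  have \<xi>: "sff f c M q (e2 (\<kappa> q)) (e2 (\<kappa> q)) = \<xi> (\<kappa> q)" "\<xi> (\<kappa> q) \<in> normal_space f c M q" if q: "q \<in> C" for q
    using eq[OF pt(4)[OF q]] normal_part_e[OF pt(4)[OF q]] normal_part_linear(4)[OF pt(4)[OF q]] pt(3)[OF q] by (simp_all add: \<xi>_def)
  have "smooth_map M C (\<lambda>q. \<xi> (\<kappa> q))"
    by (rule smooth_map_chartI[OF open_part_chart[OF chart] order_refl]) (use sx in \<open>simp add: \<Omega>_def\<close>)
  moreover have "smooth_on \<Omega> ((\<lambda>q. sff f c M q (e2 (\<kappa> q)) (e2 (\<kappa> q))) \<circ> inv_into C \<kappa>)"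
  proof (rule iffD1[OF smooth_on_cong[OF \<Omega>] sx])
    show "\<xi> z = ((\<lambda>q. sff f c M q (e2 (\<kappa> q)) (e2 (\<kappa> q))) \<circ> inv_into C \<kappa>) z" if "z \<in> \<Omega>" for z
      using \<xi>(1)[OF pt(1)[OF that]] pt(2)[OF that] by (simp add: pt_def)
  qed
  then have "smooth_map M C (\<lambda>q. sff f c M q (e2 (\<kappa> q)) (e2 (\<kappa> q)))"
    by (intro smooth_mapI[OF chart open_part_chart[OF chart] order_refl]) (simp only: \<Omega>_def)
  ultimately show ?thesis using \<xi> by (simp add: normal_field_def)
qed

text \<open>\<partial>/\<partial>t is tangent exactly where the spatial parts of the coordinate
  vectors are dependent, that is where their Gram determinant vanishes, a closed condition.\<close>

lemma d_dt_open: "\<exists>G. open G \<and> G \<subseteq> \<Omega> \<and> (\<forall>z\<in>\<Omega>. d_dt \<notin> TM z \<longrightarrow> z \<in> G) \<and> (\<forall>z\<in>G. d_dt \<notin> TM z)"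
proof -
  define x1 x2 where "x1 z = snd (dd b1 \<phi> z)" and "x2 z = snd (dd b2 \<phi> z)" for z
  define gr where "gr z = (x1 z \<bullet> x1 z) * (x2 z \<bullet> x2 z) - (x1 z \<bullet> x2 z)\<^sup>2" for z
  have "smooth_on \<Omega> gr" unfolding gr_def[abs_def] x1_def x2_def by (intro smooth_intros \<Omega> smooth_\<phi>)
  from continuous_open_preimage[OF smooth_on_continuous[OF this] \<Omega> open_Compl[OF closed_singleton[of 0]]]
  have "open (\<Omega> \<inter> gr -` (- {0}))" .
  moreover have "gr z \<noteq> 0" if z: "z \<in> \<Omega>" and d: "d_dt \<notin> TM z" for z
  proof -
    have "gr z > 0" unfolding gr_def x1_def x2_def
    proof (rule gram_pos)
      fix a b assume "a *\<^sub>R snd (dd b1 \<phi> z) + b *\<^sub>R snd (dd b2 \<phi> z) = 0"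
      then show "a = 0 \<and> b = 0" using spatial_independent[OF z d, of 0 a b] by simp
    qed
    then show ?thesis by simp
  qed
  moreover have "gr z = 0" if z: "z \<in> \<Omega>" and d: "d_dt \<in> TM z" for z
  proof -
    obtain a b where ab: "d_dt = a *\<^sub>R dd b1 \<phi> z + b *\<^sub>R dd b2 \<phi> z" using d TM_iff[OF z] by blast
    from arg_cong[OF ab, of snd] have 0: "a *\<^sub>R x1 z + b *\<^sub>R x2 z = 0" by (simp add: d_dt_def x1_def x2_def)
    show ?thesis
    proof (cases "a = 0")
      case False
      have "x1 z = (1 / a) *\<^sub>R (a *\<^sub>R x1 z + b *\<^sub>R x2 z) + (- b / a) *\<^sub>R x2 z" using False by (simp add: scaleR_add_right)
      then have "x1 z = (- b / a) *\<^sub>R x2 z" unfolding 0 by simp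
      then show ?thesis by (simp add: gr_def power2_eq_square)
    next
      case True
      have "b \<noteq> 0" using ab True by (auto simp: d_dt_def zero_prod_def)
      then have "x2 z = 0" using 0 True by simp
      then show ?thesis by (simp add: gr_def)
    qed
  qed
  ultimately show ?thesis by (intro exI[of _ "\<Omega> \<inter> gr -` (- {0})"]) blast
qed

text \<open>By contradiction at the given point: if the null field \<open>N\<close> is not
  orthogonal to \<open>E2\<close> there, the same holds nearby, and an open part of the surface
  falls into a slice or \<partial>/\<partial>t itself is null.\<close>

lemma E1_relative_null:
  assumes i: "\<forall>t\<in>I. deriv (deriv f) t / f t - ((deriv f t)\<^sup>2 + c) / (f t)\<^sup>2 \<noteq> 0"
    and dist: "smooth_line_distribution M (relative_null_space f c M)"
    and slice: "\<not> (\<exists>U P. open_part M U \<and> U \<noteq> {} \<and> totally_geodesic_hypersurface I f c P \<and> imm M ` U \<subseteq> P)"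
    and z: "z \<in> \<Omega>"
  shows "E1 z \<in> relative_null_space f c M (pt z)"
proof -
  have "pt z \<in> pts M" using pt(1)[OF z] C_pts by blast
  then obtain U X where U: "open_part M U" "pt z \<in> U" and X: "tangent_field M U X"
    and N: "\<And>q. q \<in> U \<Longrightarrow> X q \<noteq> 0 \<and> relative_null_space f c M q = span {X q}"
    using dist unfolding smooth_line_distribution_def by blast
  define N where "N y = X (pt y)" for y
  define W where "W = \<kappa> ` (U \<inter> C)"
  have W: "open W" using chart_image_open[OF atlas chart] U(1) by (simp add: W_def open_part_def)
  have WO: "W \<subseteq> \<Omega>" by (auto simp: W_def \<Omega>_def)
  have zW: "z \<in> W" using U(2) pt(1,2)[OF z] unfolding W_def by (metis IntI image_eqI)
  have WU: "pt y \<in> U" if "y \<in> W" for y using that pt(3) by (auto simp: W_def)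
  have sN: "smooth_on W N"
    using smooth_map_in_chart[OF _ chart, of U X] X by (simp add: tangent_field_def W_def N_def[abs_def] pt_def comp_def)
  have Nnz: "N y \<noteq> 0" and Nspan: "relative_null_space f c M (pt y) = span {N y}" if "y \<in> W" for y
    using N[OF WU[OF that]] by (simp_all add: N_def)
  have Nnull: "N y \<in> relative_null_space f c M (pt y)" if "y \<in> W" for y
    unfolding Nspan[OF that] by (simp add: span_base)
  have NT: "N z \<in> TM z" using Nnull[OF zW] tangent_space_pt[OF z] by (simp add: relative_null_space_def)
  \<comment> \<open>The second factor in the curvature formula; up to the factor
    \<open>- f^2\<close> it is the product of \<open>N\<close> with \<open>E2\<close>, so it
    vanishes exactly when \<open>N\<close> is a multiple of \<open>E1\<close>.\<close>
  define k where "k y = fst (dd b1 \<phi> y) * sf_metric c (snd (dd b2 \<phi> y)) (snd (N y)) - fst (dd b2 \<phi> y) * sf_metric c (snd (dd b1 \<phi> y)) (snd (N y))" for y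
  have gk: "g y (N y) (E2 y) = - (f (fst (\<phi> y)))\<^sup>2 * k y" for y
    by (simp add: g_def rw_metric_def fst_E2 k_def) (simp add: E2_def sf_metric_simps sf_metric_commute[of c "snd (N y)"] algebra_simps)
  have kz: "k z = 0"
  proof (rule ccontr)
    assume kz: "k z \<noteq> 0"
    have sm\<phi>: "smooth_on W \<phi>" using smooth_\<phi> WO smooth_on_subset by blast
    have "smooth_on W k" unfolding k_def[abs_def] by (intro smooth_intros W sN sm\<phi>)
    from continuous_open_preimage[OF smooth_on_continuous[OF this] W open_Compl[OF closed_singleton[of 0]]]
    have "open (W \<inter> k -` (- {0}))" .
    moreover define B where "B = W \<inter> k -` (- {0})"
    ultimately have B: "open B" by simp
    have zB: "z \<in> B" using zW kz by (simp add: B_def)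
    have BO: "B \<subseteq> \<Omega>" "B \<subseteq> W" using WO by (auto simp: B_def)
    \<comment> \<open>If \<partial>/\<partial>t were tangent throughout \<open>B\<close> it would
      span the null line at \<open>z\<close>. Then \<open>N z\<close> would have no spatial part,
      forcing \<open>k z = 0\<close>.\<close>
    have "\<exists>y0\<in>B. d_dt \<notin> TM y0"
    proof (rule ccontr)
      assume "\<not> (\<exists>y0\<in>B. d_dt \<notin> TM y0)"
      then have "d_dt \<in> relative_null_space f c M (pt z)" by (intro d_dt_relative_null[OF B zB BO(1)]) blast
      then obtain r where r: "d_dt = r *\<^sub>R N z" unfolding Nspan[OF zW] span_singleton by blast
      then have "r \<noteq> 0" by (auto simp: d_dt_def zero_prod_def)
      moreover have "r *\<^sub>R snd (N z) = 0" using arg_cong[OF r, of snd] by (simp add: d_dt_def)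
      ultimately have "snd (N z) = 0" by simp
      then show False using kz by (simp add: k_def sf_metric_simps)
    qed
    then obtain y0 where y0: "y0 \<in> B" "d_dt \<notin> TM y0" by blast
    obtain G where G: "open G" "G \<subseteq> \<Omega>" "\<And>z. z \<in> \<Omega> \<Longrightarrow> d_dt \<notin> TM z \<Longrightarrow> z \<in> G" "\<And>z. z \<in> G \<Longrightarrow> d_dt \<notin> TM z"
      using d_dt_open by blast
    have "\<exists>U P. open_part M U \<and> U \<noteq> {} \<and> totally_geodesic_hypersurface I f c P \<and> imm M ` U \<subseteq> P"
    proof (rule lies_in_slice)
      show "open (B \<inter> G)" "y0 \<in> B \<inter> G" "B \<inter> G \<subseteq> \<Omega>" using B G y0 BO by auto
      show "d_dt \<notin> TM y" if "y \<in> B \<inter> G" for y using G(4) that by blast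
      fix y v w assume y: "y \<in> B \<inter> G"
      have t: "fst (\<phi> y) \<in> I" and yO: "y \<in> \<Omega>" using fst_\<phi> y BO by auto
      have ft: "f (fst (\<phi> y)) \<noteq> 0" by (rule f_nonzero[OF yO])
      \<comment> \<open>Assumption (i) after clearing the denominator \<open>f^2\<close>.\<close>
      have "f (fst (\<phi> y)) * deriv (deriv f) (fst (\<phi> y)) - (deriv f (fst (\<phi> y)))\<^sup>2 - c \<noteq> 0"
      proof
        assume "f (fst (\<phi> y)) * deriv (deriv f) (fst (\<phi> y)) - (deriv f (fst (\<phi> y)))\<^sup>2 - c = 0"
        then have "(deriv f (fst (\<phi> y)))\<^sup>2 + c = f (fst (\<phi> y)) * deriv (deriv f) (fst (\<phi> y))" by simp
        then show False using bspec[OF i t] ft by (simp add: power2_eq_square)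
      qed
      moreover have "k y \<noteq> 0" using y by (simp add: B_def)
      ultimately show "\<exists>r. cd v (\<lambda>y. dd w \<phi> y) y - r *\<^sub>R d_dt \<in> TM y"
        using second_fundamental_form_along_d_dt[OF W _ WO sN Nnull Nnz, where z = y and v = v and u = w] y BO(2) G(4)[of y]
        unfolding k_def by blast
    qed
    then show False using slice by blast
  qed
  obtain a b where ab: "N z = a *\<^sub>R E1 z + b *\<^sub>R E2 z"
    using NT unfolding TM_E[OF z] span_pair_iff by blast
  have "g z (N z) (E2 z) = 0" using gk[of z] kz by simp
  then have "b = 0" using g_E2[OF z] g_E1_E2[of z] unfolding ab by (simp add: g_simps)
  then have "N z = a *\<^sub>R E1 z" "a \<noteq> 0" using ab Nnz[OF zW] by auto
  then have "E1 z = (1 / a) *\<^sub>R N z" by simp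
  then show ?thesis unfolding Nspan[OF zW] by (simp add: span_base span_scale)
qed

text \<open>Orthonormality makes \<open>X\<close>, \<open>Y\<close> a basis for either choice of
  signs, and by symmetry and linearity of \<open>h\<close> the two given values control all values
  \<open>h(X, _)\<close>.\<close>

lemma relative_null_of_frame:
  assumes z: "z \<in> \<Omega>" and X: "X \<in> TM z" and Y: "Y \<in> TM z"
    and on: "\<bar>g z X X\<bar> = 1" "\<bar>g z Y Y\<bar> = 1" "g z X Y = 0"
    and h: "sff f c M (pt z) X X = 0" "sff f c M (pt z) X Y = 0"
  shows "X \<in> relative_null_space f c M (pt z)"
proof -
  obtain u v where u: "X = dd u \<phi> z" and v: "Y = dd v \<phi> z" using X Y by (auto simp: TM_def)
  let ?F = "\<lambda>y. dd u \<phi> y"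
  have F: "?F differentiable (at z)" by (rule smooth_on_differentiable[OF smooth_on_dd[OF smooth_\<phi>] z])
  have "cd u ?F z \<in> TM z" "cd u (\<lambda>y. dd v \<phi> y) z \<in> TM z"
    using h normal_part_linear(3)[OF z cd_d\<phi>_rw_tangent[OF z] cd_d\<phi>_rw_tangent[OF z]]
    unfolding u v sff_eq[OF z] by simp_all
  then have cu: "cd u ?F z \<in> TM z" and cv: "cd v ?F z \<in> TM z" using cd_d\<phi>_commute[OF z, of u v] by simp_all
  \<comment> \<open>The determinant of the coordinate vectors of \<open>X\<close> and
    \<open>Y\<close>; its being nonzero allows any direction \<open>w\<close> to be expanded by
    Cramer's rule below.\<close>
  define \<Delta> where "\<Delta> = u $ 1 * v $ 2 - u $ 2 * v $ 1"
  have gYX: "g z Y X = 0" using on(3) g_commute by simp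
  have ind: "a = 0 \<and> b = 0" if "a *\<^sub>R X + b *\<^sub>R Y = 0" for a b
  proof -
    have "g z (a *\<^sub>R X + b *\<^sub>R Y) X = 0" "g z (a *\<^sub>R X + b *\<^sub>R Y) Y = 0" unfolding that by (simp_all add: g_simps)
    then show ?thesis using on gYX by (auto simp: g_simps)
  qed
  have "\<Delta> \<noteq> 0"
  proof
    assume D: "\<Delta> = 0"
    have "(v $ 2) *\<^sub>R u - (u $ 2) *\<^sub>R v = 0" "(v $ 1) *\<^sub>R u - (u $ 1) *\<^sub>R v = 0"
      using D by (simp_all add: vec_eq_iff forall_2 \<Delta>_def algebra_simps)
    then have "dd ((v $ 2) *\<^sub>R u - (u $ 2) *\<^sub>R v) \<phi> z = 0" "dd ((v $ 1) *\<^sub>R u - (u $ 1) *\<^sub>R v) \<phi> z = 0"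
      using linear_0[OF linear_d\<phi>[OF z]] by simp_all
    then have "(v $ 2) *\<^sub>R X + (- (u $ 2)) *\<^sub>R Y = 0" "(v $ 1) *\<^sub>R X + (- (u $ 1)) *\<^sub>R Y = 0"
      unfolding u v by (simp_all add: linear_diff[OF linear_d\<phi>[OF z]] linear_scale[OF linear_d\<phi>[OF z]])
    from ind[OF this(1)] ind[OF this(2)] have "u = 0" by (simp add: vec_eq_iff forall_2)
    then have "X = 0" unfolding u using linear_0[OF linear_d\<phi>[OF z]] by simp
    then show False using on(1) by (simp add: g_simps)
  qed
  have "cd w ?F z \<in> TM z" for w
  proof -
    define a b where "a = (w $ 1 * v $ 2 - w $ 2 * v $ 1) / \<Delta>" and "b = (u $ 1 * w $ 2 - u $ 2 * w $ 1) / \<Delta>"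
    have "a * u $ i + b * v $ i = ((w $ 1 * v $ 2 - w $ 2 * v $ 1) * u $ i + (u $ 1 * w $ 2 - u $ 2 * w $ 1) * v $ i) / \<Delta>" for i
      by (simp add: a_def b_def add_divide_distrib)
    moreover have "(w $ 1 * v $ 2 - w $ 2 * v $ 1) * u $ 1 + (u $ 1 * w $ 2 - u $ 2 * w $ 1) * v $ 1 = w $ 1 * \<Delta>"
      "(w $ 1 * v $ 2 - w $ 2 * v $ 1) * u $ 2 + (u $ 1 * w $ 2 - u $ 2 * w $ 1) * v $ 2 = w $ 2 * \<Delta>"
      unfolding \<Delta>_def by (simp_all add: algebra_simps)
    ultimately have w: "w $ 1 = a * u $ 1 + b * v $ 1" "w $ 2 = a * u $ 2 + b * v $ 2"
      using \<open>\<Delta> \<noteq> 0\<close> by simp_all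
    have "cd w ?F z = a *\<^sub>R cd u ?F z + b *\<^sub>R cd v ?F z"
      unfolding cd_direction[OF z F, of w] cd_direction[OF z F, of u] cd_direction[OF z F, of v] w
      by (simp add: algebra_simps)
    then show ?thesis using cu cv by (simp add: subspace_add[OF subspace_TM[OF z]] subspace_scale[OF subspace_TM[OF z]])
  qed
  then show ?thesis unfolding u relative_null_iff[OF z] by blast
qed

end

theorem proposition3p3:
  fixes I :: "real set" and f :: "real \<Rightarrow> real" and c :: real
    and M :: "('m::{t2_space, second_countable_topology}, real ^ 2, vec5) submanifold"
  assumes c: "c \<in> {-1, 0, 1}"
    and I: "open I" "is_interval I"
    and f: "smooth_on I f" "\<forall>t\<in>I. f t \<noteq> 0"
    and surface: "time_like_surface I f c M"
    and i: "\<forall>t\<in>I. deriv (deriv f) t / f t - ((deriv f t)\<^sup>2 + c) / (f t)\<^sup>2 \<noteq> 0"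
    and ii: "\<forall>p\<in>pts M. T_field f c M p \<noteq> 0"
    and iii: "positive_relative_nullity f c M \<longrightarrow>
      smooth_line_distribution M (relative_null_space f c M)"
    and iv: "connected (pts M)"
      "\<not> (\<exists>U P. open_part M U \<and> U \<noteq> {} \<and> totally_geodesic_hypersurface I f c P \<and> imm M ` U \<subseteq> P)"
  shows "positive_relative_nullity f c M \<longleftrightarrow>
    (\<forall>p\<in>pts M. \<exists>U e1 e2 \<xi>. open_part M U \<and> p \<in> U \<and>
       orthonormal_frame f c M U e1 e2 \<and> normal_field f c M U \<xi> \<and>
       (\<forall>q\<in>U. (\<exists>a. e1 q = a *\<^sub>R T_field f c M q) \<and>
          sff f c M q (e1 q) (e1 q) = 0 \<and> sff f c M q (e1 q) (e2 q) = 0 \<and>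
          sff f c M q (e2 q) (e2 q) = \<xi> q))"
    (is "?L \<longleftrightarrow> (\<forall>p\<in>pts M. ?R p)")
proof -
  interpret immersion M
    by (rule rw_submanifold_immersion[of I c M]) (use surface in \<open>simp add: time_like_surface_def\<close>)
  have local_chart: "\<exists>C \<kappa>. rw_surface_chart I f c M C \<kappa> \<and> p \<in> C" if "p \<in> pts M" for p
  proof -
    from chart_at[OF that] obtain C \<kappa> where "(C, \<kappa>) \<in> charts M" "p \<in> C" by blast
    then show ?thesis using c I(1) f surface unfolding rw_surface_chart_def by blast
  qed
  show ?thesis
  proof
    assume L: ?L
    show "\<forall>p\<in>pts M. ?R p"
    proof
      fix p assume "p \<in> pts M"
      then obtain C \<kappa> where "rw_surface_chart I f c M C \<kappa>" and p: "p \<in> C" using local_chart by blast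
      then interpret S: rw_surface_chart I f c M C \<kappa> by simp
      have null: "S.e1 (\<kappa> q) \<in> relative_null_space f c M q" if q: "q \<in> C" for q
        using S.relative_null_scale[OF S.pt(4)[OF q] S.E1_relative_null[OF i mp[OF iii L] iv(2) S.pt(4)[OF q]]] S.pt(3)[OF q]
        unfolding S.e1_def by simp
      have tan: "S.e1 (\<kappa> q) \<in> tangent_space M q" "S.e2 (\<kappa> q) \<in> tangent_space M q" if q: "q \<in> C" for q
        using S.e_TM[OF S.pt(4)[OF q]] S.tangent_space_pt[OF S.pt(4)[OF q]] S.pt(3)[OF q] by simp_all
      have "\<exists>a. S.e1 (\<kappa> q) = a *\<^sub>R T_field f c M q" if q: "q \<in> C" for q
        using S.T_field_e1[OF S.pt(4)[OF q]] S.pt(3)[OF q] by auto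
      then show "?R p"
        using open_part_chart[OF S.chart] p S.orthonormal_frame_e S.sff_e2_normal_field null tan
        by (intro exI[of _ C] exI[of _ "\<lambda>q. S.e1 (\<kappa> q)"] exI[of _ "\<lambda>q. S.e2 (\<kappa> q)"]
            exI[of _ "\<lambda>q. sff f c M q (S.e2 (\<kappa> q)) (S.e2 (\<kappa> q))"]) (simp add: relative_null_space_def)
    qed
  next
    assume R: "\<forall>p\<in>pts M. ?R p"
    show ?L
      unfolding positive_relative_nullity_def
    proof
      fix p assume pM: "p \<in> pts M"
      then obtain C \<kappa> where "rw_surface_chart I f c M C \<kappa>" and p: "p \<in> C" using local_chart by blast
      then interpret S: rw_surface_chart I f c M C \<kappa> by simp
      from R pM obtain U e1 e2 where U: "p \<in> U" and fr: "orthonormal_frame f c M U e1 e2"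
        and h: "sff f c M p (e1 p) (e1 p) = 0" "sff f c M p (e1 p) (e2 p) = 0" by blast
      have im: "imm M p = S.\<phi> (\<kappa> p)" using S.\<phi>_pt[of "\<kappa> p"] S.pt(3)[OF p] by simp
      note z = S.pt(4)[OF p]
      have TM: "tangent_space M p = S.TM (\<kappa> p)" using S.tangent_space_pt[OF z] S.pt(3)[OF p] by simp
      have e: "e1 p \<in> S.TM (\<kappa> p)" "e2 p \<in> S.TM (\<kappa> p)"
        and on: "\<bar>S.g (\<kappa> p) (e1 p) (e1 p)\<bar> = 1" "\<bar>S.g (\<kappa> p) (e2 p) (e2 p)\<bar> = 1" "S.g (\<kappa> p) (e1 p) (e2 p) = 0"
        using fr U by (auto simp: orthonormal_frame_def tangent_field_def TM S.g_def im)
      have "e1 p \<in> relative_null_space f c M p"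
        using S.relative_null_of_frame[OF z e on] h S.pt(3)[OF p] by simp
      moreover have "e1 p \<noteq> 0" using on(1) by (auto simp: S.g_simps)
      \<comment> \<open>A single nonzero null vector suffices, because \<open>dim\<close> is zero
        only for subsets of the zero space.\<close>
      ultimately show "dim (relative_null_space f c M p) > 0" using dim_eq_0 by fastforce
    qed
  qed
qed

end
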